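(* Let $n\ge2$. Suppose that $f\in W^{1,n}_{\mathrm{loc}}(\mathbb{R}^n,\mathbb{R}^n)$ is a mapping of finite distortion, with distortion function $K:\mathbb{R}^n\to[1,\infty)$ satisfying $\mathcal{K}_{n-1}<\infty$. If $f$ is bounded, then $f$ is constant.
   Context: A mapping $f\in W^{1,n}_{\mathrm{loc}}(\Omega,\mathbb{R}^n)$ on a domain $\Omega\subset\mathbb{R}^n$ has finite distortion if there is a measurable function $K:\Omega\to[1,\infty)$ such that $|Df(x)|^n\le K(x)J_f(x)$ for a.e. $x\in\Omega$, where $|Df(x)|$ is the operator norm of the weak differential and $J_f=\det Df$. For measurable $K:\mathbb{R}^n\to[1,\infty)$ and $s>0$, $\mathcal{K}_s:=\sup_{R\ge1}\frac{1}{m_n(B(0,R))}\int_{B(0,R)}K^s\,dm_n$, where $m_n$ is Lebesgue measure. Sobolev maps are identified when equal a.e., so "constant" means a.e. equal to a constant. *)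

theory Defs
  imports "HOL-Analysis.Analysis"
begin

text \<open>Throughout, $\mathbb{R}^n$ is the type \<open>real ^ 'n\<close>, so $n$ is \<open>CARD('n)\<close>; ``measurable''
  and ``almost everywhere'' refer to the completed Lebesgue measure.\<close>

definition domain_set :: "(real ^ 'n) set \<Rightarrow> bool"
  where "domain_set \<Omega> \<longleftrightarrow> open \<Omega> \<and> connected \<Omega> \<and> \<Omega> \<noteq> {}"

definition partial_deriv :: "'n \<Rightarrow> (real ^ 'n \<Rightarrow> real) \<Rightarrow> real ^ 'n \<Rightarrow> real"
  where "partial_deriv j \<phi> x = frechet_derivative \<phi> (at x) (axis j 1)"

primrec Ck_function :: "nat \<Rightarrow> (real ^ 'n \<Rightarrow> real) \<Rightarrow> bool"
  where
    "Ck_function 0 \<phi> \<longleftrightarrow> continuous_on UNIV \<phi>"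
  | "Ck_function (Suc k) \<phi> \<longleftrightarrow>
       (\<forall>x. \<phi> differentiable (at x)) \<and> (\<forall>j. Ck_function k (partial_deriv j \<phi>))"

text \<open>The class $C_c^\infty(\Omega)$, its members being extended by zero to all of
  $\mathbb{R}^n$.\<close>

definition test_functions :: "(real ^ 'n) set \<Rightarrow> (real ^ 'n \<Rightarrow> real) set"
  where "test_functions \<Omega> =
    {\<phi>. (\<forall>k. Ck_function k \<phi>) \<and> compact (closure (support_on UNIV \<phi>)) \<and>
         closure (support_on UNIV \<phi>) \<subseteq> \<Omega>}"

text \<open>$L^p_{\mathrm{loc}}(\Omega)$, for real $p \ge 1$.\<close>

definition Lp_loc :: "(real ^ 'n) set \<Rightarrow> real \<Rightarrow> (real ^ 'n \<Rightarrow> 'b::real_normed_vector) \<Rightarrow> bool"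
  where "Lp_loc \<Omega> p f \<longleftrightarrow>
    f \<in> borel_measurable (lebesgue_on \<Omega>) \<and>
    (\<forall>C. compact C \<and> C \<subseteq> \<Omega> \<longrightarrow> integrable (lebesgue_on C) (\<lambda>x. norm (f x) powr p))"

text \<open>\<open>A\<close> is a weak differential of \<open>f\<close>: the entry \<open>A x $ i $ j\<close> is the weak partial derivative
  $\partial_j f_i$, so that the matrix \<open>A x\<close> acts by \<open>(*v)\<close> as $Df(x)$. It is determined by \<open>f\<close> up to
  null sets.\<close>

definition weak_differential ::
    "(real ^ 'n) set \<Rightarrow> (real ^ 'n \<Rightarrow> real ^ 'm) \<Rightarrow> (real ^ 'n \<Rightarrow> real ^ 'n ^ 'm) \<Rightarrow> bool"
  where "weak_differential \<Omega> f A \<longleftrightarrow>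
    Lp_loc \<Omega> 1 f \<and> Lp_loc \<Omega> 1 A \<and>
    (\<forall>\<phi>\<in>test_functions \<Omega>. \<forall>i j.
       integral\<^sup>L (lebesgue_on \<Omega>) (\<lambda>x. f x $ i * partial_deriv j \<phi> x) =
       - integral\<^sup>L (lebesgue_on \<Omega>) (\<lambda>x. A x $ i $ j * \<phi> x))"

text \<open>$W^{1,p}_{\mathrm{loc}}(\Omega,\mathbb{R}^m)$, for real $p \ge 1$.\<close>

definition W1_loc :: "(real ^ 'n) set \<Rightarrow> real \<Rightarrow> (real ^ 'n \<Rightarrow> real ^ 'm) \<Rightarrow> bool"
  where "W1_loc \<Omega> p f \<longleftrightarrow>
    Lp_loc \<Omega> p f \<and> (\<exists>A. weak_differential \<Omega> f A \<and> Lp_loc \<Omega> p A)"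

definition distortion_function ::
    "(real ^ 'n) set \<Rightarrow> (real ^ 'n \<Rightarrow> real ^ 'n) \<Rightarrow> (real ^ 'n \<Rightarrow> real) \<Rightarrow> bool"
  where "distortion_function \<Omega> f K \<longleftrightarrow>
    K \<in> borel_measurable (lebesgue_on \<Omega>) \<and> (\<forall>x\<in>\<Omega>. 1 \<le> K x) \<and>
    (\<exists>A. weak_differential \<Omega> f A \<and>
       (AE x in lebesgue_on \<Omega>. onorm ((*v) (A x)) ^ CARD('n) \<le> K x * det (A x)))"

definition finite_distortion :: "(real ^ 'n) set \<Rightarrow> (real ^ 'n \<Rightarrow> real ^ 'n) \<Rightarrow> bool"
  where "finite_distortion \<Omega> f \<longleftrightarrow>
    domain_set \<Omega> \<and> W1_loc \<Omega> (real CARD('n)) f \<and> (\<exists>K. distortion_function \<Omega> f K)"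

text \<open>The quantity $\mathcal{K}_s$, as an extended real number.\<close>

definition mean_distortion :: "real \<Rightarrow> (real ^ 'n \<Rightarrow> real) \<Rightarrow> ennreal"
  where "mean_distortion s K =
    (SUP R\<in>{1::real..}.
       (\<integral>\<^sup>+x\<in>ball 0 R. ennreal (K x powr s) \<partial>lebesgue) / emeasure lebesgue (ball (0 :: real ^ 'n) R))"

end

theory Submission
  imports Defs
begin

text \<open>Write \<open>J\<close> for the Jacobian determinant. Since the determinant is a null Lagrangian, mollification gives
  \<open>\<integral> \<phi> J = - \<integral> f\<^sub>i det (Df with row i replaced by \<nabla>\<phi>)\<close> for bounded \<open>f \<in> W\<^sup>1\<^sup>,\<^sup>n\<close> and smooth compactly supported
  \<open>\<phi>\<close>. Take \<open>\<phi> = \<eta>\<^sup>n\<close> with \<open>\<eta> x = h (x / R)\<close> a rescaled bump, and put \<open>g x = R |\<nabla>\<eta>| (x)\<close>. A Young-type splitting and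
  the distortion inequality \<open>|Df|\<^sup>n \<le> K J\<close> bound the right-hand side by
  \<open>C / \<epsilon> \<integral> g \<eta>\<^sup>n J + C \<epsilon>\<^sup>n\<^sup>-\<^sup>1\<close>, where the averages of \<open>K\<^sup>n\<^sup>-\<^sup>1\<close> enter only through the constant. A large \<open>\<epsilon>\<close> shows that
  \<open>J\<close> is integrable. Then \<open>\<integral> g \<eta>\<^sup>n J\<close> tends to \<open>0\<close> as \<open>R\<close> grows, because \<open>\<nabla>h (0) = 0\<close>, and letting \<open>\<epsilon>\<close>
  tend to \<open>0\<close> gives \<open>\<integral> J = 0\<close>. Hence \<open>J\<close>, and with it \<open>Df\<close>, vanishes almost everywhere.\<close>

section \<open>A smooth bump function\<close>


text \<open>Differentiating \<eta>^n costs a factor 1 / R and leaves (\<eta> |Df|)^(n-1), whereas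
  the distortion inequality controls the n-th power, and only with the factor K. A splitting with
  weight \<epsilon> K pays for the missing power with \<epsilon>^(n-1) K^(n-1) / R^n. This is the
  origin of the exponent n - 1 in the hypothesis: bounded means of K^(n-1) say that its integral
  over a ball grows at most like R^n. The resulting term is bounded in R but does not become small
  with R; only \<epsilon> makes it small, and there n >= 2 enters. The other term carries 1 /
  \<epsilon>, so R must tend to infinity before \<epsilon> tends to 0. That limit in R rests on
  dominated convergence with majorant |J|, which is why J has to be integrable beforehand. The
  second obstacle is regularity. Df is only locally in L^n, so the determinants of the mollified
  maps come with no fixed majorant; the majorants used are mollified themselves and converge in
  L^1.\<close>

primrec exp_recip_poly :: "nat \<Rightarrow> real poly" where
  "exp_recip_poly 0 = 1"
| "exp_recip_poly (Suc m) = [:0, 0, 1:] * (exp_recip_poly m - pderiv (exp_recip_poly m))"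

text \<open>The m-th derivative of exp (- 1 / t), extended by zero to t \<le> 0. With u = 1 / t, the
  t-derivative of p(u) exp (- u) is u^2 (p(u) - p'(u)) exp (- u), whence the recursion for
  \<open>exp_recip_poly\<close>.\<close>

definition exp_recip :: "nat \<Rightarrow> real \<Rightarrow> real" where
  "exp_recip m t = (if t > 0 then poly (exp_recip_poly m) (1 / t) * exp (- (1 / t)) else 0)"

text \<open>The free exponent k lets the induction on coefficients pass from
  \<open>pCons a p\<close> to p. With k = 1 and u = 1 / s the expression is the difference quotient
  of \<open>exp_recip\<close> at the origin from the right.\<close>

lemma poly_exp_neg_tendsto_0: "((\<lambda>u::real. u ^ k * poly p u * exp (- u)) \<longlongrightarrow> 0) at_top"
proof (induction p arbitrary: k)
  case 0
  then show ?case by simp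
next
  case (pCons a p)
  have "((\<lambda>u::real. a * (u ^ k / exp u) + u ^ Suc k * poly p u * exp (- u)) \<longlongrightarrow> a * 0 + 0) at_top"
    by (intro tendsto_intros tendsto_power_div_exp_0 pCons.IH)
  moreover have "(\<lambda>u::real. u ^ k * poly (pCons a p) u * exp (- u)) =
      (\<lambda>u. a * (u ^ k / exp u) + u ^ Suc k * poly p u * exp (- u))"
    by (simp add: fun_eq_iff exp_minus field_simps)
  ultimately show ?case by simp
qed

lemma exp_recip_has_derivative: "(exp_recip m has_real_derivative exp_recip (Suc m) t) (at t)"
proof (cases t "0::real" rule: linorder_cases)
  case less
  have "((\<lambda>_. 0) has_real_derivative exp_recip (Suc m) t) (at t)"
    using less by (simp add: exp_recip_def)
  then show ?thesis
  proof (rule DERIV_cong_ev[THEN iffD1, rotated 3])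
    show "\<forall>\<^sub>F x in nhds t. 0 = exp_recip m x"
      using eventually_nhds_in_open[of "{..<0}" t] less
      by (auto simp: exp_recip_def elim!: eventually_mono)
  qed auto
next
  case equal
  have "((\<lambda>u. u ^ 1 * poly (exp_recip_poly m) u * exp (- u)) \<longlongrightarrow> 0) (at_top :: real filter)"
    by (rule poly_exp_neg_tendsto_0)
  then have "(((\<lambda>u. u ^ 1 * poly (exp_recip_poly m) u * exp (- u)) \<circ> inverse) \<longlongrightarrow> 0) (at_right (0::real))"
    unfolding o_def by (rule filterlim_compose) (rule filterlim_inverse_at_top_right)
  moreover have "\<forall>\<^sub>F s in at_right (0::real). ((\<lambda>u. u ^ 1 * poly (exp_recip_poly m) u * exp (- u)) \<circ> inverse) s
      = (exp_recip m (0 + s) - exp_recip m 0) / s"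
    by (rule eventually_at_rightI[of 0 1]) (auto simp: exp_recip_def field_simps)
  ultimately have r: "((\<lambda>s. (exp_recip m (0 + s) - exp_recip m 0) / s) \<longlongrightarrow> 0) (at_right 0)"
    by (rule Lim_transform_eventually)
  have "((\<lambda>s. 0::real) \<longlongrightarrow> 0) (at_left (0::real))" by simp
  moreover have "\<forall>\<^sub>F s in at_left (0::real). 0 = (exp_recip m (0 + s) - exp_recip m 0) / s"
    by (rule eventually_at_leftI[of "-1" 0]) (auto simp: exp_recip_def)
  ultimately have l: "((\<lambda>s. (exp_recip m (0 + s) - exp_recip m 0) / s) \<longlongrightarrow> 0) (at_left 0)"
    by (rule Lim_transform_eventually)
  show ?thesis unfolding DERIV_def equal
    using l r by (auto simp: exp_recip_def intro: filterlim_split_at)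
next
  case greater
  have d: "((\<lambda>s. poly (exp_recip_poly m) (1 / s) * exp (- (1 / s))) has_real_derivative exp_recip (Suc m) t) (at t)"
    using greater
    by (auto intro!: derivative_eq_intros DERIV_chain2[OF poly_DERIV] simp: exp_recip_def field_simps power2_eq_square)
  then show ?thesis
  proof (rule DERIV_cong_ev[THEN iffD1, rotated 3])
    show "\<forall>\<^sub>F x in nhds t. poly (exp_recip_poly m) (1 / x) * exp (- (1 / x)) = exp_recip m x"
      using eventually_nhds_in_open[of "{0<..}" t] greater
      by (auto simp: exp_recip_def elim!: eventually_mono)
  qed auto
qed

text \<open>The \<open>m\<close>-th derivative of the product of \<open>exp_recip a (1 + t)\<close> and \<open>exp_recip b (1 - t)\<close>.\<close>

primrec bump_deriv :: "nat \<Rightarrow> nat \<Rightarrow> nat \<Rightarrow> real \<Rightarrow> real" where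
  "bump_deriv 0 a b t = exp_recip a (1 + t) * exp_recip b (1 - t)"
| "bump_deriv (Suc m) a b t = bump_deriv m (Suc a) b t - bump_deriv m a (Suc b) t"

lemma bump_deriv_has_derivative:
  "(bump_deriv m a b has_real_derivative bump_deriv (Suc m) a b t) (at t)"
proof (induction m arbitrary: a b)
  case 0
  have "((\<lambda>s. exp_recip a (1 + s)) has_real_derivative exp_recip (Suc a) (1 + t) * 1) (at t)"
    by (rule DERIV_chain2[OF exp_recip_has_derivative]) (auto intro!: derivative_eq_intros)
  moreover have "((\<lambda>s. exp_recip b (1 - s)) has_real_derivative exp_recip (Suc b) (1 - t) * (-1)) (at t)"
    by (rule DERIV_chain2[OF exp_recip_has_derivative]) (auto intro!: derivative_eq_intros)
  ultimately have "((\<lambda>s. exp_recip a (1 + s) * exp_recip b (1 - s)) has_real_derivative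
     bump_deriv (Suc 0) a b t) (at t)"
    by (auto intro!: derivative_eq_intros)
  then show ?case unfolding bump_deriv.simps(1)[abs_def] .
next
  case (Suc m)
  have "((\<lambda>t. bump_deriv m (Suc a) b t - bump_deriv m a (Suc b) t) has_real_derivative bump_deriv (Suc (Suc m)) a b t) (at t)"
    by (subst bump_deriv.simps(2)) (intro DERIV_diff Suc)
  then show ?case by simp
qed

lemma bump_deriv_eq_0: "\<bar>t\<bar> \<ge> 1 \<Longrightarrow> bump_deriv m a b t = 0"
  by (induction m arbitrary: a b) (auto simp: exp_recip_def)

definition bump :: "nat \<Rightarrow> real \<Rightarrow> real" where
  "bump m = bump_deriv m 0 0"

lemma bump_has_derivative: "(bump m has_real_derivative bump (Suc m) t) (at t)"
  unfolding bump_def by (rule bump_deriv_has_derivative)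

lemma bump_eq_0: "\<bar>t\<bar> \<ge> 1 \<Longrightarrow> bump m t = 0"
  by (simp add: bump_def bump_deriv_eq_0)

lemma bump_nonneg: "bump 0 t \<ge> 0"
  by (simp add: bump_def exp_recip_def)

lemma bump_pos: "\<bar>t\<bar> < 1 \<Longrightarrow> bump 0 t > 0"
  by (simp add: bump_def exp_recip_def)

text \<open>The two terms of the product rule cancel because the bump is even. This makes the
  gradient of the cutoff vanish at the origin.\<close>

lemma bump_1_0: "bump (Suc 0) 0 = 0"
  by (simp add: bump_def)

text \<open>The partial derivatives of \<open>bump_prod a (\<lambda>_. 0)\<close>, with a multi-index \<open>\<alpha>\<close>. The same family provides the
  test functions, the mollifiers (\<open>a\<close> large) and the cutoff functions (\<open>a\<close> small).\<close>

definition bump_prod :: "real \<Rightarrow> ('n \<Rightarrow> nat) \<Rightarrow> real ^ 'n \<Rightarrow> real" where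
  "bump_prod a \<alpha> x = (\<Prod>i\<in>UNIV. a ^ \<alpha> i * bump (\<alpha> i) (a * x $ i))"

abbreviation incr :: "'n \<Rightarrow> ('n \<Rightarrow> nat) \<Rightarrow> 'n \<Rightarrow> nat" where
  "incr j \<alpha> \<equiv> \<alpha>(j := Suc (\<alpha> j))"

lemma bump_prod_has_derivative:
  "(bump_prod a \<alpha> has_derivative (\<lambda>h. \<Sum>j\<in>UNIV. h $ j * bump_prod a (incr j \<alpha>) x)) (at x)"
proof -
  have 1: "((\<lambda>x. a ^ \<alpha> i * bump (\<alpha> i) (a * x $ i)) has_derivative
      (\<lambda>h. h $ i * (a ^ Suc (\<alpha> i) * bump (Suc (\<alpha> i)) (a * x $ i)))) (at x)" for i
  proof -
    have "((\<lambda>x. bump (\<alpha> i) (a * x $ i)) has_derivative (\<lambda>h. bump (Suc (\<alpha> i)) (a * x $ i) * (a * h $ i))) (at x)"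
      by (rule has_derivative_compose[OF _ bump_has_derivative[unfolded has_field_derivative_def]])
        (intro has_derivative_mult_right bounded_linear_imp_has_derivative bounded_linear_vec_nth)
    then show ?thesis
      by (auto intro!: derivative_eq_intros simp: fun_eq_iff)
  qed
  have "((\<lambda>x. \<Prod>i\<in>UNIV. a ^ \<alpha> i * bump (\<alpha> i) (a * x $ i)) has_derivative
     (\<lambda>h. \<Sum>i\<in>UNIV. h $ i * (a ^ Suc (\<alpha> i) * bump (Suc (\<alpha> i)) (a * x $ i)) *
        (\<Prod>j\<in>UNIV - {i}. a ^ \<alpha> j * bump (\<alpha> j) (a * x $ j)))) (at x)"
    by (intro has_derivative_prod 1)
  moreover have "bump_prod a (incr i \<alpha>) x = (a ^ Suc (\<alpha> i) * bump (Suc (\<alpha> i)) (a * x $ i)) *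
        (\<Prod>j\<in>UNIV - {i}. a ^ \<alpha> j * bump (\<alpha> j) (a * x $ j))" for i
    unfolding bump_prod_def by (subst prod.remove[of _ i]) auto
  ultimately show ?thesis
    by (simp add: bump_prod_def[abs_def] mult.assoc)
qed

lemma continuous_bump_prod: "continuous_on UNIV (bump_prod a \<alpha>)"
  using bump_prod_has_derivative
  by (meson continuous_at_imp_continuous_on has_derivative_continuous)

lemma bump_prod_nonneg: "bump_prod a (\<lambda>_. 0) x \<ge> 0"
  by (auto simp: bump_prod_def bump_nonneg intro!: prod_nonneg)

lemma bump_prod_0_pos: "bump_prod a (\<lambda>_. 0) 0 > 0"
  by (auto simp: bump_prod_def bump_pos intro!: prod_pos)

text \<open>The support lies in a cube of half side 1 / a. The generous radius CARD('n) / a comes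
  from comparing the Euclidean norm with the sum of the moduli of the coordinates.\<close>

lemma bump_prod_eq_0:
  fixes x :: "real ^ 'n"
  assumes "a > 0" "norm x \<ge> real CARD('n) / a"
  shows "bump_prod a \<alpha> x = 0"
proof -
  have "\<exists>i. 1 / a \<le> \<bar>x $ i\<bar>"
  proof (rule ccontr)
    assume "\<nexists>i. 1 / a \<le> \<bar>x $ i\<bar>"
    then have "(\<Sum>i\<in>(UNIV::'n set). \<bar>x $ i\<bar>) < (\<Sum>i\<in>(UNIV::'n set). 1 / a)"
      by (intro sum_strict_mono) (auto simp: not_le)
    with norm_le_l1_cart[of x] assms show False by simp
  qed
  then obtain i where "1 / a \<le> \<bar>x $ i\<bar>" by blast
  then have "bump (\<alpha> i) (a * x $ i) = 0"
    using assms by (intro bump_eq_0) (simp add: abs_mult field_simps)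
  then show ?thesis unfolding bump_prod_def by (intro prod_zero) auto
qed

text \<open>One factor a for each derivative taken. For cutoffs, where the scale is 1 / R, this is
  the factor 1 / R in the gradient.\<close>

lemma bump_prod_scale:
  "bump_prod (a * b) \<alpha> x = a ^ (\<Sum>i\<in>UNIV. \<alpha> i) * bump_prod b \<alpha> (a *\<^sub>R x)"
  by (simp add: bump_prod_def power_sum prod.distrib[symmetric] power_mult_distrib mult_ac)

lemma bounded_bump_prod: "\<exists>B>0. \<forall>x. \<bar>bump_prod a \<alpha> x\<bar> \<le> B" if "a > 0" for \<alpha> :: "'n::finite \<Rightarrow> nat"
proof -
  have "compact (bump_prod a \<alpha> ` cball 0 (real CARD('n) / a))"
    by (intro compact_continuous_image continuous_on_subset[OF continuous_bump_prod]) auto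
  then obtain B where B: "B > 0" "\<And>x. x \<in> cball 0 (real CARD('n) / a) \<Longrightarrow> norm (bump_prod a \<alpha> x) \<le> B"
    by (auto simp: dest!: compact_imp_bounded simp: bounded_pos)
  have "\<bar>bump_prod a \<alpha> x\<bar> \<le> B" for x
    using B(2)[of x] B(1) bump_prod_eq_0[OF that, of x \<alpha>] by (cases "norm x \<le> real CARD('n) / a") auto
  with B(1) show ?thesis by blast
qed

text \<open>As functions of y these are the kernels of convolutions at x, and c will be the
  normalising constant of a mollifier. Differentiability of every order follows by one induction
  over all c and \<alpha>, since the family is closed under partial derivatives.\<close>

lemma test_function_bump_prod:
  fixes x :: "real ^ 'n"
  assumes "a > 0"
  shows "(\<lambda>y. c * bump_prod a \<alpha> (x - y)) \<in> test_functions UNIV"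
    and "partial_deriv j (\<lambda>y. c * bump_prod a \<alpha> (x - y)) = (\<lambda>y. - c * bump_prod a (incr j \<alpha>) (x - y))"
proof -
  have d: "((\<lambda>y. c * bump_prod a \<alpha> (x - y)) has_derivative
      (\<lambda>h. c * (\<Sum>j\<in>UNIV. (- h) $ j * bump_prod a (incr j \<alpha>) (x - y)))) (at y)" for c \<alpha> y
    by (intro has_derivative_mult_right has_derivative_compose[OF _ bump_prod_has_derivative])
      (auto intro!: derivative_eq_intros)
  have pd: "partial_deriv j (\<lambda>y. c * bump_prod a \<alpha> (x - y)) = (\<lambda>y. - c * bump_prod a (incr j \<alpha>) (x - y))" for j c \<alpha>
    unfolding partial_deriv_def fun_eq_iff frechet_derivative_at[OF d, symmetric]
    by (simp add: axis_def if_distrib[of "\<lambda>z. z * _"] sum.delta sum_negf cong: if_cong)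
  then show "partial_deriv j (\<lambda>y. c * bump_prod a \<alpha> (x - y)) = (\<lambda>y. - c * bump_prod a (incr j \<alpha>) (x - y))" .
  have ck: "Ck_function k (\<lambda>y. c * bump_prod a \<alpha> (x - y))" for k c \<alpha>
  proof (induction k arbitrary: c \<alpha>)
    case 0
    have "isCont (\<lambda>y. c * bump_prod a \<alpha> (x - y)) y" for y
      using d has_derivative_continuous by blast
    then show ?case by (simp add: continuous_at_imp_continuous_on)
  next
    case (Suc k)
    then show ?case using d unfolding Ck_function.simps pd differentiable_def by blast
  qed
  have "support_on UNIV (\<lambda>y. c * bump_prod a \<alpha> (x - y)) \<subseteq> cball x (real CARD('n) / a)"
    using bump_prod_eq_0[OF assms, of "x - _" \<alpha>]
    by (force simp: support_on_def dist_norm not_le)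
  then have "bounded (support_on UNIV (\<lambda>y. c * bump_prod a \<alpha> (x - y)))"
    using bounded_cball bounded_subset by blast
  then show "(\<lambda>y. c * bump_prod a \<alpha> (x - y)) \<in> test_functions UNIV"
    by (auto simp: test_functions_def ck)
qed

section \<open>Partial derivatives, convolutions and null Lagrangians\<close>


text \<open>Stated along a coordinate line, so that product rules and the mean value theorem are
  those of one real variable.\<close>

definition has_partial :: "'n \<Rightarrow> (real ^ 'n \<Rightarrow> real) \<Rightarrow> (real ^ 'n \<Rightarrow> real) \<Rightarrow> bool" where
  "has_partial j F F' \<longleftrightarrow> (\<forall>x. ((\<lambda>t. F (x + t *\<^sub>R axis j 1)) has_real_derivative F' x) (at 0))"

lemma has_partial_along_line:
  assumes "has_partial j F F'"
  shows "((\<lambda>t. F (x + t *\<^sub>R axis j 1)) has_real_derivative F' (x + s *\<^sub>R axis j 1)) (at s)"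
proof -
  have "((\<lambda>t. F ((x + s *\<^sub>R axis j 1) + t *\<^sub>R axis j 1)) has_real_derivative F' (x + s *\<^sub>R axis j 1)) (at 0)"
    using assms by (simp add: has_partial_def)
  then have "((\<lambda>t. F (x + (t + s) *\<^sub>R axis j 1)) has_real_derivative F' (x + s *\<^sub>R axis j 1)) (at 0)"
    by (simp add: algebra_simps)
  then show ?thesis
    using DERIV_shift[of "\<lambda>t. F (x + t *\<^sub>R axis j 1)" _ 0 s] by simp
qed

lemma has_partial_increment_bound:
  assumes "has_partial j F F'" and "\<And>x. \<bar>F' x\<bar> \<le> B"
  shows "\<bar>F (x + t *\<^sub>R axis j 1) - F x\<bar> \<le> B * \<bar>t\<bar>"
proof -
  have "norm (F (x + t *\<^sub>R axis j 1) - F (x + 0 *\<^sub>R axis j 1)) \<le> B * norm (t - 0)"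
    by (rule field_differentiable_bound[where S=UNIV and f="\<lambda>t. F (x + t *\<^sub>R axis j 1)"
          and f'="\<lambda>s. F' (x + s *\<^sub>R axis j 1)"])
      (use has_partial_along_line[OF assms(1)] assms(2) in auto)
  then show ?thesis by simp
qed

lemma has_partial_mult:
  assumes "has_partial j F F'" "has_partial j G G'"
  shows "has_partial j (\<lambda>x. F x * G x) (\<lambda>x. F' x * G x + F x * G' x)"
  using assms unfolding has_partial_def by (auto intro!: derivative_eq_intros)

lemma has_partial_power:
  assumes "has_partial j F F'"
  shows "has_partial j (\<lambda>x. F x ^ m) (\<lambda>x. real m * F x ^ (m - 1) * F' x)"
  using assms unfolding has_partial_def by (auto intro!: derivative_eq_intros)

lemma has_partial_prod:
  assumes "\<And>i. i \<in> S \<Longrightarrow> has_partial j (F i) (F' i)"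
  shows "has_partial j (\<lambda>x. \<Prod>i\<in>S. F i x) (\<lambda>x. \<Sum>k\<in>S. F' k x * (\<Prod>l\<in>S - {k}. F l x))"
  unfolding has_partial_def
proof
  fix x
  have "((\<lambda>t. \<Prod>i\<in>S. F i (x + t *\<^sub>R axis j 1)) has_derivative
     (\<lambda>y. \<Sum>k\<in>S. F' k x * y * (\<Prod>l\<in>S - {k}. F l (x + 0 *\<^sub>R axis j 1)))) (at 0)"
    using assms by (intro has_derivative_prod) (auto simp: has_partial_def has_field_derivative_def)
  then show "((\<lambda>t. \<Prod>i\<in>S. F i (x + t *\<^sub>R axis j 1)) has_real_derivative
      (\<Sum>k\<in>S. F' k x * (\<Prod>l\<in>S - {k}. F l x))) (at 0)"
    unfolding has_field_derivative_def
    by (rule has_derivative_eq_rhs) (simp add: fun_eq_iff sum_distrib_left mult_ac)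
qed

lemma has_partial_bump_prod: "has_partial j (bump_prod a \<alpha>) (bump_prod a (incr j \<alpha>))"
  unfolding has_partial_def
proof
  fix x
  have "((\<lambda>t. bump_prod a \<alpha> (x + t *\<^sub>R axis j 1)) has_derivative
      (\<lambda>t. \<Sum>i\<in>UNIV. (t *\<^sub>R axis j 1) $ i * bump_prod a (incr i \<alpha>) (x + 0 *\<^sub>R axis j 1))) (at 0)"
    by (rule has_derivative_compose[OF _ bump_prod_has_derivative]) (auto intro!: derivative_eq_intros)
  then show "((\<lambda>t. bump_prod a \<alpha> (x + t *\<^sub>R axis j 1)) has_real_derivative bump_prod a (incr j \<alpha>) x) (at 0)"
    unfolding has_field_derivative_def
    by (rule has_derivative_eq_rhs)
      (simp add: fun_eq_iff axis_def if_distrib[of "\<lambda>z. z * _"] if_distrib[of "\<lambda>z. _ * z"] sum.delta mult_ac cong: if_cong)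
qed

section \<open>Convolution with continuous kernels of bounded support\<close>

lemma distr_lborel_reflect: "distr lborel borel (\<lambda>y. x - y) = (lborel :: ('a :: euclidean_space) measure)"
proof -
  have "(\<lambda>y. x + (\<Sum>j\<in>Basis. ((-1) * (y \<bullet> j)) *\<^sub>R j)) = (\<lambda>y. x - y)"
    by (simp add: fun_eq_iff sum_negf euclidean_representation)
  then show ?thesis
    using lborel_affine_euclidean[of "\<lambda>_. -1" x] by (simp add: density_1)
qed

lemma integral_reflect:
  fixes F :: "'a::euclidean_space \<Rightarrow> 'b::{banach, second_countable_topology}"
  assumes "F \<in> borel_measurable borel"
  shows "(\<integral>y. F (x - y) \<partial>lborel) = (\<integral>y. F y \<partial>lborel)"
  by (subst (2) distr_lborel_reflect[of x, symmetric], subst integral_distr) (use assms in auto)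

lemma nn_integral_translate:
  fixes F :: "'a::euclidean_space \<Rightarrow> ennreal"
  assumes "F \<in> borel_measurable borel"
  shows "(\<integral>\<^sup>+y. F (y - x) \<partial>lborel) = (\<integral>\<^sup>+y. F y \<partial>lborel)"
proof -
  have "(\<integral>\<^sup>+y. F (- x + y) \<partial>lborel) = (\<integral>\<^sup>+y. F y \<partial>lborel)"
    by (subst (2) lborel_distr_plus[of "- x", symmetric], subst nn_integral_distr) (use assms in auto)
  then show ?thesis by simp
qed

text \<open>Borel measurability is demanded because Fubini and translation are applied on
  \<open>lborel\<close>. The Lebesgue measurable data of the theorem are replaced by Borel
  representatives in the last section.\<close>

definition loc_integrable :: "('a::euclidean_space \<Rightarrow> real) \<Rightarrow> bool" where
  "loc_integrable g \<longleftrightarrow> g \<in> borel_measurable borel \<and> (\<forall>R. set_integrable lborel (cball 0 R) g)"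

definition conv :: "('a::euclidean_space \<Rightarrow> real) \<Rightarrow> ('a \<Rightarrow> real) \<Rightarrow> 'a \<Rightarrow> real" where
  "conv \<psi> g x = (\<integral>y. \<psi> (x - y) * g y \<partial>lborel)"

definition bounded_support :: "('a::euclidean_space \<Rightarrow> real) \<Rightarrow> bool" where
  "bounded_support \<psi> \<longleftrightarrow> (\<exists>r. \<forall>x. norm x \<ge> r \<longrightarrow> \<psi> x = 0)"

lemma bounded_support_bound:
  fixes \<psi> :: "'a::euclidean_space \<Rightarrow> real"
  assumes "continuous_on UNIV \<psi>" "bounded_support \<psi>"
  obtains B r where "B > 0" "r > 0" "\<And>x. \<bar>\<psi> x\<bar> \<le> B * indicator (cball 0 r) x"
proof -
  obtain r0 where r0: "\<And>x. norm x \<ge> r0 \<Longrightarrow> \<psi> x = 0"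
    using assms(2) by (auto simp: bounded_support_def)
  define r where "r = max r0 1"
  have r: "r > 0" "\<And>x. norm x \<ge> r \<Longrightarrow> \<psi> x = 0" using r0 by (auto simp: r_def)
  have "compact (\<psi> ` cball 0 r)"
    by (intro compact_continuous_image continuous_on_subset[OF assms(1)]) auto
  then obtain B where B: "B > 0" "\<And>x. x \<in> cball 0 r \<Longrightarrow> norm (\<psi> x) \<le> B"
    by (auto dest!: compact_imp_bounded simp: bounded_pos)
  have "\<bar>\<psi> x\<bar> \<le> B * indicator (cball 0 r) x" for x
    using B(2)[of x] r(2)[of x] by (cases "norm x \<le> r") (auto simp: indicator_def)
  with B(1) r(1) that show ?thesis by blast
qed

lemma loc_integrable_const: "loc_integrable (\<lambda>_. c)"
  by (auto simp: loc_integrable_def set_integrable_def intro!: integrable_mult_left integrable_real_indicator emeasure_compact_finite)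

lemma loc_integrable_abs: "loc_integrable g \<Longrightarrow> loc_integrable (\<lambda>x. \<bar>g x\<bar>)"
  by (auto simp: loc_integrable_def intro!: set_integrable_abs)

lemma continuous_imp_borel [measurable (raw)]: "continuous_on UNIV f \<Longrightarrow> f \<in> borel_measurable borel"
  by (rule borel_measurable_continuous_onI)

lemma integrable_bounded_support_mult:
  assumes "loc_integrable g" "continuous_on UNIV \<psi>" "bounded_support \<psi>"
  shows "integrable lborel (\<lambda>y. \<psi> y * g y)"
proof -
  obtain B r where B: "B > 0" "\<And>x. \<bar>\<psi> x\<bar> \<le> B * indicator (cball 0 r) x"
    using bounded_support_bound[OF assms(2,3)] by metis
  have [measurable]: "g \<in> borel_measurable borel" using assms(1) by (simp add: loc_integrable_def)
  have [measurable]: "\<psi> \<in> borel_measurable borel" using assms(2) by (rule continuous_imp_borel)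
  show ?thesis
  proof (rule Bochner_Integration.integrable_bound)
    show "integrable lborel (\<lambda>x. B * (indicat_real (cball 0 r) x *\<^sub>R g x))"
      using assms(1) by (auto simp: loc_integrable_def set_integrable_def)
    show "AE x in lborel. norm (\<psi> x * g x) \<le> norm (B * (indicat_real (cball 0 r) x *\<^sub>R g x))"
    proof (rule AE_I2)
      fix x show "norm (\<psi> x * g x) \<le> norm (B * (indicat_real (cball 0 r) x *\<^sub>R g x))"
        using mult_right_mono[OF B(2)[of x] abs_ge_zero[of "g x"]] B(1) by (simp add: abs_mult mult_ac)
    qed
  qed simp
qed

lemma bounded_support_reflect: "bounded_support \<psi> \<Longrightarrow> bounded_support (\<lambda>y. \<psi> (x - y))"
proof -
  assume "bounded_support \<psi>"
  then obtain r where r: "\<And>x. norm x \<ge> r \<Longrightarrow> \<psi> x = 0" by (auto simp: bounded_support_def)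
  have "\<psi> (x - y) = 0" if "norm y \<ge> r + norm x" for y
    using that norm_triangle_ineq2[of y x] by (intro r) (simp add: norm_minus_commute)
  then show ?thesis by (auto simp: bounded_support_def)
qed

lemma integrable_conv:
  assumes "loc_integrable g" "continuous_on UNIV \<psi>" "bounded_support \<psi>"
  shows "integrable lborel (\<lambda>y. \<psi> (x - y) * g y)"
  by (intro integrable_bounded_support_mult assms bounded_support_reflect
      continuous_on_compose2[OF assms(2)] continuous_intros) auto

lemma continuous_conv:
  fixes g :: "'a::euclidean_space \<Rightarrow> real"
  assumes g: "loc_integrable g" and \<psi>: "continuous_on UNIV \<psi>" "bounded_support \<psi>"
  shows "continuous_on UNIV (conv \<psi> g)"
  unfolding continuous_on_sequentially o_def
proof (intro ballI allI impI, elim conjE)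
  fix X and x :: 'a
  assume X: "X \<longlonglongrightarrow> x"
  obtain B r where B: "B > 0" "r > 0" "\<And>x. \<bar>\<psi> x\<bar> \<le> B * indicator (cball 0 r) x"
    using bounded_support_bound[OF \<psi>] by metis
  have [measurable]: "g \<in> borel_measurable borel" using g by (simp add: loc_integrable_def)
  have [measurable]: "\<psi> \<in> borel_measurable borel" using \<psi>(1) by (rule continuous_imp_borel)
  \<comment> \<open>A bound b for the sequence places all kernels \<open>\<psi> (X n - y)\<close> on
    one ball of radius b + r, which gives a majorant independent of n.\<close>
  have "bounded (range X)" using X by (rule convergent_imp_bounded)
  then obtain b where b: "\<And>n. norm (X n) \<le> b" by (auto simp: bounded_iff)
  show "(\<lambda>n. conv \<psi> g (X n)) \<longlonglongrightarrow> conv \<psi> g x"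
    unfolding conv_def
  proof (rule integral_dominated_convergence[where w="\<lambda>y. B * \<bar>indicat_real (cball 0 (b + r)) y *\<^sub>R g y\<bar>"])
    show "integrable lborel (\<lambda>y. B * \<bar>indicat_real (cball 0 (b + r)) y *\<^sub>R g y\<bar>)"
      using g by (auto simp: loc_integrable_def set_integrable_def)
    show "AE y in lborel. (\<lambda>n. \<psi> (X n - y) * g y) \<longlonglongrightarrow> \<psi> (x - y) * g y"
      by (intro AE_I2 tendsto_intros continuous_on_tendsto_compose[OF \<psi>(1)] X) auto
    fix n
    show "AE y in lborel. norm (\<psi> (X n - y) * g y) \<le> B * \<bar>indicat_real (cball 0 (b + r)) y *\<^sub>R g y\<bar>"
    proof (rule AE_I2)
      fix y
      have "\<bar>\<psi> (X n - y)\<bar> \<le> B * indicat_real (cball 0 (b + r)) y"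
        using B(3)[of "X n - y"] B(1) b[of n] norm_triangle_sub[of y "X n"]
        by (cases "norm (X n - y) \<le> r") (auto simp: indicator_def norm_minus_commute)
      from mult_right_mono[OF this abs_ge_zero[of "g y"]]
      show "norm (\<psi> (X n - y) * g y) \<le> B * \<bar>indicat_real (cball 0 (b + r)) y *\<^sub>R g y\<bar>"
        by (simp add: abs_mult mult_ac)
    qed
  qed auto
qed

text \<open>The derivative falls on the kernel, so local integrability of g suffices. The mean value
  theorem bounds the difference quotients of \<psi> by the supremum of \<psi>', and for bounded
  increments they are supported in a fixed ball, so dominated convergence applies.\<close>

lemma has_partial_conv:
  fixes g :: "real ^ 'n \<Rightarrow> real"
  assumes g: "loc_integrable g" and \<psi>: "continuous_on UNIV \<psi>" "bounded_support \<psi>"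
    and \<psi>': "continuous_on UNIV \<psi>'" "bounded_support \<psi>'" and pd: "has_partial j \<psi> \<psi>'"
  shows "has_partial j (conv \<psi> g) (conv \<psi>' g)"
  unfolding has_partial_def
proof
  fix x :: "real ^ 'n"
  let ?e = "axis j 1 :: real ^ 'n"
  obtain B r where B: "B > 0" "r > 0" "\<And>x. \<bar>\<psi> x\<bar> \<le> B * indicator (cball 0 r) x"
    using bounded_support_bound[OF \<psi>] by metis
  obtain B' r' where B': "B' > 0" "r' > 0" "\<And>x. \<bar>\<psi>' x\<bar> \<le> B' * indicator (cball 0 r') x"
    using bounded_support_bound[OF \<psi>'] by metis
  have B'2: "\<bar>\<psi>' y\<bar> \<le> B'" for y using B'(3)[of y] B'(1)
    by (cases "norm y \<le> r'") auto
  have [measurable]: "g \<in> borel_measurable borel" using g by (simp add: loc_integrable_def)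
  have [measurable]: "\<psi> \<in> borel_measurable borel" using \<psi>(1) by (rule continuous_imp_borel)
  have [measurable]: "\<psi>' \<in> borel_measurable borel" using \<psi>'(1) by (rule continuous_imp_borel)
  show "((\<lambda>t. conv \<psi> g (x + t *\<^sub>R ?e)) has_real_derivative conv \<psi>' g x) (at 0)"
    unfolding DERIV_def tendsto_at_iff_sequentially o_def
  proof (intro allI impI)
    fix X :: "nat \<Rightarrow> real"
    assume X0: "\<forall>i. X i \<in> UNIV - {0}" and X: "X \<longlonglongrightarrow> 0"
    have "bounded (range X)" using X by (rule convergent_imp_bounded)
    then obtain b where b: "\<And>n. \<bar>X n\<bar> \<le> b" by (auto simp: bounded_iff)
    then have b0: "b \<ge> 0" using abs_ge_zero order.trans by blast
    have eq: "(conv \<psi> g (x + (0 + X n) *\<^sub>R ?e) - conv \<psi> g (x + 0 *\<^sub>R ?e)) / X n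
       = (\<integral>y. ((\<psi> (x + X n *\<^sub>R ?e - y) - \<psi> (x - y)) / X n) * g y \<partial>lborel)" for n
    proof -
      have "conv \<psi> g (x + (0 + X n) *\<^sub>R ?e) - conv \<psi> g (x + 0 *\<^sub>R ?e)
          = (\<integral>y. \<psi> (x + X n *\<^sub>R ?e - y) * g y - \<psi> (x - y) * g y \<partial>lborel)"
        unfolding conv_def by (simp add: Bochner_Integration.integral_diff integrable_conv g \<psi>)
      then show ?thesis
        by (simp add: algebra_simps diff_divide_distrib flip: integral_divide_zero)
    qed
    show "(\<lambda>n. (conv \<psi> g (x + (0 + X n) *\<^sub>R ?e) - conv \<psi> g (x + 0 *\<^sub>R ?e)) / X n) \<longlonglongrightarrow> conv \<psi>' g x"
      unfolding eq unfolding conv_def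
    proof (rule integral_dominated_convergence[where w="\<lambda>y. B' * \<bar>indicat_real (cball 0 (norm x + b + r)) y *\<^sub>R g y\<bar>"])
      show "integrable lborel (\<lambda>y. B' * \<bar>indicat_real (cball 0 (norm x + b + r)) y *\<^sub>R g y\<bar>)"
        using g by (auto simp: loc_integrable_def set_integrable_def)
      show "AE y in lborel. (\<lambda>n. (\<psi> (x + X n *\<^sub>R ?e - y) - \<psi> (x - y)) / X n * g y) \<longlonglongrightarrow> \<psi>' (x - y) * g y"
      proof (intro AE_I2 tendsto_intros)
        fix y
        have "((\<lambda>t. \<psi> (x - y + t *\<^sub>R ?e)) has_real_derivative \<psi>' (x - y)) (at 0)"
          using pd by (simp add: has_partial_def)
        then show "(\<lambda>n. (\<psi> (x + X n *\<^sub>R ?e - y) - \<psi> (x - y)) / X n) \<longlonglongrightarrow> \<psi>' (x - y)"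
          unfolding DERIV_def tendsto_at_iff_sequentially o_def using X0 X
          by (auto simp: algebra_simps)
      qed
      fix n
      show "AE y in lborel. norm ((\<psi> (x + X n *\<^sub>R ?e - y) - \<psi> (x - y)) / X n * g y)
          \<le> B' * \<bar>indicat_real (cball 0 (norm x + b + r)) y *\<^sub>R g y\<bar>"
      proof (rule AE_I2)
        fix y
        have n0: "X n \<noteq> 0" using X0 by auto
        have "\<bar>\<psi> (x - y + X n *\<^sub>R ?e) - \<psi> (x - y)\<bar> \<le> B' * \<bar>X n\<bar>"
          by (rule has_partial_increment_bound[OF pd B'2])
        then have 1: "\<bar>(\<psi> (x + X n *\<^sub>R ?e - y) - \<psi> (x - y)) / X n\<bar> \<le> B'"
          using n0 by (simp add: algebra_simps abs_divide field_simps)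
        have "\<bar>(\<psi> (x + X n *\<^sub>R ?e - y) - \<psi> (x - y)) / X n\<bar> \<le> B' * indicat_real (cball 0 (norm x + b + r)) y"
        proof (cases "norm y \<le> norm x + b + r")
          case False
          have "norm (X n *\<^sub>R ?e) \<le> b" using b[of n] by simp
          then have "norm (x + X n *\<^sub>R ?e - y) > r" "norm (x - y) > r"
            using False norm_triangle_ineq2[of y "x + X n *\<^sub>R ?e"] norm_triangle_ineq2[of y x]
              norm_triangle_ineq[of x "X n *\<^sub>R ?e"] b0 by (simp_all add: norm_minus_commute)
          then have "\<psi> (x + X n *\<^sub>R ?e - y) = 0" "\<psi> (x - y) = 0"
            using B(3)[of "x + X n *\<^sub>R ?e - y"] B(3)[of "x - y"] by auto
          then show ?thesis using B'(1) by simp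
        qed (use 1 in auto)
        from mult_right_mono[OF this abs_ge_zero[of "g y"]]
        show "norm ((\<psi> (x + X n *\<^sub>R ?e - y) - \<psi> (x - y)) / X n * g y)
          \<le> B' * \<bar>indicat_real (cball 0 (norm x + b + r)) y *\<^sub>R g y\<bar>"
          by (simp add: abs_mult mult_ac)
      qed
    qed auto
  qed
qed

section \<open>Integrals of partial derivatives and of determinants with a gradient row\<close>

text \<open>Convolving with the constant 1 returns the integral of the kernel at every point.
  Differentiating this constant function of x under the integral gives the claim.\<close>

lemma integral_partial_eq_0:
  assumes "continuous_on UNIV \<psi>" "bounded_support \<psi>"
    and "continuous_on UNIV \<psi>'" "bounded_support \<psi>'" and "has_partial j \<psi> \<psi>'"
  shows "(\<integral>x. \<psi>' x \<partial>lborel) = 0"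
proof -
  have "has_partial j (conv \<psi> (\<lambda>_. 1)) (conv \<psi>' (\<lambda>_. 1))"
    by (intro has_partial_conv loc_integrable_const assms)
  moreover have "conv \<psi> (\<lambda>_. 1) = (\<lambda>_. \<integral>x. \<psi> x \<partial>lborel)" "conv \<psi>' (\<lambda>_. 1) = (\<lambda>_. \<integral>x. \<psi>' x \<partial>lborel)"
    using assms by (simp_all add: conv_def fun_eq_iff integral_reflect continuous_imp_borel)
  ultimately have "((\<lambda>t. \<integral>x. \<psi> x \<partial>lborel) has_real_derivative (\<integral>x. \<psi>' x \<partial>lborel)) (at 0)"
    by (simp add: has_partial_def)
  then show ?thesis using DERIV_const DERIV_unique by blast
qed

text \<open>Composing p with the transposition of i0 and k exchanges p i0 and p k, keeps the other
  factors and flips the sign. By the symmetry of W the sum equals its own negative. In the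
  application W consists of the second derivatives of the k-th component.\<close>

lemma sum_sign_swap_eq_0:
  fixes W :: "'n::finite \<Rightarrow> 'n \<Rightarrow> real"
  assumes "k \<noteq> i0" "\<And>a b. W a b = W b a"
  shows "(\<Sum>p | p permutes (UNIV::'n set). of_int (sign p) * (W (p k) (p i0) * (\<Prod>l\<in>UNIV - {i0} - {k}. V l (p l)))) = 0"
    (is "?S = 0")
proof -
  let ?\<tau> = "Transposition.transpose i0 k"
  have "?S = (\<Sum>p | p permutes (UNIV::'n set). of_int (sign (p \<circ> ?\<tau>)) *
      (W ((p \<circ> ?\<tau>) k) ((p \<circ> ?\<tau>) i0) * (\<Prod>l\<in>UNIV - {i0} - {k}. V l ((p \<circ> ?\<tau>) l))))"
    by (rule sum_permutations_compose_right) (simp add: permutes_swap_id)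
  also have "\<dots> = (\<Sum>p | p permutes (UNIV::'n set). - (of_int (sign p) *
      (W (p k) (p i0) * (\<Prod>l\<in>UNIV - {i0} - {k}. V l (p l)))))"
  proof (rule sum.cong)
    fix p :: "'n \<Rightarrow> 'n" assume "p \<in> {p. p permutes UNIV}"
    then have "permutation p" by (simp add: permutation_permutes) (use finite in blast)
    then have "sign (p \<circ> ?\<tau>) = - sign p"
      using assms(1) by (simp add: sign_compose permutation_swap_id sign_swap_id)
    moreover have "(\<Prod>l\<in>UNIV - {i0} - {k}. V l ((p \<circ> ?\<tau>) l)) = (\<Prod>l\<in>UNIV - {i0} - {k}. V l (p l))"
      by (rule prod.cong) (auto simp: transpose_def)
    ultimately show "of_int (sign (p \<circ> ?\<tau>)) *
      (W ((p \<circ> ?\<tau>) k) ((p \<circ> ?\<tau>) i0) * (\<Prod>l\<in>UNIV - {i0} - {k}. V l ((p \<circ> ?\<tau>) l)))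
      = - (of_int (sign p) * (W (p k) (p i0) * (\<Prod>l\<in>UNIV - {i0} - {k}. V l (p l))))"
      using assms(2) by simp
  qed simp
  finally show ?thesis by (simp add: sum_negf)
qed

lemma bounded_support_mult: "bounded_support u \<Longrightarrow> bounded_support (\<lambda>x. u x * v x)"
  "bounded_support u \<Longrightarrow> bounded_support (\<lambda>x. v x * u x)"
  by (auto simp: bounded_support_def)

lemma bounded_support_add:
  assumes "bounded_support u" "bounded_support v"
  shows "bounded_support (\<lambda>x. u x + v x)"
proof -
  obtain r s where "\<forall>x. norm x \<ge> r \<longrightarrow> u x = 0" "\<forall>x. norm x \<ge> s \<longrightarrow> v x = 0"
    using assms by (auto simp: bounded_support_def)
  then have "\<forall>x. norm x \<ge> max r s \<longrightarrow> u x + v x = 0" by auto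
  then show ?thesis unfolding bounded_support_def by blast
qed

text \<open>The determinant is a null Lagrangian: it is a sum of partial derivatives of compactly supported
  functions, because the terms with second derivatives cancel in pairs.\<close>

lemma integral_det_gradient_eq_0:
  fixes u :: "real ^ 'n \<Rightarrow> real" and U :: "'n \<Rightarrow> real ^ 'n \<Rightarrow> real"
    and V :: "'n \<Rightarrow> 'n \<Rightarrow> real ^ 'n \<Rightarrow> real" and W :: "'n \<Rightarrow> 'n \<Rightarrow> 'n \<Rightarrow> real ^ 'n \<Rightarrow> real"
  assumes u: "continuous_on UNIV u" "bounded_support u"
    and U: "\<And>j. continuous_on UNIV (U j)" "\<And>j. bounded_support (U j)" "\<And>j. has_partial j u (U j)"
    and V: "\<And>i j. continuous_on UNIV (V i j)"
    and W: "\<And>i j l. continuous_on UNIV (W i j l)" "\<And>i j l. has_partial l (V i j) (W i j l)"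
    and sym: "\<And>i j l x. W i j l x = W i l j x"
  shows "(\<integral>x. det (\<chi> i j. if i = i0 then U j x else V i j x) \<partial>lborel) = 0"
proof -
  define P where "P = {p. p permutes (UNIV::'n set)}"
  \<comment> \<open>Differentiating \<open>F p\<close> in direction p i0 yields the Leibniz summand
    for p of the determinant with the gradient of u in row i0, plus terms in W. Summed over p with
    signs, the latter cancel.\<close>
  define F where "F p x = u x * (\<Prod>i\<in>UNIV - {i0}. V i (p i) x)" for p x
  define F' where "F' p x = U (p i0) x * (\<Prod>i\<in>UNIV - {i0}. V i (p i) x) +
     u x * (\<Sum>k\<in>UNIV - {i0}. W k (p k) (p i0) x * (\<Prod>l\<in>UNIV - {i0} - {k}. V l (p l) x))" for p x
  have pd: "has_partial (p i0) (F p) (F' p)" for p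
    unfolding F_def F'_def by (intro has_partial_mult has_partial_prod U W)
  have c: "continuous_on UNIV (F p)" "continuous_on UNIV (F' p)" for p
    unfolding F_def F'_def by (intro continuous_intros u U V W)+
  have b: "bounded_support (F p)" "bounded_support (F' p)" for p
    unfolding F_def F'_def by (intro bounded_support_add bounded_support_mult u U)+
  have int: "integrable lborel (F' p)" for p
    using integrable_bounded_support_mult[OF loc_integrable_const[of 1] c(2) b(2)] by simp
  have "det (\<chi> i j. if i = i0 then U j x else V i j x) = (\<Sum>p\<in>P. of_int (sign p) * F' p x)" for x
  proof -
    have "(\<Sum>p\<in>P. of_int (sign p) * F' p x) =
        (\<Sum>p\<in>P. of_int (sign p) * (U (p i0) x * (\<Prod>i\<in>UNIV - {i0}. V i (p i) x))) +
        u x * (\<Sum>k\<in>UNIV - {i0}. \<Sum>p\<in>P. of_int (sign p) *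
          (W k (p k) (p i0) x * (\<Prod>l\<in>UNIV - {i0} - {k}. V l (p l) x)))"
      unfolding F'_def
      by (subst sum.swap) (simp add: algebra_simps sum.distrib sum_distrib_left)
    also have "(\<Sum>k\<in>UNIV - {i0}. \<Sum>p\<in>P. of_int (sign p) *
          (W k (p k) (p i0) x * (\<Prod>l\<in>UNIV - {i0} - {k}. V l (p l) x))) = 0"
      unfolding P_def using sum_sign_swap_eq_0[of _ i0 "\<lambda>a b. W _ a b x" "\<lambda>l j. V l j x"] sym
      by (intro sum.neutral) blast
    also have "(\<Sum>p\<in>P. of_int (sign p) * (U (p i0) x * (\<Prod>i\<in>UNIV - {i0}. V i (p i) x))) =
       (\<Sum>p\<in>P. of_int (sign p) * (\<Prod>i\<in>UNIV. if i = i0 then U (p i) x else V i (p i) x))"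
      by (intro sum.cong refl arg_cong2[where f="(*)"], subst prod.remove[of UNIV i0])
        (auto intro!: prod.cong)
    finally show ?thesis by (simp add: det_def P_def)
  qed
  then have "(\<integral>x. det (\<chi> i j. if i = i0 then U j x else V i j x) \<partial>lborel)
      = (\<Sum>p\<in>P. of_int (sign p) * (\<integral>x. F' p x \<partial>lborel))"
    using int by simp
  also have "\<dots> = 0"
    using integral_partial_eq_0[OF c(1) b(1) c(2) b(2) pd] by simp
  finally show ?thesis .
qed

section \<open>Mollification\<close>


text \<open>The radius d is a parameter because the approximation estimates depend on the kernel
  through d alone.\<close>

definition mollifier :: "('a::euclidean_space \<Rightarrow> real) \<Rightarrow> real \<Rightarrow> bool" where
  "mollifier \<psi> d \<longleftrightarrow> continuous_on UNIV \<psi> \<and> (\<forall>x. 0 \<le> \<psi> x) \<and> (\<forall>x. norm x \<ge> d \<longrightarrow> \<psi> x = 0) \<and>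
     (\<integral>x. \<psi> x \<partial>lborel) = 1"

lemma mollifierD:
  assumes "mollifier \<psi> d"
  shows "continuous_on UNIV \<psi>" "0 \<le> \<psi> x" "norm x \<ge> d \<Longrightarrow> \<psi> x = 0" "(\<integral>x. \<psi> x \<partial>lborel) = 1"
    "bounded_support \<psi>" "\<psi> \<in> borel_measurable borel" "integrable lborel \<psi>"
  using assms continuous_imp_borel[of \<psi>] not_integrable_integral_eq[of lborel \<psi>]
  by (auto simp: mollifier_def bounded_support_def)

definition moll :: "nat \<Rightarrow> real ^ 'n \<Rightarrow> real" where
  "moll k x = inverse (\<integral>y. bump_prod (Suc k) (\<lambda>_. 0) (y :: real ^ 'n) \<partial>lborel) * bump_prod (Suc k) (\<lambda>_. 0) x"

lemma bounded_support_bump_prod: "a > 0 \<Longrightarrow> bounded_support (bump_prod a \<alpha>)"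
  unfolding bounded_support_def using bump_prod_eq_0 by blast

text \<open>A vanishing integral would make the nonempty open set on which the bump is positive a
  null set.\<close>

lemma integral_bump_prod_pos:
  assumes "a > 0"
  shows "(\<integral>y. bump_prod a (\<lambda>_. 0) (y :: real ^ 'n) \<partial>lborel) > 0"
proof -
  let ?b = "bump_prod a (\<lambda>_. 0) :: real ^ 'n \<Rightarrow> real"
  have i: "integrable lborel ?b"
    using integrable_bounded_support_mult[OF loc_integrable_const[of 1] continuous_bump_prod bounded_support_bump_prod] assms
    by simp
  have "(\<integral>y. ?b y \<partial>lborel) \<noteq> 0"
  proof
    assume "(\<integral>y. ?b y \<partial>lborel) = 0"
    then have "AE y in lborel. ?b y = 0"
      using integral_nonneg_eq_0_iff_AE[OF i] bump_prod_nonneg by auto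
    then have "AE y in lborel. y \<notin> ?b -` {0<..}" by eventually_elim auto
    moreover have op: "open (?b -` {0<..})"
      by (intro open_vimage continuous_bump_prod) auto
    ultimately have "?b -` {0<..} \<in> null_sets lborel"
      by (subst AE_iff_null_sets) auto
    then have "negligible (?b -` {0<..})"
      by (simp add: negligible_iff_null_sets null_sets_completionI)
    moreover have "0 \<in> ?b -` {0<..}" using bump_prod_0_pos by auto
    ultimately show False using open_not_negligible[OF op] by blast
  qed
  moreover have "(\<integral>y. ?b y \<partial>lborel) \<ge> 0"
    by (intro integral_nonneg_AE AE_I2 bump_prod_nonneg)
  ultimately show ?thesis by simp
qed

lemma mollifier_moll: "mollifier (moll k :: real ^ 'n \<Rightarrow> real) (real CARD('n) / real (Suc k))"
  unfolding mollifier_def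
proof (intro conjI allI impI)
  show "continuous_on UNIV (moll k :: real ^ 'n \<Rightarrow> real)"
    unfolding moll_def[abs_def] by (intro continuous_intros continuous_bump_prod)
  show "0 \<le> moll k x" for x :: "real ^ 'n"
    unfolding moll_def using integral_bump_prod_pos[of "real (Suc k)", where 'n='n]
    by (intro mult_nonneg_nonneg bump_prod_nonneg) (simp add: less_imp_le)
  show "moll k x = 0" if "real CARD('n) / real (Suc k) \<le> norm x" for x :: "real ^ 'n"
    using bump_prod_eq_0[OF _ that] by (simp add: moll_def)
  show "(\<integral>x. moll k (x :: real ^ 'n) \<partial>lborel) = 1"
    unfolding moll_def using integral_bump_prod_pos[of "real (Suc k)", where 'n='n] by simp
qed

lemma nn_integral_mollifier:
  assumes "mollifier \<psi> d"
  shows "(\<integral>\<^sup>+x. ennreal (\<psi> x) \<partial>lborel) = 1"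
  using nn_integral_eq_integral[OF mollifierD(7)[OF assms]] mollifierD(2,4)[OF assms] by simp

lemma conv_const:
  assumes "mollifier \<psi> d"
  shows "conv \<psi> (\<lambda>_. c) x = c"
  unfolding conv_def
  using integral_reflect[OF mollifierD(6)[OF assms], of x] mollifierD(4)[OF assms] by simp

lemma conv_diff:
  assumes "mollifier \<psi> d" "loc_integrable g" "loc_integrable h"
  shows "conv \<psi> (\<lambda>y. g y - h y) x = conv \<psi> g x - conv \<psi> h x"
  unfolding conv_def
  by (subst Bochner_Integration.integral_diff[symmetric])
    (auto simp: right_diff_distrib intro!: integrable_conv assms mollifierD[OF assms(1)])

lemma conv_mono:
  assumes "mollifier \<psi> d" "loc_integrable g" "loc_integrable h"
    and "\<And>y. norm (x - y) < d \<Longrightarrow> g y \<le> h y"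
  shows "conv \<psi> g x \<le> conv \<psi> h x"
  unfolding conv_def
proof (intro integral_mono integrable_conv assms mollifierD[OF assms(1)])
  fix y
  show "\<psi> (x - y) * g y \<le> \<psi> (x - y) * h y"
    using assms(4)[of y] mollifierD(2,3)[OF assms(1), of "x - y"]
    by (cases "norm (x - y) < d") (auto intro: mult_left_mono)
qed

lemma abs_conv_le:
  assumes "mollifier \<psi> d" "loc_integrable g"
  shows "\<bar>conv \<psi> g x\<bar> \<le> conv \<psi> (\<lambda>y. \<bar>g y\<bar>) x"
proof -
  have "norm (conv \<psi> g x) \<le> (\<integral>y. norm (\<psi> (x - y) * g y) \<partial>lborel)"
    unfolding conv_def by (rule integral_norm_bound)
  also have "\<dots> = conv \<psi> (\<lambda>y. \<bar>g y\<bar>) x"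
    unfolding conv_def using mollifierD(2)[OF assms(1)] by (simp add: abs_mult)
  finally show ?thesis by simp
qed

text \<open>Jensen's inequality, by integrating the tangent line inequality for \<open>t ^ m\<close>.\<close>

lemma abs_conv_power_le:
  assumes m: "mollifier \<psi> d" and g: "loc_integrable g" "loc_integrable (\<lambda>y. \<bar>g y\<bar> ^ m)"
  shows "\<bar>conv \<psi> g x\<bar> ^ m \<le> conv \<psi> (\<lambda>y. \<bar>g y\<bar> ^ m) x"
proof -
  define s where "s = conv \<psi> (\<lambda>y. \<bar>g y\<bar>) x"
  have s0: "0 \<le> s" using abs_conv_le[OF m g(1), of x] by (simp add: s_def)
  have tangent: "s ^ m + real m * s ^ (m - 1) * (t - s) \<le> t ^ m" if "t \<ge> 0" for t
  proof (cases "s = 0")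
    case True
    show ?thesis
    proof (cases m)
      case (Suc m')
      then show ?thesis using True that by (cases m') auto
    qed simp
  next
    case False
    with s0 have sp: "s > 0" by simp
    show ?thesis
    proof (cases m)
      case (Suc m')
      \<comment> \<open>Bernoulli's inequality, to be multiplied by s ^ m. The division by s is the
        reason for the separate case s = 0.\<close>
      have "1 + real m * (t / s - 1) \<le> (1 + (t / s - 1)) ^ m"
        using that sp by (intro Bernoulli_inequality) simp
      then have "s ^ m * (1 + real m * (t / s - 1)) \<le> s ^ m * (t / s) ^ m"
        using sp by (intro mult_left_mono) auto
      moreover have "s ^ m * (1 + real m * (t / s - 1)) = s ^ m + real m * s ^ (m - 1) * (t - s)"
        using sp Suc by (simp add: field_simps)
      moreover have "s ^ m * (t / s) ^ m = t ^ m" using sp by (simp add: power_divide)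
      ultimately show ?thesis by simp
    qed simp
  qed
  have i1: "loc_integrable (\<lambda>y. \<bar>g y\<bar>)" by (rule loc_integrable_abs[OF g(1)])
  note mD = mollifierD[OF m]
  have ia: "integrable lborel (\<lambda>y. \<psi> (x - y) * \<bar>g y\<bar> ^ m)" by (intro integrable_conv g mD)
  have ib: "integrable lborel (\<lambda>y. \<psi> (x - y) * 1)" by (intro integrable_conv loc_integrable_const mD)
  have ic: "integrable lborel (\<lambda>y. \<psi> (x - y) * \<bar>g y\<bar>)" by (intro integrable_conv i1 mD)
  have "0 \<le> (\<integral>y. \<psi> (x - y) * \<bar>g y\<bar> ^ m - (s ^ m + real m * s ^ (m - 1) * (- s)) * (\<psi> (x - y) * 1)
       - real m * s ^ (m - 1) * (\<psi> (x - y) * \<bar>g y\<bar>) \<partial>lborel)"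
  proof (intro integral_nonneg_AE AE_I2)
    fix y
    have "0 \<le> \<psi> (x - y) * (\<bar>g y\<bar> ^ m - (s ^ m + real m * s ^ (m - 1) * (\<bar>g y\<bar> - s)))"
      using tangent[of "\<bar>g y\<bar>"] mD(2) by (intro mult_nonneg_nonneg) auto
    then show "0 \<le> \<psi> (x - y) * \<bar>g y\<bar> ^ m - (s ^ m + real m * s ^ (m - 1) * (- s)) * (\<psi> (x - y) * 1)
       - real m * s ^ (m - 1) * (\<psi> (x - y) * \<bar>g y\<bar>)"
      by (simp add: algebra_simps)
  qed
  also have "\<dots> = conv \<psi> (\<lambda>y. \<bar>g y\<bar> ^ m) x - (s ^ m + real m * s ^ (m - 1) * (- s)) * conv \<psi> (\<lambda>_. 1) x
       - real m * s ^ (m - 1) * s"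
    unfolding s_def conv_def
    using ia ib ic
    by (simp only: Bochner_Integration.integral_diff Bochner_Integration.integrable_diff
        integrable_mult_right integral_mult_right_zero)
  also have "\<dots> = conv \<psi> (\<lambda>y. \<bar>g y\<bar> ^ m) x - s ^ m"
    by (simp add: conv_const[OF m] algebra_simps)
  finally have "s ^ m \<le> conv \<psi> (\<lambda>y. \<bar>g y\<bar> ^ m) x" by simp
  moreover have "\<bar>conv \<psi> g x\<bar> ^ m \<le> s ^ m"
    unfolding s_def by (intro power_mono abs_conv_le[OF m g(1)]) auto
  ultimately show ?thesis by simp
qed

section \<open>Convergence of mollifications in L^1 and almost everywhere\<close>

lemma continuous_imp_loc_integrable:
  fixes h :: "'a::euclidean_space \<Rightarrow> real"
  assumes "continuous_on UNIV h"
  shows "loc_integrable h"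
  unfolding loc_integrable_def
proof (intro conjI allI)
  show "h \<in> borel_measurable borel" by (rule continuous_imp_borel[OF assms])
  show "set_integrable lborel (cball 0 R) h" for R
    unfolding set_integrable_def
    by (intro borel_integrable_compact continuous_on_subset[OF assms]) auto
qed

text \<open>For an indicator of A, take a closed T inside A and an open U around A, both close in
  measure, and a Urysohn function that is 1 on T and 0 off U; the error is confined to U - T. Sums
  and dominated limits then give all integrable functions.\<close>

lemma integrable_continuous_approx:
  fixes g :: "'a::euclidean_space \<Rightarrow> real"
  assumes "integrable lborel g" "e > 0"
  shows "\<exists>h. continuous_on UNIV h \<and> integrable lborel h \<and> (\<integral>x. \<bar>g x - h x\<bar> \<partial>lborel) < e"
  using assms
proof (induction g arbitrary: e rule: integrable_induct)
  case (base A c)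
  have A: "A \<in> sets lebesgue" using base by auto
  \<comment> \<open>U - T will have measure at most 2 \<delta>, and the error is multiplied by |c|.
    The summand 1 covers c = 0, and the outcome is below e / 2.\<close>
  define \<delta> where "\<delta> = e / (2 * (2 * (\<bar>c\<bar> + 1)))"
  have \<delta>: "\<delta> > 0" using base(3) by (auto simp: \<delta>_def)
  obtain T where T: "closed T" "T \<subseteq> A" "A - T \<in> lmeasurable" "emeasure lebesgue (A - T) < ennreal \<delta>"
    using sets_lebesgue_inner_closed[OF A \<delta>] by metis
  obtain U where U: "open U" "A \<subseteq> U" "U - A \<in> lmeasurable" "emeasure lebesgue (U - A) < ennreal \<delta>"
    using sets_lebesgue_outer_open[OF A \<delta>] by metis
  have UT: "U - T = (U - A) \<union> (A - T)" using T U by auto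
  have lm: "U - T \<in> lmeasurable" unfolding UT by (intro fmeasurable.Un T U)
  have bo: "U - T \<in> sets borel" using T U by auto
  have "measure lebesgue (U - T) \<le> measure lebesgue (U - A) + measure lebesgue (A - T)"
    unfolding UT by (intro measure_Un_le fmeasurableD T U)
  also have "\<dots> \<le> \<delta> + \<delta>"
    using T(3,4) U(3,4) \<delta> by (intro add_mono) (simp_all add: emeasure_eq_measure2 ennreal_less_iff)
  finally have mUT: "measure lborel (U - T) \<le> 2 * \<delta>"
    using bo by (simp add: measure_completion)
  have int: "integrable lborel (indicat_real (U - T))"
    using lm bo by (intro integrable_real_indicator) (auto simp: fmeasurable_def)
  obtain h :: "'a \<Rightarrow> real" where h: "continuous_on UNIV h" "\<And>x. h x \<in> closed_segment 1 0"
    "\<And>x. x \<in> T \<Longrightarrow> h x = 1" "\<And>x. x \<in> - U \<Longrightarrow> h x = 0"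
  proof (rule Urysohn[of T "- U" 1 "0::real"])
    show "T \<inter> - U = {}" using T(2) U(2) by auto
  qed (use T(1) U(1) in auto)
  have h01: "0 \<le> h x" "h x \<le> 1" for x
    using h(2)[of x] by (auto simp: closed_segment_eq_real_ivl)
  have le: "\<bar>indicat_real A x - h x\<bar> \<le> indicat_real (U - T) x" for x
    using h(3,4)[of x] h01[of x] T(2) U(2) by (auto simp: indicator_def)
  have [measurable]: "h \<in> borel_measurable borel" by (rule continuous_imp_borel[OF h(1)])
  have [measurable]: "A \<in> sets borel" using base by simp
  have iA: "integrable lborel (indicat_real A)"
    using base by (intro integrable_real_indicator) auto
  have id: "integrable lborel (\<lambda>x. indicat_real A x - h x)"
    by (rule Bochner_Integration.integrable_bound[OF int]) (use le in auto)
  have ih: "integrable lborel h"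
    using Bochner_Integration.integrable_diff[OF iA id] by simp
  have "(\<integral>x. \<bar>indicat_real A x *\<^sub>R c - c * h x\<bar> \<partial>lborel) = \<bar>c\<bar> * (\<integral>x. \<bar>indicat_real A x - h x\<bar> \<partial>lborel)"
    by (subst integral_mult_right_zero[symmetric]) (simp add: abs_mult[symmetric] algebra_simps)
  also have "(\<integral>x. \<bar>indicat_real A x - h x\<bar> \<partial>lborel) \<le> (\<integral>x. indicat_real (U - T) x \<partial>lborel)"
    by (intro integral_mono integrable_abs id int le)
  also have "\<dots> \<le> 2 * \<delta>" using mUT bo by simp
  also have "\<bar>c\<bar> * (2 * \<delta>) < (\<bar>c\<bar> + 1) * (2 * \<delta>)" using \<delta> by simp
  also have "\<dots> = e / 2" by (simp add: \<delta>_def field_simps)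
  finally have "(\<integral>x. \<bar>indicat_real A x *\<^sub>R c - c * h x\<bar> \<partial>lborel) < e"
    using base(3) by (simp add: mult_left_mono)
  then show ?case
    using h(1) ih by (intro exI[of _ "\<lambda>x. c * h x"]) (auto intro!: continuous_intros)
next
  case (add f g)
  obtain h k where h: "continuous_on UNIV h" "integrable lborel h" "(\<integral>x. \<bar>f x - h x\<bar> \<partial>lborel) < e / 2"
    and k: "continuous_on UNIV k" "integrable lborel k" "(\<integral>x. \<bar>g x - k x\<bar> \<partial>lborel) < e / 2"
    using add(3,4)[of "e / 2"] add(5) by auto
  have "(\<integral>x. \<bar>(f x + g x) - (h x + k x)\<bar> \<partial>lborel) \<le> (\<integral>x. \<bar>f x - h x\<bar> + \<bar>g x - k x\<bar> \<partial>lborel)"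
    using add h k by (intro integral_mono) auto
  also have "\<dots> < e" using add h k by simp
  finally show ?case
    using h k by (intro exI[of _ "\<lambda>x. h x + k x"]) (auto intro!: continuous_intros)
next
  case (lim f s)
  have [measurable]: "f \<in> borel_measurable lborel" "\<And>i. s i \<in> borel_measurable lborel" using lim by auto
  have "(\<lambda>i. \<integral>x. \<bar>s i x - f x\<bar> \<partial>lborel) \<longlonglongrightarrow> (\<integral>x. 0 \<partial>(lborel :: 'a measure))"
  proof (rule integral_dominated_convergence[where w="\<lambda>x. 3 * \<bar>f x\<bar>"])
    show "AE x in lborel. (\<lambda>i. \<bar>s i x - f x\<bar>) \<longlonglongrightarrow> 0"
      by (intro AE_I2 tendsto_rabs_zero LIM_zero lim.hyps(2)) auto
    \<comment> \<open>The induction rule supplies approximations with |s i x| \<le> 2 |f x|, whence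
      the factor 3.\<close>
    show "AE x in lborel. norm \<bar>s i x - f x\<bar> \<le> 3 * \<bar>f x\<bar>" for i
    proof (rule AE_I2)
      fix x show "norm \<bar>s i x - f x\<bar> \<le> 3 * \<bar>f x\<bar>" using lim.hyps(3)[of x i] by simp
    qed
  qed (use lim in auto)
  then have "\<forall>\<^sub>F i in sequentially. (\<integral>x. \<bar>s i x - f x\<bar> \<partial>lborel) < e / 2"
    using lim.prems by (intro order_tendstoD) auto
  then obtain i where i: "(\<integral>x. \<bar>s i x - f x\<bar> \<partial>lborel) < e / 2"
    by (auto simp: eventually_sequentially)
  obtain h where h: "continuous_on UNIV h" "integrable lborel h" "(\<integral>x. \<bar>s i x - h x\<bar> \<partial>lborel) < e / 2"
    using lim.IH[of "e / 2" i] lim.prems by auto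
  have "(\<integral>x. \<bar>f x - h x\<bar> \<partial>lborel) \<le> (\<integral>x. \<bar>s i x - f x\<bar> + \<bar>s i x - h x\<bar> \<partial>lborel)"
    using lim.hyps h by (intro integral_mono) auto
  also have "\<dots> < e" using lim.hyps h i by simp
  finally show ?case using h by blast
qed

lemma loc_integrable_diff:
  "loc_integrable g \<Longrightarrow> loc_integrable h \<Longrightarrow> loc_integrable (\<lambda>x. g x - h x)"
  by (auto simp: loc_integrable_def)

text \<open>By Tonelli: each y distributes total kernel mass 1, and for x in the ball of radius R
  only y in the ball of radius R + d contribute.\<close>

lemma nn_integral_conv_le:
  fixes g :: "'a::euclidean_space \<Rightarrow> real"
  assumes m: "mollifier \<psi> d" and g: "loc_integrable g"
  shows "(\<integral>\<^sup>+x\<in>cball 0 R. ennreal \<bar>conv \<psi> g x\<bar> \<partial>lborel) \<le> (\<integral>\<^sup>+x\<in>cball 0 (R + d). ennreal \<bar>g x\<bar> \<partial>lborel)"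
proof -
  have [measurable]: "g \<in> borel_measurable borel" using g by (simp add: loc_integrable_def)
  have [measurable]: "\<psi> \<in> borel_measurable borel" by (rule mollifierD(6)[OF m])
  have [measurable]: "cball 0 (R + d) \<in> sets (borel :: 'a measure)" by auto
  have "(\<integral>\<^sup>+x\<in>cball 0 R. ennreal \<bar>conv \<psi> g x\<bar> \<partial>lborel)
      \<le> (\<integral>\<^sup>+x. (\<integral>\<^sup>+y. ennreal (\<psi> (x - y)) * (ennreal \<bar>g y\<bar> * indicator (cball 0 (R + d)) y) \<partial>lborel) \<partial>lborel)"
  proof (rule nn_integral_mono)
    fix x :: 'a
    show "ennreal \<bar>conv \<psi> g x\<bar> * indicator (cball 0 R) x
      \<le> (\<integral>\<^sup>+y. ennreal (\<psi> (x - y)) * (ennreal \<bar>g y\<bar> * indicator (cball 0 (R + d)) y) \<partial>lborel)"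
    proof (cases "x \<in> cball 0 R")
      case True
      have "ennreal \<bar>conv \<psi> g x\<bar> \<le> (\<integral>\<^sup>+y. ennreal (norm (\<psi> (x - y) * g y)) \<partial>lborel)"
        unfolding conv_def real_norm_def[symmetric] by (rule integral_norm_bound_ennreal)
          (intro integrable_conv g mollifierD[OF m])
      also have "\<dots> \<le> (\<integral>\<^sup>+y. ennreal (\<psi> (x - y)) * (ennreal \<bar>g y\<bar> * indicator (cball 0 (R + d)) y) \<partial>lborel)"
      proof (rule nn_integral_mono)
        fix y
        show "ennreal (norm (\<psi> (x - y) * g y)) \<le> ennreal (\<psi> (x - y)) * (ennreal \<bar>g y\<bar> * indicator (cball 0 (R + d)) y)"
        proof (cases "norm (x - y) < d")
          case True
          then have "y \<in> cball 0 (R + d)"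
            using \<open>x \<in> cball 0 R\<close> norm_triangle_ineq2[of y x] by (simp add: norm_minus_commute)
          then show ?thesis using mollifierD(2)[OF m, of "x - y"] by (simp add: abs_mult ennreal_mult)
        next
          case False
          then show ?thesis using mollifierD(3)[OF m, of "x - y"] by simp
        qed
      qed
      finally show ?thesis using True by simp
    qed simp
  qed
  also have "\<dots> = (\<integral>\<^sup>+y. (\<integral>\<^sup>+x. ennreal (\<psi> (x - y)) * (ennreal \<bar>g y\<bar> * indicator (cball 0 (R + d)) y) \<partial>lborel) \<partial>lborel)"
    by (rule lborel_pair.Fubini'[symmetric]) measurable
  also have "\<dots> = (\<integral>\<^sup>+y. ennreal \<bar>g y\<bar> * indicator (cball 0 (R + d)) y \<partial>lborel)"
  proof (rule nn_integral_cong)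
    fix y
    have "(\<integral>\<^sup>+x. ennreal (\<psi> (x - y)) \<partial>lborel) = 1"
      using nn_integral_translate[of "\<lambda>x. ennreal (\<psi> x)" y] nn_integral_mollifier[OF m] by simp
    then show "(\<integral>\<^sup>+x. ennreal (\<psi> (x - y)) * (ennreal \<bar>g y\<bar> * indicator (cball 0 (R + d)) y) \<partial>lborel)
       = ennreal \<bar>g y\<bar> * indicator (cball 0 (R + d)) y"
      by (subst nn_integral_multc) auto
  qed
  finally show ?thesis .
qed

text \<open>With a continuous h close to g in L^1 on the ball of radius R + 1, the error has three
  parts: the mollified difference \<open>D\<close> and \<open>D\<close> itself, both controlled by
  that closeness, and the mollification error of h, controlled by uniform continuity. Requiring d <
  1 keeps all points involved in the larger ball. The threshold is the same for all kernels.\<close>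

lemma conv_L1_approx:
  fixes g :: "'a::euclidean_space \<Rightarrow> real"
  assumes g: "loc_integrable g" and e: "e > 0"
  obtains d0 where "d0 > 0" "\<And>\<psi> d. mollifier \<psi> d \<Longrightarrow> d < d0 \<Longrightarrow>
     (\<integral>\<^sup>+x\<in>cball 0 R. ennreal \<bar>conv \<psi> g x - g x\<bar> \<partial>lborel) \<le> ennreal e"
proof -
  have [measurable]: "g \<in> borel_measurable borel" using g by (simp add: loc_integrable_def)
  have si: "integrable lborel (\<lambda>x. indicat_real (cball 0 (R + 1)) x * g x)"
    using g by (simp add: loc_integrable_def set_integrable_def)
  obtain h where h: "continuous_on UNIV h" "integrable lborel h"
    "(\<integral>x. \<bar>indicat_real (cball 0 (R + 1)) x * g x - h x\<bar> \<partial>lborel) < e / 3"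
    using integrable_continuous_approx[OF si, of "e / 3"] e by auto
  have hl: "loc_integrable h" by (rule continuous_imp_loc_integrable[OF h(1)])
  have [measurable]: "h \<in> borel_measurable borel" using hl by (simp add: loc_integrable_def)
  have "uniformly_continuous_on (cball 0 (R + 1)) h"
    by (intro compact_uniformly_continuous continuous_on_subset[OF h(1)]) auto
  \<comment> \<open>The permitted oscillation of h: integrated over the ball it costs at most e / 3.
    The summand 1 keeps the denominator positive when the ball is a null set.\<close>
  define \<omega> where "\<omega> = e / (3 * (1 + measure lborel (cball 0 R :: 'a set)))"
  have \<omega>: "\<omega> > 0" unfolding \<omega>_def using e measure_nonneg[of lborel "cball 0 R"] by (intro divide_pos_pos mult_pos_pos add_pos_nonneg) auto
  obtain d1 where d1: "d1 > 0" "\<And>x y. x \<in> cball 0 (R + 1) \<Longrightarrow> y \<in> cball 0 (R + 1) \<Longrightarrow> dist y x < d1 \<Longrightarrow> dist (h y) (h x) < \<omega>"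
    using \<open>uniformly_continuous_on (cball 0 (R + 1)) h\<close> \<omega> unfolding uniformly_continuous_on_def by metis
  define D where "D x = g x - h x" for x
  have D: "loc_integrable D" unfolding D_def[abs_def] by (intro loc_integrable_diff g hl)
  then have [measurable]: "D \<in> borel_measurable borel" by (simp add: loc_integrable_def)
  have DR: "(\<integral>\<^sup>+x\<in>cball 0 (R + 1). ennreal \<bar>D x\<bar> \<partial>lborel) \<le> ennreal (e / 3)"
  proof -
    have "(\<integral>\<^sup>+x\<in>cball 0 (R + 1). ennreal \<bar>D x\<bar> \<partial>lborel)
        \<le> (\<integral>\<^sup>+x. ennreal \<bar>indicat_real (cball 0 (R + 1)) x * g x - h x\<bar> \<partial>lborel)"
      by (intro nn_integral_mono) (auto simp: indicator_def D_def)
    also have "\<dots> = ennreal (\<integral>x. \<bar>indicat_real (cball 0 (R + 1)) x * g x - h x\<bar> \<partial>lborel)"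
      using si h by (intro nn_integral_eq_integral) auto
    also have "\<dots> \<le> ennreal (e / 3)" using h(3) by (intro ennreal_leI) simp
    finally show ?thesis .
  qed
  show thesis
  proof (rule that[of "min d1 1"])
    show "min d1 1 > 0" using d1 by simp
    fix \<psi> :: "'a \<Rightarrow> real" and d
    assume m: "mollifier \<psi> d" and d: "d < min d1 1"
    have hc: "\<bar>conv \<psi> h x - h x\<bar> \<le> \<omega>" if "x \<in> cball 0 R" for x
    proof -
      have *: "\<bar>h y - h x\<bar> \<le> \<omega>" if "norm (x - y) < d" for y
      proof -
        have "norm y \<le> R + 1" "norm x \<le> R + 1"
          using that \<open>x \<in> cball 0 R\<close> d norm_triangle_ineq2[of y x] by (simp_all add: norm_minus_commute)
        then show ?thesis using d1(2)[of x y] that d by (simp add: dist_norm norm_minus_commute)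
      qed
      have "conv \<psi> (\<lambda>_. h x - \<omega>) x \<le> conv \<psi> h x"
        by (intro conv_mono[OF m] loc_integrable_const hl) (use * in \<open>auto simp: abs_le_iff algebra_simps\<close>)
      moreover have "conv \<psi> h x \<le> conv \<psi> (\<lambda>_. h x + \<omega>) x"
        by (intro conv_mono[OF m] loc_integrable_const hl) (use * in \<open>auto simp: abs_le_iff algebra_simps\<close>)
      ultimately show ?thesis by (simp add: conv_const[OF m])
    qed
    have [measurable]: "conv \<psi> D \<in> borel_measurable borel" "conv \<psi> h \<in> borel_measurable borel"
      by (intro continuous_imp_borel continuous_conv D hl mollifierD[OF m])+
    have [measurable]: "cball 0 R \<in> sets (borel :: 'a measure)" by auto
    have "(\<integral>\<^sup>+x\<in>cball 0 R. ennreal \<bar>conv \<psi> g x - g x\<bar> \<partial>lborel)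
        \<le> (\<integral>\<^sup>+x. ennreal \<bar>conv \<psi> D x\<bar> * indicator (cball 0 R) x + ennreal \<omega> * indicator (cball 0 R) x
            + ennreal \<bar>D x\<bar> * indicator (cball 0 R) x \<partial>lborel)"
    proof (intro nn_integral_mono)
      fix x :: 'a
      have "\<bar>conv \<psi> g x - g x\<bar> \<le> \<bar>conv \<psi> D x\<bar> + \<omega> + \<bar>D x\<bar>" if "x \<in> cball 0 R"
        using hc[OF that] unfolding D_def[abs_def] conv_diff[OF m g hl] D_def by linarith
      then show "ennreal \<bar>conv \<psi> g x - g x\<bar> * indicator (cball 0 R) x \<le>
         ennreal \<bar>conv \<psi> D x\<bar> * indicator (cball 0 R) x + ennreal \<omega> * indicator (cball 0 R) x
            + ennreal \<bar>D x\<bar> * indicator (cball 0 R) x"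
        using \<omega> by (auto simp: indicator_def ennreal_leI simp flip: ennreal_plus)
    qed
    also have "\<dots> = (\<integral>\<^sup>+x\<in>cball 0 R. ennreal \<bar>conv \<psi> D x\<bar> \<partial>lborel) + ennreal \<omega> * emeasure lborel (cball 0 R :: 'a set)
        + (\<integral>\<^sup>+x\<in>cball 0 R. ennreal \<bar>D x\<bar> \<partial>lborel)"
      by (simp add: nn_integral_add nn_integral_cmult)
    also have "\<dots> \<le> ennreal (e / 3) + ennreal (e / 3) + ennreal (e / 3)"
    proof (intro add_mono)
      show "(\<integral>\<^sup>+x\<in>cball 0 R. ennreal \<bar>conv \<psi> D x\<bar> \<partial>lborel) \<le> ennreal (e / 3)"
        by (rule order.trans[OF nn_integral_conv_le[OF m D] order.trans[OF _ DR]])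
          (use d in \<open>auto intro!: nn_integral_mono simp: indicator_def\<close>)
      show "(\<integral>\<^sup>+x\<in>cball 0 R. ennreal \<bar>D x\<bar> \<partial>lborel) \<le> ennreal (e / 3)"
        by (rule order.trans[OF _ DR]) (auto intro!: nn_integral_mono simp: indicator_def)
      have "emeasure lborel (cball 0 R :: 'a set) = ennreal (measure lborel (cball 0 R :: 'a set))"
        using emeasure_lborel_cball_finite[of "0::'a" R]
        by (intro emeasure_eq_ennreal_measure) (auto simp: less_top)
      moreover have "\<omega> * measure lborel (cball 0 R :: 'a set) \<le> e / 3"
      proof -
        have "\<omega> * measure lborel (cball 0 R :: 'a set) \<le> \<omega> * (1 + measure lborel (cball 0 R :: 'a set))"
          using \<omega> by (intro mult_left_mono) auto
        also have "\<dots> = e / 3"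
          unfolding \<omega>_def using measure_nonneg[of lborel "cball 0 R :: 'a set"]
          by (simp add: add_nonneg_eq_0_iff divide_eq_eq algebra_simps)
        finally show ?thesis .
      qed
      ultimately show "ennreal \<omega> * emeasure lborel (cball 0 R :: 'a set) \<le> ennreal (e / 3)"
        using \<omega> by (simp add: ennreal_mult[symmetric] ennreal_leI)
    qed
    also have "\<dots> = ennreal e" using e by (simp flip: ennreal_plus)
    finally show "(\<integral>\<^sup>+x\<in>cball 0 R. ennreal \<bar>conv \<psi> g x - g x\<bar> \<partial>lborel) \<le> ennreal e" .
  qed
qed

lemma conv_tendsto_L1:
  fixes g :: "'a::euclidean_space \<Rightarrow> real"
  assumes g: "loc_integrable g" and m: "\<And>k. mollifier (\<psi> k) (d k)" "d \<longlonglongrightarrow> 0"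
  shows "integrable lborel (\<lambda>x. indicator (cball 0 R) x * (conv (\<psi> k) g x - g x))"
    and "(\<lambda>k. \<integral>x. \<bar>indicator (cball 0 R) x * (conv (\<psi> k) g x - g x)\<bar> \<partial>lborel) \<longlonglongrightarrow> 0"
proof -
  have "loc_integrable (\<lambda>x. conv (\<psi> k) g x - g x)" for k
    by (intro loc_integrable_diff g continuous_imp_loc_integrable continuous_conv mollifierD[OF m(1)])
  then show int: "integrable lborel (\<lambda>x. indicator (cball 0 R) x * (conv (\<psi> k) g x - g x))" for k
    by (simp add: loc_integrable_def set_integrable_def)
  show "(\<lambda>k. \<integral>x. \<bar>indicator (cball 0 R) x * (conv (\<psi> k) g x - g x)\<bar> \<partial>lborel) \<longlonglongrightarrow> 0"
  proof (rule LIMSEQ_I)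
    fix e :: real assume e: "0 < e"
    obtain d0 where d0: "d0 > 0" "\<And>\<psi> d. mollifier \<psi> d \<Longrightarrow> d < d0 \<Longrightarrow>
     (\<integral>\<^sup>+x\<in>cball 0 R. ennreal \<bar>conv \<psi> g x - g x\<bar> \<partial>lborel) \<le> ennreal (e / 2)"
      using conv_L1_approx[OF g, of "e / 2" R] e by auto
    have "\<forall>\<^sub>F k in sequentially. d k < d0" using m(2) d0(1) by (rule order_tendstoD)
    then have "\<forall>\<^sub>F k in sequentially. norm ((\<integral>x. \<bar>indicator (cball 0 R) x * (conv (\<psi> k) g x - g x)\<bar> \<partial>lborel) - 0) < e"
    proof eventually_elim
      case (elim k)
      have "ennreal (\<integral>x. \<bar>indicator (cball 0 R) x * (conv (\<psi> k) g x - g x)\<bar> \<partial>lborel)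
         = (\<integral>\<^sup>+x\<in>cball 0 R. ennreal \<bar>conv (\<psi> k) g x - g x\<bar> \<partial>lborel)"
        by (subst nn_integral_eq_integral[symmetric])
          ((intro integrable_abs int AE_I2 abs_ge_zero nn_integral_cong)+, auto simp: indicator_def)
      also have "\<dots> \<le> ennreal (e / 2)" by (rule d0(2)[OF m(1) elim])
      finally have "(\<integral>x. \<bar>indicator (cball 0 R) x * (conv (\<psi> k) g x - g x)\<bar> \<partial>lborel) \<le> e / 2"
        using e by (simp add: ennreal_le_iff)
      moreover have "(\<integral>x. \<bar>indicator (cball 0 R) x * (conv (\<psi> k) g x - g x)\<bar> \<partial>lborel) \<ge> 0" by simp
      ultimately show ?case using e by simp
    qed
    then show "\<exists>no. \<forall>k\<ge>no. norm ((\<integral>x. \<bar>indicator (cball 0 R) x * (conv (\<psi> k) g x - g x)\<bar> \<partial>lborel) - 0) < e"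
      by (simp add: eventually_sequentially)
  qed
qed

text \<open>The errors are added over the finite set G before a subsequence is extracted, so that a
  single one serves all members of G.\<close>

lemma conv_tendsto_AE_subseq:
  fixes G :: "('a::euclidean_space \<Rightarrow> real) set"
  assumes "finite G" and g: "\<And>g. g \<in> G \<Longrightarrow> loc_integrable g"
    and m: "\<And>k. mollifier (\<psi> k) (d k)" "d \<longlonglongrightarrow> 0"
  obtains r where "strict_mono r"
    "AE x in lborel. x \<in> cball 0 R \<longrightarrow> (\<forall>g\<in>G. (\<lambda>k. conv (\<psi> (r k)) g x) \<longlonglongrightarrow> g x)"
proof -
  define u where "u k x = (\<Sum>g\<in>G. \<bar>indicator (cball 0 R) x * (conv (\<psi> k) g x - g x)\<bar>)" for k x
  have 1: "integrable lborel (u k)" for k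
    unfolding u_def[abs_def] by (intro Bochner_Integration.integrable_sum integrable_abs conv_tendsto_L1(1)[OF g m])
  have "(\<lambda>k. \<Sum>g\<in>G. \<integral>x. \<bar>indicator (cball 0 R) x * (conv (\<psi> k) g x - g x)\<bar> \<partial>lborel) \<longlonglongrightarrow> (\<Sum>g\<in>G. 0)"
    by (intro tendsto_sum conv_tendsto_L1(2)[OF g m])
  moreover have "(\<integral>x. norm (u k x) \<partial>lborel) = (\<Sum>g\<in>G. \<integral>x. \<bar>indicator (cball 0 R) x * (conv (\<psi> k) g x - g x)\<bar> \<partial>lborel)" for k
  proof -
    have "norm (u k x) = u k x" for x by (simp add: u_def sum_nonneg)
    then have "(\<integral>x. norm (u k x) \<partial>lborel) = (\<integral>x. u k x \<partial>lborel)" by simp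
    also have "\<dots> = (\<Sum>g\<in>G. \<integral>x. \<bar>indicator (cball 0 R) x * (conv (\<psi> k) g x - g x)\<bar> \<partial>lborel)"
      unfolding u_def by (intro Bochner_Integration.integral_sum integrable_abs conv_tendsto_L1(1)[OF g m])
    finally show ?thesis .
  qed
  ultimately have "(\<lambda>k. \<integral>x. norm (u k x) \<partial>lborel) \<longlonglongrightarrow> 0" by simp
  from tendsto_L1_AE_subseq[OF 1 this] obtain r where r: "strict_mono r" "AE x in lborel. (\<lambda>k. u (r k) x) \<longlonglongrightarrow> 0"
    by blast
  have "AE x in lborel. x \<in> cball 0 R \<longrightarrow> (\<forall>g\<in>G. (\<lambda>k. conv (\<psi> (r k)) g x) \<longlonglongrightarrow> g x)"
    using r(2)
  proof eventually_elim
    case (elim x)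
    show ?case
    proof (intro impI ballI)
      fix g assume x: "x \<in> cball 0 R" and gG: "g \<in> G"
      have "norm (conv (\<psi> (r k)) g x - g x) \<le> u (r k) x" for k
        unfolding u_def using x gG member_le_sum[of g G "\<lambda>g. \<bar>indicator (cball 0 R) x * (conv (\<psi> (r k)) g x - g x)\<bar>"] assms(1)
        by simp
      then have "(\<lambda>k. conv (\<psi> (r k)) g x - g x) \<longlonglongrightarrow> 0"
        by (intro Lim_null_comparison[OF _ elim] always_eventually) blast
      then show "(\<lambda>k. conv (\<psi> (r k)) g x) \<longlonglongrightarrow> g x" by (rule LIM_zero_cancel)
    qed
  qed
  with r(1) that show ?thesis by blast
qed

text \<open>Dominated convergence with majorants \<open>G k\<close> that vary but converge in L^1.
  Removing |G k - H| from |u k - v| and truncating at 0 leaves \<open>w k\<close>, which has the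
  fixed majorant |H| + |v|; the removed part tends to 0 in the mean by assumption.\<close>

lemma Pratt_convergence:
  fixes u :: "nat \<Rightarrow> 'a \<Rightarrow> real"
  assumes u: "\<And>k. integrable M (u k)" and v: "integrable M v"
    and G: "\<And>k. integrable M (G k)" "integrable M H" "(\<lambda>k. \<integral>x. \<bar>G k x - H x\<bar> \<partial>M) \<longlonglongrightarrow> 0"
    and le: "\<And>k. AE x in M. \<bar>u k x\<bar> \<le> G k x" and lim: "AE x in M. (\<lambda>k. u k x) \<longlonglongrightarrow> v x"
  shows "(\<lambda>k. \<integral>x. u k x \<partial>M) \<longlonglongrightarrow> (\<integral>x. v x \<partial>M)"
proof -
  define w where "w k x = max 0 (\<bar>u k x - v x\<bar> - \<bar>G k x - H x\<bar>)" for k x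
  have [measurable]: "u k \<in> borel_measurable M" "v \<in> borel_measurable M"
    "G k \<in> borel_measurable M" "H \<in> borel_measurable M" for k
    using u v G by auto
  have wi: "integrable M (w k)" for k
    unfolding w_def[abs_def] using u v G by (intro integrable_max) auto
  have "(\<lambda>k. \<integral>x. w k x \<partial>M) \<longlonglongrightarrow> (\<integral>x. 0 \<partial>M)"
  proof (rule integral_dominated_convergence[where w="\<lambda>x. \<bar>H x\<bar> + \<bar>v x\<bar>"])
    show "AE x in M. (\<lambda>k. w k x) \<longlonglongrightarrow> 0" using lim
    proof eventually_elim
      case (elim x)
      have "(\<lambda>k. \<bar>u k x - v x\<bar>) \<longlonglongrightarrow> \<bar>v x - v x\<bar>" by (intro tendsto_intros elim)
      then have "(\<lambda>k. \<bar>u k x - v x\<bar>) \<longlonglongrightarrow> 0" by simp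
      then show ?case
        by (rule Lim_null_comparison[rotated]) (auto intro!: always_eventually simp: w_def)
    qed
    show "AE x in M. norm (w k x) \<le> \<bar>H x\<bar> + \<bar>v x\<bar>" for k using le[of k]
      by eventually_elim (auto simp: w_def)
    show "(\<lambda>_. 0) \<in> borel_measurable M" by simp
    show "w k \<in> borel_measurable M" for k unfolding w_def[abs_def] by measurable
    show "integrable M (\<lambda>x. \<bar>H x\<bar> + \<bar>v x\<bar>)" using G v by auto
  qed
  then have "(\<lambda>k. (\<integral>x. w k x \<partial>M) + (\<integral>x. \<bar>G k x - H x\<bar> \<partial>M)) \<longlonglongrightarrow> 0 + 0"
    by (intro tendsto_add G(3)) simp
  moreover have "norm ((\<integral>x. u k x \<partial>M) - (\<integral>x. v x \<partial>M)) \<le> (\<integral>x. w k x \<partial>M) + (\<integral>x. \<bar>G k x - H x\<bar> \<partial>M)" for k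
  proof -
    have "norm ((\<integral>x. u k x \<partial>M) - (\<integral>x. v x \<partial>M)) = norm (\<integral>x. u k x - v x \<partial>M)"
      using u[of k] v by simp
    also have "\<dots> \<le> (\<integral>x. norm (u k x - v x) \<partial>M)" by (rule integral_norm_bound)
    also have "\<dots> \<le> (\<integral>x. w k x + \<bar>G k x - H x\<bar> \<partial>M)"
    proof (rule integral_mono)
      show "integrable M (\<lambda>x. norm (u k x - v x))" using u v by auto
      show "integrable M (\<lambda>x. w k x + \<bar>G k x - H x\<bar>)" using wi G by auto
      show "norm (u k x - v x) \<le> w k x + \<bar>G k x - H x\<bar>" for x
        unfolding w_def real_norm_def by (rule order.trans[OF _ add_right_mono[OF max.cobounded2]]) (rule eq_refl, simp only: diff_add_cancel)
    qed
    also have "\<dots> = (\<integral>x. w k x \<partial>M) + (\<integral>x. \<bar>G k x - H x\<bar> \<partial>M)"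
      using wi[of k] G(1)[of k] G(2) by simp
    finally show ?thesis .
  qed
  ultimately have "(\<lambda>k. (\<integral>x. u k x \<partial>M) - (\<integral>x. v x \<partial>M)) \<longlonglongrightarrow> 0"
    using Lim_null_comparison[OF always_eventually, of "\<lambda>k. (\<integral>x. u k x \<partial>M) - (\<integral>x. v x \<partial>M)"
        "\<lambda>k. (\<integral>x. w k x \<partial>M) + (\<integral>x. \<bar>G k x - H x\<bar> \<partial>M)"] by simp
  then show ?thesis by (rule LIM_zero_cancel)
qed

section \<open>Weak Jacobians\<close>


text \<open>The partial derivative of \<open>moll k\<close> with multi-index \<alpha>. The constant
  normalises the undifferentiated kernel for every \<alpha>.\<close>

definition moll_deriv :: "nat \<Rightarrow> ('n \<Rightarrow> nat) \<Rightarrow> real ^ 'n \<Rightarrow> real" where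
  "moll_deriv k \<alpha> x = inverse (\<integral>y. bump_prod (Suc k) (\<lambda>_. 0) (y :: real ^ 'n) \<partial>lborel) * bump_prod (Suc k) \<alpha> x"

lemma moll_deriv_0: "moll_deriv k (\<lambda>_. 0) = moll k"
  by (simp add: moll_deriv_def[abs_def] moll_def[abs_def])

lemma moll_deriv_props:
  "continuous_on UNIV (moll_deriv k \<alpha>)" "bounded_support (moll_deriv k \<alpha>)"
  "has_partial j (moll_deriv k \<alpha>) (moll_deriv k (incr j \<alpha>))"
proof -
  show "continuous_on UNIV (moll_deriv k \<alpha>)"
    unfolding moll_deriv_def[abs_def] by (intro continuous_intros continuous_bump_prod)
  show "bounded_support (moll_deriv k \<alpha>)"
    unfolding moll_deriv_def[abs_def] by (intro bounded_support_mult bounded_support_bump_prod) simp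
  show "has_partial j (moll_deriv k \<alpha>) (moll_deriv k (incr j \<alpha>))"
    using has_partial_bump_prod[of j "real (Suc k)" \<alpha>]
    unfolding has_partial_def moll_deriv_def by (auto intro: DERIV_cmult)
qed

text \<open>The counterpart of \<open>weak_differential UNIV\<close> for Borel representatives of
  the scalar components, with integrals over \<open>lborel\<close>.\<close>

definition weak_jacobian :: "('n::finite \<Rightarrow> real ^ 'n \<Rightarrow> real) \<Rightarrow> ('n \<Rightarrow> 'n \<Rightarrow> real ^ 'n \<Rightarrow> real) \<Rightarrow> bool" where
  "weak_jacobian F A \<longleftrightarrow> (\<forall>i. loc_integrable (F i)) \<and> (\<forall>i j. loc_integrable (A i j)) \<and>
     (\<forall>\<phi>\<in>test_functions UNIV. \<forall>i j.
        (\<integral>x. F i x * partial_deriv j \<phi> x \<partial>lborel) = - (\<integral>x. A i j x * \<phi> x \<partial>lborel))"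

text \<open>The test function is the reflected kernel; differentiating it in y produces a minus sign
  that cancels the one in the definition of weak derivatives. Thus a mollified weak derivative is a
  classical derivative of the mollified function, and its own derivatives fall on the kernel
  again.\<close>

lemma conv_weak_jacobian:
  assumes "weak_jacobian F A"
  shows "conv (moll_deriv k \<alpha>) (A i j) = conv (moll_deriv k (incr j \<alpha>)) (F i)"
proof
  fix x
  define c where "c = inverse (\<integral>y. bump_prod (Suc k) (\<lambda>_. 0) (y :: real ^ 'a) \<partial>lborel)"
  have "(\<integral>y. F i y * partial_deriv j (\<lambda>y. c * bump_prod (Suc k) \<alpha> (x - y)) y \<partial>lborel)
      = - (\<integral>y. A i j y * (c * bump_prod (Suc k) \<alpha> (x - y)) \<partial>lborel)"
    using assms test_function_bump_prod(1)[where a="real (Suc k)" and c=c and \<alpha>=\<alpha> and x=x]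
    by (auto simp: weak_jacobian_def)
  moreover have "(\<lambda>y. F i y * (- (c * bump_prod (Suc k) (incr j \<alpha>) (x - y))))
      = (\<lambda>y. - (F i y * (c * bump_prod (Suc k) (incr j \<alpha>) (x - y))))" by simp
  ultimately show "conv (moll_deriv k \<alpha>) (A i j) x = conv (moll_deriv k (incr j \<alpha>)) (F i) x"
    unfolding conv_def moll_deriv_def test_function_bump_prod(2)[where a="real (Suc k)", OF of_nat_0_less_iff[THEN iffD2, OF zero_less_Suc]]
      c_def[symmetric] by (auto simp: mult_ac)
qed

lemma moll_radius_tendsto: "(\<lambda>k. real CARD('n::finite) / real (Suc k)) \<longlonglongrightarrow> 0"
  by real_asymp

lemma AE_if_AE_cball:
  fixes P :: "'a::euclidean_space \<Rightarrow> bool"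
  assumes "\<And>m::nat. AE x in lborel. x \<in> cball 0 (real m) \<longrightarrow> P x"
  shows "AE x in lborel. P x"
proof -
  have "AE x in lborel. \<forall>m. x \<in> cball 0 (real m) \<longrightarrow> P x"
    by (subst AE_all_countable) (use assms in blast)
  then show ?thesis
  proof eventually_elim
    case (elim x)
    obtain m where "norm x \<le> real m" using real_arch_simple by blast
    then show ?case using elim by auto
  qed
qed

text \<open>Both candidates have the same mollifications, because these are determined by F, and
  along a common subsequence the mollifications recover each of them almost everywhere. This
  reconciles the weak differentials that the Sobolev condition and the distortion inequality provide
  separately.\<close>

lemma weak_jacobian_unique:
  assumes "weak_jacobian F A" "weak_jacobian F A'"
  shows "AE x in lborel. A i j x = A' i j x"
proof (rule AE_if_AE_cball)
  fix m :: nat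
  have eq: "conv (moll k) (A i j) = conv (moll k) (A' i j)" for k
    using conv_weak_jacobian[OF assms(1), of k "\<lambda>_. 0" i j] conv_weak_jacobian[OF assms(2), of k "\<lambda>_. 0" i j]
    by (simp add: moll_deriv_0)
  obtain r where "AE x in lborel. x \<in> cball 0 (real m) \<longrightarrow> (\<forall>g\<in>{A i j, A' i j}. (\<lambda>k. conv (moll (r k)) g x) \<longlonglongrightarrow> g x)"
    using assms
    by (rule_tac conv_tendsto_AE_subseq[of "{A i j, A' i j}" moll, OF _ _ mollifier_moll moll_radius_tendsto])
      (auto simp: weak_jacobian_def)
  then show "AE x in lborel. x \<in> cball 0 (real m) \<longrightarrow> A i j x = A' i j x"
    by eventually_elim (auto simp: eq intro: LIMSEQ_unique)
qed

lemma has_partial_0_imp_const: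
  fixes F :: "real ^ 'n \<Rightarrow> real"
  assumes "\<And>j. has_partial j F (\<lambda>_. 0)"
  shows "F x = F 0"
proof -
  have step: "F (x + t *\<^sub>R axis j 1) = F x" for x t j
    using has_partial_increment_bound[OF assms, of 0 x t j] by simp
  have "F (\<Sum>j\<in>S. x $ j *\<^sub>R axis j 1) = F 0" if "finite S" for S :: "'n set"
    using that
  proof induction
    case (insert j S)
    have "(\<Sum>j\<in>insert j S. x $ j *\<^sub>R axis j 1) = (\<Sum>j\<in>S. x $ j *\<^sub>R axis j (1::real)) + x $ j *\<^sub>R axis j 1"
      by (subst sum.insert[OF insert.hyps]) (rule add.commute)
    then show ?case
      by (simp only: step insert.IH)
  qed simp
  then have "F (\<Sum>j\<in>UNIV. x $ j *\<^sub>R axis j 1) = F 0" by simp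
  also have "(\<Sum>j\<in>UNIV. x $ j *\<^sub>R axis j 1) = x"
    using basis_expansion[of x] unfolding scalar_mult_eq_scaleR .
  finally show ?thesis .
qed

lemma not_AE_false_cball: "\<not> (AE x in lborel. (x :: 'a::euclidean_space) \<notin> cball 0 1)"
proof
  assume "AE x in lborel. (x :: 'a) \<notin> cball 0 1"
  then have "(cball 0 1 :: 'a set) \<in> null_sets lborel" by (subst AE_iff_null_sets) auto
  then have "negligible (cball 0 1 :: 'a set)"
    by (simp add: negligible_iff_null_sets null_sets_completionI)
  then have "negligible (ball 0 1 :: 'a set)" by (rule negligible_subset) (rule ball_subset_cball)
  moreover have "\<not> negligible (ball 0 1 :: 'a set)" by (rule open_not_negligible) auto
  ultimately show False by blast
qed

text \<open>Every mollification of \<open>F i\<close> has vanishing partial derivatives and is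
  therefore constant. Its values at 0 then converge, along a subsequence, to the value of
  \<open>F i\<close> at almost every point of a given ball.\<close>

lemma weak_jacobian_0_imp_const:
  assumes w: "weak_jacobian F A" and 0: "\<And>i j. AE x in lborel. A i j x = 0"
  shows "\<exists>c. AE x in lborel. F i x = c"
proof -
  have [measurable]: "A i j \<in> borel_measurable borel" for i j
    using w by (simp add: weak_jacobian_def loc_integrable_def)
  have "conv (moll k) (A i j) x = 0" for k j x
    unfolding conv_def using 0[of i j] by (intro integral_eq_zero_AE) (auto elim!: eventually_mono)
  then have z: "conv (moll_deriv k (incr j (\<lambda>_. 0))) (F i) = (\<lambda>_. 0)" for k j
    using conv_weak_jacobian[OF w, of k "\<lambda>_. 0" i j] by (auto simp: moll_deriv_0 fun_eq_iff)
  have "has_partial j (conv (moll_deriv k (\<lambda>_. 0)) (F i)) (conv (moll_deriv k (incr j (\<lambda>_. 0))) (F i))" for j k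
    using w by (intro has_partial_conv moll_deriv_props) (auto simp: weak_jacobian_def)
  then have const: "conv (moll k) (F i) x = conv (moll k) (F i) 0" for k x
    using has_partial_0_imp_const[of "conv (moll k) (F i)" x] by (simp add: z moll_deriv_0)
  \<comment> \<open>\<open>Suc m\<close> makes every ball contain the unit ball, which has positive
    measure and forces the constants of different balls to agree.\<close>
  have ex: "\<exists>c. AE x in lborel. x \<in> cball 0 (real (Suc m)) \<longrightarrow> F i x = c" for m
  proof -
    obtain r where r: "AE x in lborel. x \<in> cball 0 (real (Suc m)) \<longrightarrow> (\<forall>g\<in>{F i}. (\<lambda>k. conv (moll (r k)) g x) \<longlonglongrightarrow> g x)"
      using w
      by (rule_tac conv_tendsto_AE_subseq[of "{F i}" moll, OF _ _ mollifier_moll moll_radius_tendsto])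
        (auto simp: weak_jacobian_def)
    have "AE x in lborel. x \<in> cball 0 (real (Suc m)) \<longrightarrow> F i x = lim (\<lambda>k. conv (moll (r k)) (F i) 0)"
      using r
    proof eventually_elim
      case (elim x)
      then show ?case using const[of _ x] by (auto simp: limI)
    qed
    then show ?thesis by blast
  qed
  have "\<exists>c. \<forall>m. AE x in lborel. x \<in> cball 0 (real (Suc m)) \<longrightarrow> F i x = c m"
    using ex by (intro choice allI)
  then obtain c where c: "\<And>m. AE x in lborel. x \<in> cball 0 (real (Suc m)) \<longrightarrow> F i x = c m" by blast
  have "c m = c 0" for m
  proof (rule ccontr)
    assume "c m \<noteq> c 0"
    have "AE x in lborel. (x :: real ^ 'a) \<notin> cball 0 1"
      using c[of m] c[of 0] by eventually_elim (use \<open>c m \<noteq> c 0\<close> in auto)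
    then show False using not_AE_false_cball by blast
  qed
  note c0 = this
  have "AE x in lborel. F i x = c 0"
  proof (rule AE_if_AE_cball)
    fix m :: nat
    show "AE x in lborel. x \<in> cball 0 (real m) \<longrightarrow> F i x = c 0"
      using c[of m] by eventually_elim (use c0[of m] in auto)
  qed
  then show ?thesis by blast
qed

section \<open>Determinants: measurability, continuity, bounds and linearity in one row\<close>

abbreviation mat_of :: "('n \<Rightarrow> 'n \<Rightarrow> real) \<Rightarrow> real ^ 'n ^ 'n" where
  "mat_of B \<equiv> (\<chi> i j. B i j)"

abbreviation replace_row :: "'n \<Rightarrow> ('n \<Rightarrow> real) \<Rightarrow> ('n \<Rightarrow> 'n \<Rightarrow> real) \<Rightarrow> real ^ 'n ^ 'n" where
  "replace_row i0 U B \<equiv> (\<chi> i j. if i = i0 then U j else B i j)"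

lemma borel_measurable_det [measurable (raw)]:
  fixes B :: "'n::finite \<Rightarrow> 'n \<Rightarrow> 'a \<Rightarrow> real"
  assumes "\<And>i j. B i j \<in> borel_measurable M"
  shows "(\<lambda>x. det (\<chi> i j. B i j x)) \<in> borel_measurable M"
  unfolding det_def vec_lambda_beta
  by (intro borel_measurable_sum borel_measurable_times borel_measurable_prod borel_measurable_const assms)

lemma tendsto_det:
  fixes B :: "'a \<Rightarrow> 'n::finite \<Rightarrow> 'n \<Rightarrow> real"
  assumes "\<And>i j. ((\<lambda>k. B k i j) \<longlongrightarrow> C i j) net"
  shows "((\<lambda>k. det (mat_of (B k))) \<longlongrightarrow> det (mat_of C)) net"
  unfolding det_def using assms by (auto intro!: tendsto_intros)

lemma continuous_on_det:
  fixes B :: "'n::finite \<Rightarrow> 'n \<Rightarrow> 'a::topological_space \<Rightarrow> real"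
  assumes "\<And>i j. continuous_on S (B i j)"
  shows "continuous_on S (\<lambda>x. det (\<chi> i j. B i j x))"
  using assms by (auto simp: continuous_on_def intro!: tendsto_det)

text \<open>The Leibniz formula has n! terms, each a product with one factor per row. A separate
  bound for each row is what the replaced row calls for.\<close>

lemma abs_det_le:
  fixes B :: "'n::finite \<Rightarrow> 'n \<Rightarrow> real"
  assumes "\<And>i j. \<bar>B i j\<bar> \<le> b i"
  shows "\<bar>det (mat_of B)\<bar> \<le> fact CARD('n) * (\<Prod>i\<in>UNIV. b i)"
proof -
  have "\<bar>det (mat_of B)\<bar> \<le> (\<Sum>p | p permutes (UNIV::'n set). \<bar>of_int (sign p) * (\<Prod>i\<in>UNIV. mat_of B $ i $ p i)\<bar>)"
    unfolding det_def by (rule sum_abs)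
  also have "\<dots> \<le> (\<Sum>p | p permutes (UNIV::'n set). \<Prod>i\<in>UNIV. b i)"
  proof (rule sum_mono)
    fix p :: "'n \<Rightarrow> 'n"
    have "\<bar>of_int (sign p) * (\<Prod>i\<in>UNIV. mat_of B $ i $ p i)\<bar> = (\<Prod>i\<in>UNIV. \<bar>B i (p i)\<bar>)"
      by (simp add: abs_mult abs_prod sign_def)
    also have "\<dots> \<le> (\<Prod>i\<in>UNIV. b i)" by (intro prod_mono) (auto simp: assms)
    finally show "\<bar>of_int (sign p) * (\<Prod>i\<in>UNIV. mat_of B $ i $ p i)\<bar> \<le> (\<Prod>i\<in>UNIV. b i)" .
  qed
  also have "\<dots> = fact CARD('n) * (\<Prod>i\<in>UNIV. b i)"
    by (simp add: card_permutations[of UNIV "CARD('n)"])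
  finally show ?thesis .
qed

lemma abs_det_replace_row_le:
  fixes B :: "'n::finite \<Rightarrow> 'n \<Rightarrow> real"
  assumes "\<And>j. \<bar>U j\<bar> \<le> u" "\<And>i j. \<bar>B i j\<bar> \<le> q"
  shows "\<bar>det (replace_row i0 U B)\<bar> \<le> fact CARD('n) * (u * q ^ (CARD('n) - 1))"
proof -
  have "\<bar>det (replace_row i0 U B)\<bar> \<le> fact CARD('n) * (\<Prod>i\<in>UNIV. if i = i0 then u else q)"
    by (rule abs_det_le) (use assms in auto)
  also have "(\<Prod>i\<in>UNIV. if i = i0 then u else q) = u * (\<Prod>i\<in>UNIV - {i0}. if i = i0 then u else q)"
    by (subst prod.remove[of _ i0]) auto
  also have "(\<Prod>i\<in>UNIV - {i0}. if i = i0 then u else q) = (\<Prod>i\<in>UNIV - {i0}. q)"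
    by (rule prod.cong) auto
  finally show ?thesis by (simp add: card_Diff_singleton)
qed

lemma det_replace_row_linear:
  "det (replace_row i0 (\<lambda>j. a * U j + b * V j) B) = a * det (replace_row i0 U B) + b * det (replace_row i0 V B)"
proof -
  have *: "replace_row i0 (\<lambda>j. a * U j + b * V j) B
      = (\<chi> i. if i = i0 then a *s (\<chi> j. U j) + b *s (\<chi> j. V j) else (\<chi> j. B i j))"
    "replace_row i0 U B = (\<chi> i. if i = i0 then (\<chi> j. U j) else (\<chi> j. B i j))"
    "replace_row i0 V B = (\<chi> i. if i = i0 then (\<chi> j. V j) else (\<chi> j. B i j))"
    by (simp_all add: vec_eq_iff)
  show ?thesis unfolding *
    by (simp only: det_row_add[of i0 "\<lambda>_. a *s (\<chi> j. U j)" "\<lambda>_. b *s (\<chi> j. V j)"]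
        det_row_mul[of i0 _ "\<lambda>_. _"])
qed

text \<open>The null Lagrangian property is applied with the gradient of \<phi> times the mollified
  \<open>F i0\<close> in row i0. By the product rule and linearity in that row, the determinant is
  the sum of the two integrands. The symmetry of second derivatives is that of incrementing a
  multi-index twice.\<close>

lemma smooth_det_by_parts:
  fixes F :: "'n::finite \<Rightarrow> real ^ 'n \<Rightarrow> real"
  assumes w: "weak_jacobian F A"
    and \<phi>: "continuous_on UNIV \<phi>" "bounded_support \<phi>"
    and \<Phi>: "\<And>j. continuous_on UNIV (\<Phi> j)" "\<And>j. bounded_support (\<Phi> j)" "\<And>j. has_partial j \<phi> (\<Phi> j)"
  shows "(\<integral>x. \<phi> x * det (\<chi> i j. conv (moll k) (A i j) x) \<partial>lborel) =
     - (\<integral>x. conv (moll k) (F i0) x * det (replace_row i0 (\<lambda>j. \<Phi> j x) (\<lambda>i j. conv (moll k) (A i j) x)) \<partial>lborel)"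
    (is "(\<integral>x. ?a x \<partial>_) = - (\<integral>x. ?b x \<partial>_)")
proof -
  let ?z = "\<lambda>_::'n. 0::nat"
  have li: "loc_integrable (F i)" "loc_integrable (A i j)" for i j using w by (auto simp: weak_jacobian_def)
  have V: "conv (moll k) (A i j) = conv (moll_deriv k (incr j ?z)) (F i)" for i j
    using conv_weak_jacobian[OF w, of k ?z] by (simp add: moll_deriv_0)
  have pf: "has_partial j (conv (moll k) (F i)) (conv (moll k) (A i j))" for i j
  proof -
    have "has_partial j (conv (moll_deriv k ?z) (F i)) (conv (moll_deriv k (incr j ?z)) (F i))"
      by (intro has_partial_conv li moll_deriv_props)
    then show ?thesis by (simp only: V moll_deriv_0)
  qed
  have cf: "continuous_on UNIV (conv (moll k) (F i))" for i
    unfolding moll_deriv_0[symmetric] by (intro continuous_conv li moll_deriv_props)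
  have cV: "continuous_on UNIV (conv (moll k) (A i j))" for i j
    unfolding V by (intro continuous_conv li moll_deriv_props)
  have "(\<integral>x. det (replace_row i0 (\<lambda>j. conv (moll k) (F i0) x * \<Phi> j x + \<phi> x * conv (moll k) (A i0 j) x)
      (\<lambda>i j. conv (moll k) (A i j) x)) \<partial>lborel) = 0"
  proof (rule integral_det_gradient_eq_0[where u="\<lambda>x. \<phi> x * conv (moll k) (F i0) x"
        and W="\<lambda>i j l. conv (moll_deriv k (incr l (incr j ?z))) (F i)"])
    show "has_partial l (conv (moll k) (A i j)) (conv (moll_deriv k (incr l (incr j ?z))) (F i))" for i j l
      unfolding V by (intro has_partial_conv li moll_deriv_props)
    show "conv (moll_deriv k (incr l (incr j ?z))) (F i) x = conv (moll_deriv k (incr j (incr l ?z))) (F i) x" for i j l x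
      by (rule arg_cong[where f="\<lambda>\<alpha>. conv (moll_deriv k \<alpha>) (F i) x"]) (auto simp: fun_eq_iff)
    show "has_partial j (\<lambda>x. \<phi> x * conv (moll k) (F i0) x)
        (\<lambda>x. conv (moll k) (F i0) x * \<Phi> j x + \<phi> x * conv (moll k) (A i0 j) x)" for j
      using has_partial_mult[OF \<Phi>(3) pf, of j i0] by (simp add: mult.commute)
  qed (intro continuous_intros \<phi> \<Phi> cf cV bounded_support_add bounded_support_mult continuous_conv li moll_deriv_props)+
  moreover have "det (replace_row i0 (\<lambda>j. conv (moll k) (F i0) x * \<Phi> j x + \<phi> x * conv (moll k) (A i0 j) x)
      (\<lambda>i j. conv (moll k) (A i j) x)) = ?b x + ?a x" for x
  proof -
    have "replace_row i0 (\<lambda>j. conv (moll k) (A i0 j) x) (\<lambda>i j. conv (moll k) (A i j) x)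
        = (\<chi> i j. conv (moll k) (A i j) x)" by (auto simp: vec_eq_iff)
    then show ?thesis
      using det_replace_row_linear[of i0 "conv (moll k) (F i0) x" "\<lambda>j. \<Phi> j x" "\<phi> x" "\<lambda>j. conv (moll k) (A i0 j) x"
          "\<lambda>i j. conv (moll k) (A i j) x"] by simp
  qed
  moreover have "integrable lborel ?a"
    by (intro integrable_bounded_support_mult continuous_imp_loc_integrable continuous_on_det cV \<phi>)
  moreover have "integrable lborel ?b"
  proof -
    have c: "continuous_on UNIV ?b"
    proof (intro continuous_intros cf continuous_on_det)
      show "continuous_on UNIV (\<lambda>x. if i = i0 then \<Phi> j x else conv (moll k) (A i j) x)" for i j
        using \<Phi>(1) cV by (cases "i = i0") auto
    qed
    have "bounded_support ?b"
    proof -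
      have "\<exists>r. \<forall>x. norm x \<ge> r \<longrightarrow> (\<forall>j. \<Phi> j x = 0)"
      proof -
        obtain r where r: "\<And>j x. norm x \<ge> r j \<Longrightarrow> \<Phi> j x = 0"
          using \<Phi>(2) unfolding bounded_support_def by metis
        show ?thesis
        proof (intro exI allI impI)
          fix x :: "real ^ 'n" and j assume "Max (range r) \<le> norm x"
          moreover have "r j \<le> Max (range r)" by (rule Max_ge) auto
          ultimately show "\<Phi> j x = 0" by (intro r[of j]) linarith
        qed
      qed
      then obtain r where r: "\<And>x j. norm x \<ge> r \<Longrightarrow> \<Phi> j x = 0" by blast
      have "?b x = 0" if "norm x \<ge> r" for x
        using det_replace_row_linear[of i0 0 "\<lambda>_. 0" 0 "\<lambda>_. 0" "\<lambda>i j. conv (moll k) (A i j) x"] r[OF that]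
        by (simp cong: if_cong)
      then show ?thesis by (auto simp: bounded_support_def)
    qed
    then show ?thesis using integrable_bounded_support_mult[OF loc_integrable_const[of 1] c] by simp
  qed
  ultimately show ?thesis by simp
qed

section \<open>Integration by parts for the weak Jacobian determinant\<close>


text \<open>q is the largest modulus of an entry, so q ^ m is one of the summands. The sum is
  preferred to the maximum because Jensen's inequality and L^1 convergence can be applied to it
  entry by entry.\<close>

lemma obtain_entry_bound:
  fixes B :: "'n::finite \<Rightarrow> 'n \<Rightarrow> real"
  obtains q where "q \<ge> 0" "\<And>i j. \<bar>B i j\<bar> \<le> q" "\<And>m. q ^ m \<le> (\<Sum>i\<in>UNIV. \<Sum>j\<in>UNIV. \<bar>B i j\<bar> ^ m)"
proof -
  define S where "S = (\<lambda>(i, j). \<bar>B i j\<bar>) ` UNIV"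
  have S: "finite S" "S \<noteq> {}" by (auto simp: S_def)
  have le: "\<bar>B i j\<bar> \<le> Max S" for i j
    by (intro Max_ge S) (auto simp: S_def)
  obtain i j where ij: "Max S = \<bar>B i j\<bar>" using Max_in[OF S] unfolding S_def by fast
  show thesis
  proof (rule that[OF _ le])
    show "Max S \<ge> 0" by (simp add: ij)
    fix m
    have "\<bar>B i j\<bar> ^ m \<le> (\<Sum>j\<in>UNIV. \<bar>B i j\<bar> ^ m)"
      by (intro member_le_sum) auto
    also have "\<dots> \<le> (\<Sum>i\<in>UNIV. \<Sum>j\<in>UNIV. \<bar>B i j\<bar> ^ m)"
      by (intro member_le_sum[of i UNIV "\<lambda>i. \<Sum>j\<in>UNIV. \<bar>B i j\<bar> ^ m"] sum_nonneg) auto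
    finally show "Max S ^ m \<le> (\<Sum>i\<in>UNIV. \<Sum>j\<in>UNIV. \<bar>B i j\<bar> ^ m)" by (simp add: ij)
  qed
qed

lemma power_pred_le:
  fixes q :: real
  assumes "q \<ge> 0"
  shows "q ^ (m - 1) \<le> 1 + q ^ m"
proof (cases "q \<le> 1")
  case True
  then have "q ^ (m - 1) \<le> 1" using assms by (simp add: power_le_one)
  then show ?thesis using assms by (smt (verit) zero_le_power)
next
  case False
  then have "q ^ (m - 1) \<le> q ^ m" by (intro power_increasing) auto
  then show ?thesis by simp
qed

text \<open>The second determinant has only n - 1 rows of B, and q^(n-1) is raised to 1 + q^n. Both
  sides of the integration by parts then share one form of majorant.\<close>

lemma det_bounds:
  fixes B :: "'n::finite \<Rightarrow> 'n \<Rightarrow> real"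
  defines "S \<equiv> (\<Sum>i\<in>UNIV. \<Sum>j\<in>UNIV. \<bar>B i j\<bar> ^ CARD('n))"
  shows "\<bar>det (mat_of B)\<bar> \<le> fact CARD('n) * (1 + S)"
    and "(\<And>j. \<bar>U j\<bar> \<le> u) \<Longrightarrow> \<bar>det (replace_row i0 U B)\<bar> \<le> fact CARD('n) * (u * (1 + S))"
proof -
  obtain q where q: "q \<ge> 0" "\<And>i j. \<bar>B i j\<bar> \<le> q" "q ^ CARD('n) \<le> S"
    using obtain_entry_bound[of B] unfolding S_def by metis
  have "\<bar>det (mat_of B)\<bar> \<le> fact CARD('n) * (\<Prod>i\<in>(UNIV::'n set). q)"
    by (rule abs_det_le) (use q in auto)
  also have "\<dots> \<le> fact CARD('n) * (1 + S)" using q(3) by (intro mult_left_mono) auto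
  finally show "\<bar>det (mat_of B)\<bar> \<le> fact CARD('n) * (1 + S)" .
  assume u: "\<And>j. \<bar>U j\<bar> \<le> u"
  then have u0: "u \<ge> 0" using abs_ge_zero order.trans by blast
  have "\<bar>det (replace_row i0 U B)\<bar> \<le> fact CARD('n) * (u * q ^ (CARD('n) - 1))"
    by (rule abs_det_replace_row_le) (use u q in auto)
  also have "\<dots> \<le> fact CARD('n) * (u * (1 + S))"
    using power_pred_le[OF q(1), of "CARD('n)"] q(3) u0 by (intro mult_left_mono) auto
  finally show "\<bar>det (replace_row i0 U B)\<bar> \<le> fact CARD('n) * (u * (1 + S))" .
qed

lemma integrable_abs_bound:
  assumes "integrable M (H :: 'a \<Rightarrow> real)" "v \<in> borel_measurable M" "AE x in M. \<bar>v x\<bar> \<le> H x"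
  shows "integrable M v"
  by (rule Bochner_Integration.integrable_bound[OF assms(1,2)]) (use assms(3) in \<open>auto elim!: eventually_mono\<close>)

lemma loc_integrable_imp_integrable:
  assumes "loc_integrable g"
  shows "integrable lborel (\<lambda>x. indicat_real (cball 0 R) x * g x)"
  using assms by (simp add: loc_integrable_def set_integrable_def)

lemma loc_integrable_add: "loc_integrable g \<Longrightarrow> loc_integrable h \<Longrightarrow> loc_integrable (\<lambda>x. g x + h x)"
  by (auto simp: loc_integrable_def)

lemma loc_integrable_sum:
  "(\<And>i. i \<in> I \<Longrightarrow> loc_integrable (g i)) \<Longrightarrow> loc_integrable (\<lambda>x. \<Sum>i\<in>I. g i x)"
  by (induction I rule: infinite_finite_induct) (auto intro: loc_integrable_add loc_integrable_const)

text \<open>The limit of \<open>smooth_det_by_parts\<close> along a subsequence. By Jensen, the n-th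
  powers of the mollified entries are at most the mollifications of
  \<open>\<bar>A i j x\<bar> ^ CARD('n)\<close>, and these converge locally in L^1, as
  \<open>Pratt_convergence\<close> requires. The bound M, inherited by the mollifications of F,
  controls the undifferentiated factor on the right.\<close>

lemma weak_det_by_parts:
  fixes F :: "'n::finite \<Rightarrow> real ^ 'n \<Rightarrow> real"
  assumes w: "weak_jacobian F A" and M: "\<And>i x. \<bar>F i x\<bar> \<le> M"
    and An: "\<And>i j. loc_integrable (\<lambda>x. \<bar>A i j x\<bar> ^ CARD('n))"
    and \<phi>: "continuous_on UNIV \<phi>" "bounded_support \<phi>"
    and \<Phi>: "\<And>j. continuous_on UNIV (\<Phi> j)" "\<And>j. bounded_support (\<Phi> j)" "\<And>j. has_partial j \<phi> (\<Phi> j)"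
  shows "integrable lborel (\<lambda>x. \<phi> x * det (\<chi> i j. A i j x))"
    and "integrable lborel (\<lambda>x. F i0 x * det (replace_row i0 (\<lambda>j. \<Phi> j x) (\<lambda>i j. A i j x)))"
    and "(\<integral>x. \<phi> x * det (\<chi> i j. A i j x) \<partial>lborel) =
     - (\<integral>x. F i0 x * det (replace_row i0 (\<lambda>j. \<Phi> j x) (\<lambda>i j. A i j x)) \<partial>lborel)"
proof -
  let ?n = "CARD('n)"
  have M0: "M \<ge> 0" using M[of i0 0] abs_ge_zero order.trans by blast
  have li: "loc_integrable (F i)" "loc_integrable (A i j)" for i j using w by (auto simp: weak_jacobian_def)
  then have [measurable]: "F i \<in> borel_measurable borel" "A i j \<in> borel_measurable borel" for i j
    by (auto simp: loc_integrable_def)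
  have [measurable]: "\<phi> \<in> borel_measurable borel" "\<Phi> j \<in> borel_measurable borel" for j
    using \<phi>(1) \<Phi>(1) by (auto intro: continuous_imp_borel)
  obtain B0 r0 where b0: "B0 > 0" "\<And>x. \<bar>\<phi> x\<bar> \<le> B0 * indicator (cball 0 r0) x"
    using bounded_support_bound[OF \<phi>] by metis
  have "\<exists>b r. b > 0 \<and> (\<forall>x. \<bar>\<Phi> j x\<bar> \<le> b * indicator (cball 0 r) x)" for j
    using bounded_support_bound[OF \<Phi>(1)[of j] \<Phi>(2)[of j]] by metis
  then obtain b r where br: "\<And>j. b j > 0" "\<And>j x. \<bar>\<Phi> j x\<bar> \<le> b j * indicator (cball 0 (r j)) x"
    by metis
  define R where "R = Max (insert r0 (range r))"
  define Bd where "Bd = Max (insert B0 (range b))"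
  have Rr: "r0 \<le> R" "\<And>j. r j \<le> R" unfolding R_def by (rule Max_ge; simp)+
  have Bb: "B0 \<le> Bd" "\<And>j. b j \<le> Bd" unfolding Bd_def by (rule Max_ge; simp)+
  have Bd0: "Bd > 0" using Bb(1) b0(1) by simp
  define I where "I x = indicat_real (cball 0 R :: (real ^ 'n) set) x" for x
  have I01: "0 \<le> I x" "I x \<le> 1" for x by (auto simp: I_def indicator_def)
  have \<phi>I: "\<bar>\<phi> x\<bar> \<le> Bd * I x" for x
    using b0(2)[of x] Rr(1) Bb(1) b0(1)
    by (cases "norm x \<le> r0") (auto simp: I_def indicator_def)
  have \<Phi>I: "\<bar>\<Phi> j x\<bar> \<le> Bd * I x" for j x
    using br(2)[of j x] Rr(2)[of j] Bb(2)[of j] br(1)[of j]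
    by (cases "norm x \<le> r j") (auto simp: I_def indicator_def)
  \<comment> \<open>One constant for both integrands: without the factor M for the one with \<phi>,
    with it for the one with the gradient row.\<close>
  define C where "C = (1 + M) * (fact ?n * Bd)"
  have C: "fact ?n * Bd \<le> C" "M * (fact ?n * Bd) \<le> C" "C \<ge> 0"
    unfolding C_def using M0 Bd0 by (auto simp: algebra_simps)
  define H where "H x = C * (I x * (1 + (\<Sum>i\<in>UNIV. \<Sum>j\<in>UNIV. \<bar>A i j x\<bar> ^ ?n)))" for x
  have bound: "\<bar>\<phi> x * det (mat_of D)\<bar> \<le> C * (I x * (1 + S))"
    "\<bar>y\<bar> \<le> M \<Longrightarrow> \<bar>y * det (replace_row i0 (\<lambda>j. \<Phi> j x) D)\<bar> \<le> C * (I x * (1 + S))"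
    if "(\<Sum>i\<in>UNIV. \<Sum>j\<in>UNIV. \<bar>D i j\<bar> ^ ?n) \<le> S" for x y D S
  proof -
    define S0 where "S0 = (\<Sum>i\<in>UNIV. \<Sum>j\<in>UNIV. \<bar>D i j\<bar> ^ ?n)"
    have S0: "0 \<le> S0" "S0 \<le> S" using that by (auto simp: S0_def intro!: sum_nonneg)
    have "\<bar>\<phi> x * det (mat_of D)\<bar> \<le> (Bd * I x) * (fact ?n * (1 + S0))"
      unfolding abs_mult S0_def using Bd0 I01 by (intro mult_mono \<phi>I det_bounds(1)) auto
    also have "\<dots> = (fact ?n * Bd) * (I x * (1 + S0))" by (simp add: mult_ac)
    also have "\<dots> \<le> C * (I x * (1 + S))" using C S0 I01 Bd0 by (intro mult_mono) auto
    finally show "\<bar>\<phi> x * det (mat_of D)\<bar> \<le> C * (I x * (1 + S))" .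
    assume y: "\<bar>y\<bar> \<le> M"
    have "\<bar>y * det (replace_row i0 (\<lambda>j. \<Phi> j x) D)\<bar> \<le> M * (fact ?n * ((Bd * I x) * (1 + S0)))"
      unfolding abs_mult S0_def using y M0 by (intro mult_mono det_bounds(2) \<Phi>I) auto
    also have "\<dots> = (M * (fact ?n * Bd)) * (I x * (1 + S0))" by (simp add: mult_ac)
    also have "\<dots> \<le> C * (I x * (1 + S))" using C S0 I01 Bd0 M0 by (intro mult_mono) auto
    finally show "\<bar>y * det (replace_row i0 (\<lambda>j. \<Phi> j x) D)\<bar> \<le> C * (I x * (1 + S))" .
  qed
  have Hi: "integrable lborel H"
    unfolding H_def[abs_def] I_def
    by (intro integrable_mult_right loc_integrable_imp_integrable loc_integrable_add loc_integrable_sum An loc_integrable_const)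
  let ?v = "\<lambda>x. \<phi> x * det (\<chi> i j. A i j x)"
  let ?v' = "\<lambda>x. F i0 x * det (replace_row i0 (\<lambda>j. \<Phi> j x) (\<lambda>i j. A i j x))"
  have [measurable]: "(\<lambda>x. if i = i0 then \<Phi> j x else A i j x) \<in> borel_measurable borel" for i j by (cases "i = i0") simp_all
  show vi: "integrable lborel ?v"
    by (rule integrable_abs_bound[OF Hi])
      (auto simp: H_def intro!: bound(1) borel_measurable_times borel_measurable_det)
  show vi': "integrable lborel ?v'"
    by (rule integrable_abs_bound[OF Hi])
      (auto simp: H_def intro!: bound(2) M borel_measurable_times borel_measurable_det)
  \<comment> \<open>All components and entries must converge along the same subsequence.\<close>
  define Gs where "Gs = range F \<union> (\<lambda>(i, j). A i j) ` UNIV"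
  obtain s where s: "strict_mono s"
    "AE x in lborel. x \<in> cball 0 R \<longrightarrow> (\<forall>g\<in>Gs. (\<lambda>k. conv (moll (s k)) g x) \<longlonglongrightarrow> g x)"
  proof (rule conv_tendsto_AE_subseq[of Gs moll, OF _ _ mollifier_moll moll_radius_tendsto])
    show "finite Gs" by (simp add: Gs_def)
    show "loc_integrable g" if "g \<in> Gs" for g using that li by (auto simp: Gs_def)
  qed
  define V where "V k i j x = conv (moll (s k)) (A i j) x" for k i j x
  define f where "f k i x = conv (moll (s k)) (F i) x" for k i x
  define E where "E k i j x = conv (moll (s k)) (\<lambda>x. \<bar>A i j x\<bar> ^ ?n) x" for k i j x
  have cV: "continuous_on UNIV (V k i j)" "continuous_on UNIV (f k i)" "continuous_on UNIV (E k i j)" for k i j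
    unfolding V_def[abs_def] f_def[abs_def] E_def[abs_def]
    by (intro continuous_conv li An mollifierD[OF mollifier_moll])+
  have [measurable]: "V k i j \<in> borel_measurable borel" "f k i \<in> borel_measurable borel" for k i j
    using cV by (auto intro: continuous_imp_borel)
  have [measurable]: "(\<lambda>x. if i = i0 then \<Phi> j x else V k i j x) \<in> borel_measurable borel" for i j k by (cases "i = i0") simp_all
  have fM: "\<bar>f k i x\<bar> \<le> M" for k i x
  proof -
    have "conv (moll (s k)) (\<lambda>_. - M) x \<le> f k i x" "f k i x \<le> conv (moll (s k)) (\<lambda>_. M) x"
      unfolding f_def by (intro conv_mono[OF mollifier_moll] li loc_integrable_const, use M in \<open>auto simp: abs_le_iff minus_le_iff\<close>)+
    then show ?thesis by (simp add: conv_const[OF mollifier_moll] abs_le_iff)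
  qed
  have VE: "\<bar>V k i j x\<bar> ^ ?n \<le> E k i j x" for k i j x
    unfolding V_def E_def by (rule abs_conv_power_le[OF mollifier_moll li(2) An])
  \<comment> \<open>The mollified form of \<open>H\<close>: the sum in \<open>H\<close> is replaced
    by its mollification, while the indicator stays outside.\<close>
  define G where "G k x = C * (I x * (1 + (\<Sum>i\<in>UNIV. \<Sum>j\<in>UNIV. E k i j x)))" for k x
  have Gi: "integrable lborel (G k)" for k
    unfolding G_def[abs_def] I_def
    by (intro integrable_mult_right loc_integrable_imp_integrable loc_integrable_add loc_integrable_sum
        continuous_imp_loc_integrable cV loc_integrable_const)
  have GH: "(\<lambda>k. \<integral>x. \<bar>G k x - H x\<bar> \<partial>lborel) \<longlonglongrightarrow> 0"
  proof -
    define Q where "Q k i j x = \<bar>I x * (E k i j x - \<bar>A i j x\<bar> ^ ?n)\<bar>" for k i j x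
    have Qi: "integrable lborel (Q k i j)" for k i j
      unfolding Q_def[abs_def] I_def E_def
      by (intro integrable_abs conv_tendsto_L1(1)[OF An mollifier_moll moll_radius_tendsto])
    have "(\<lambda>k. \<integral>x. Q k i j x \<partial>lborel) \<longlonglongrightarrow> 0" for i j
      unfolding Q_def I_def E_def
      using LIMSEQ_subseq_LIMSEQ[OF conv_tendsto_L1(2)[OF An mollifier_moll moll_radius_tendsto] s(1)]
      by (simp add: o_def)
    then have "(\<lambda>k. C * (\<Sum>i\<in>UNIV. \<Sum>j\<in>UNIV. \<integral>x. Q k i j x \<partial>lborel)) \<longlonglongrightarrow> C * (\<Sum>i\<in>(UNIV::'n set). \<Sum>j\<in>(UNIV::'n set). 0)"
      by (intro tendsto_intros)
    then have lim: "(\<lambda>k. C * (\<Sum>i\<in>UNIV. \<Sum>j\<in>UNIV. \<integral>x. Q k i j x \<partial>lborel)) \<longlonglongrightarrow> 0" by simp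
    have le: "(\<integral>x. \<bar>G k x - H x\<bar> \<partial>lborel) \<le> C * (\<Sum>i\<in>UNIV. \<Sum>j\<in>UNIV. \<integral>x. Q k i j x \<partial>lborel)" for k
    proof -
      have "(\<integral>x. \<bar>G k x - H x\<bar> \<partial>lborel) \<le> (\<integral>x. C * (\<Sum>i\<in>UNIV. \<Sum>j\<in>UNIV. Q k i j x) \<partial>lborel)"
      proof (rule integral_mono)
        show "integrable lborel (\<lambda>x. \<bar>G k x - H x\<bar>)" using Gi[of k] Hi by auto
        show "integrable lborel (\<lambda>x. C * (\<Sum>i\<in>UNIV. \<Sum>j\<in>UNIV. Q k i j x))"
          using Qi by (intro integrable_mult_right Bochner_Integration.integrable_sum)
        fix x
        have "G k x - H x = C * (\<Sum>i\<in>UNIV. \<Sum>j\<in>UNIV. I x * (E k i j x - \<bar>A i j x\<bar> ^ ?n))"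
          by (simp add: G_def H_def algebra_simps sum_subtractf sum_distrib_left)
        also have "\<bar>\<dots>\<bar> \<le> C * (\<Sum>i\<in>UNIV. \<Sum>j\<in>UNIV. Q k i j x)"
          unfolding abs_mult abs_of_nonneg[OF C(3)] Q_def
          by (intro mult_left_mono C order.trans[OF sum_abs] sum_mono order.refl) (simp add: abs_mult[symmetric])
        finally show "\<bar>G k x - H x\<bar> \<le> C * (\<Sum>i\<in>UNIV. \<Sum>j\<in>UNIV. Q k i j x)" .
      qed
      also have "\<dots> = C * (\<Sum>i\<in>UNIV. \<Sum>j\<in>UNIV. \<integral>x. Q k i j x \<partial>lborel)"
        using Qi by (simp add: Bochner_Integration.integral_sum Bochner_Integration.integrable_sum)
      finally show ?thesis .
    qed
    show ?thesis
      by (rule tendsto_sandwich[OF _ _ tendsto_const lim]) (auto simp: le)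
  qed
  let ?u = "\<lambda>k x. \<phi> x * det (\<chi> i j. V k i j x)"
  let ?u' = "\<lambda>k x. f k i0 x * det (replace_row i0 (\<lambda>j. \<Phi> j x) (\<lambda>i j. V k i j x))"
  have VS: "(\<Sum>i\<in>UNIV. \<Sum>j\<in>UNIV. \<bar>V k i j x\<bar> ^ ?n) \<le> (\<Sum>i\<in>UNIV. \<Sum>j\<in>UNIV. E k i j x)" for k x
    by (intro sum_mono VE)
  have uG: "\<bar>?u k x\<bar> \<le> G k x" "\<bar>?u' k x\<bar> \<le> G k x" for k x
    unfolding G_def by (intro bound VS fM)+
  have ui: "integrable lborel (?u k)" "integrable lborel (?u' k)" for k
    by (rule integrable_abs_bound[OF Gi[of k]];
       auto intro!: uG borel_measurable_times borel_measurable_det)+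
  have lims: "AE x in lborel. (\<lambda>k. ?u k x) \<longlonglongrightarrow> ?v x \<and> (\<lambda>k. ?u' k x) \<longlonglongrightarrow> ?v' x"
    using s(2)
  proof eventually_elim
    case (elim x)
    show ?case
    proof (cases "x \<in> cball 0 R")
      case True
      have V: "(\<lambda>k. V k i j x) \<longlonglongrightarrow> A i j x" for i j
        unfolding V_def by (rule elim[rule_format, OF True]) (auto simp: Gs_def)
      have f: "(\<lambda>k. f k i x) \<longlonglongrightarrow> F i x" for i
        unfolding f_def by (rule elim[rule_format, OF True]) (auto simp: Gs_def)
      show ?thesis by (intro conjI tendsto_mult tendsto_const tendsto_det V f) (auto intro: V)
    next
      case False
      then have "\<phi> x = 0" "\<Phi> j x = 0" for j using \<phi>I[of x] \<Phi>I[of j x] by (auto simp: I_def)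
      moreover have "det (replace_row i0 (\<lambda>j. 0) D) = 0" for D :: "'n \<Rightarrow> 'n \<Rightarrow> real"
        using det_replace_row_linear[of i0 0 "\<lambda>_. 0" 0 "\<lambda>_. 0" D] by (simp cong: if_cong)
      ultimately show ?thesis by (simp cong: if_cong)
    qed
  qed
  have 1: "(\<lambda>k. \<integral>x. ?u k x \<partial>lborel) \<longlonglongrightarrow> (\<integral>x. ?v x \<partial>lborel)"
    by (rule Pratt_convergence[OF ui(1) vi Gi Hi GH]) (use uG lims in \<open>auto elim!: eventually_mono\<close>)
  have 2: "(\<lambda>k. \<integral>x. ?u' k x \<partial>lborel) \<longlonglongrightarrow> (\<integral>x. ?v' x \<partial>lborel)"
    by (rule Pratt_convergence[OF ui(2) vi' Gi Hi GH]) (use uG lims in \<open>auto elim!: eventually_mono\<close>)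
  have "(\<integral>x. ?u k x \<partial>lborel) = - (\<integral>x. ?u' k x \<partial>lborel)" for k
    unfolding V_def f_def by (rule smooth_det_by_parts[OF w \<phi> \<Phi>])
  with 1 tendsto_minus[OF 2] show "(\<integral>x. ?v x \<partial>lborel) = - (\<integral>x. ?v' x \<partial>lborel)"
    by (simp add: LIMSEQ_unique)
qed

section \<open>The energy estimate\<close>


text \<open>Either \<open>\<epsilon> k / R \<le> p\<close>, and the first summand dominates, or the second one does.\<close>

lemma young_split:
  fixes p k R \<epsilon> :: real
  assumes "p \<ge> 0" "k > 0" "R > 0" "\<epsilon> > 0" "n > 0"
  shows "p ^ (n - 1) / R \<le> p ^ n / (\<epsilon> * k) + \<epsilon> ^ (n - 1) * k ^ (n - 1) / R ^ n"
proof -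
  obtain m where n: "n = Suc m" using assms(5) by (cases n) auto
  have nn: "0 \<le> p ^ n / (\<epsilon> * k)" "0 \<le> \<epsilon> ^ (n - 1) * k ^ (n - 1) / R ^ n" using assms by auto
  show ?thesis
  proof (cases "\<epsilon> * k / R \<le> p")
    case True
    then have "p ^ m * (\<epsilon> * k / R) \<le> p ^ m * p" using assms by (intro mult_left_mono) auto
    then have "p ^ m / R \<le> p ^ n / (\<epsilon> * k)" using assms n by (simp add: field_simps)
    then show ?thesis using nn n by simp
  next
    case False
    then have "p ^ m \<le> (\<epsilon> * k / R) ^ m" using assms by (intro power_mono) auto
    then have "p ^ m / R \<le> (\<epsilon> * k / R) ^ m / R" using assms by (intro divide_right_mono) auto
    also have "\<dots> = \<epsilon> ^ (n - 1) * k ^ (n - 1) / R ^ n"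
      using n by (simp add: power_divide power_mult_distrib mult.commute)
    finally show ?thesis using nn n by simp
  qed
qed

text \<open>q stands for the operator norm of Df. It enters as a bound for the entries and through
  the distortion inequality, which also yields J \<ge> 0 almost everywhere.\<close>

lemma weak_jacobian_eq_0:
  fixes F :: "'n::finite \<Rightarrow> real ^ 'n \<Rightarrow> real"
  assumes n2: "CARD('n) \<ge> 2"
    and w: "weak_jacobian F A" and M: "\<And>i x. \<bar>F i x\<bar> \<le> M"
    and An: "\<And>i j. loc_integrable (\<lambda>x. \<bar>A i j x\<bar> ^ CARD('n))"
    and K: "\<And>x. 1 \<le> K x" "loc_integrable (\<lambda>x. K x ^ (CARD('n) - 1))"
      "\<And>R. R \<ge> 1 \<Longrightarrow> (\<integral>x. indicator (cball 0 R) x * K x ^ (CARD('n) - 1) \<partial>lborel) \<le> \<kappa> * R ^ CARD('n)"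
    and dist: "AE x in lborel. (\<forall>i j. \<bar>A i j x\<bar> \<le> q x) \<and> q x ^ CARD('n) \<le> K x * det (\<chi> i j. A i j x)"
  shows "AE x in lborel. \<forall>i j. A i j x = 0"
proof -
  let ?n = "CARD('n)" and ?z = "\<lambda>_::'n. 0::nat"
  \<comment> \<open>An arbitrary row, fixed for the integration by parts.\<close>
  obtain i0 :: 'n where True by blast
  have M0: "M \<ge> 0" using M[of i0 0] abs_ge_zero order.trans by blast
  define J where "J x = det (\<chi> i j. A i j x)" for x
  have [measurable]: "A i j \<in> borel_measurable borel" for i j
    using w by (auto simp: weak_jacobian_def loc_integrable_def)
  have [measurable]: "J \<in> borel_measurable borel"
    unfolding J_def[abs_def] by (rule borel_measurable_det) measurable
  have J: "AE x in lborel. 0 \<le> J x"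
    using dist
  proof eventually_elim
    case (elim x)
    have "0 \<le> q x" using elim abs_ge_zero order.trans by blast
    then have "0 \<le> K x * J x" using elim by (auto simp: J_def intro: order.trans[of 0 "q x ^ ?n"])
    then show ?case using K(1)[of x] by (simp add: zero_le_mult_iff)
  qed
  define h where "h = (bump_prod 1 ?z :: real ^ 'n \<Rightarrow> real)"
  define h' where "h' j = (bump_prod 1 (incr j ?z) :: real ^ 'n \<Rightarrow> real)" for j
  \<comment> \<open>The gradient of h is measured by the sum of the moduli, which dominates each
    partial derivative. The function g of the overview is g (x / R) here.\<close>
  define g where "g y = (\<Sum>j\<in>UNIV. \<bar>h' j y\<bar>)" for y
  have ch: "continuous_on UNIV h" "continuous_on UNIV (h' j)" "continuous_on UNIV g" for j
    unfolding h_def h'_def g_def[abs_def] by (intro continuous_intros continuous_bump_prod)+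
  have [measurable]: "h \<in> borel_measurable borel" "g \<in> borel_measurable borel" "h' j \<in> borel_measurable borel" for j
    using ch by (auto intro: continuous_imp_borel)
  have h0: "h 0 > 0" "\<And>y. h y \<ge> 0" unfolding h_def by (auto simp: bump_prod_0_pos bump_prod_nonneg)
  have g0: "\<And>y. g y \<ge> 0" unfolding g_def by (auto intro: sum_nonneg)
  have "h' j 0 = 0" for j
  proof -
    have "\<exists>i\<in>UNIV. 1 ^ incr j ?z i * bump (incr j ?z i) (1 * (0 :: real ^ 'n) $ i) = 0"
      by (intro bexI[of _ j]) (auto simp: bump_1_0)
    then show ?thesis unfolding h'_def bump_prod_def by (intro prod_zero) auto
  qed
  then have g_0: "g 0 = 0" by (simp add: g_def)
  obtain C0 where C0: "C0 > 0" "\<And>y. \<bar>h y\<bar> \<le> C0"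
    unfolding h_def using bounded_bump_prod[of 1 ?z] by auto
  obtain C1 where C1: "C1 > 0" "\<And>y. \<bar>g y\<bar> \<le> C1"
  proof -
    have "\<exists>B>0. \<forall>y. \<bar>h' j y\<bar> \<le> B" for j unfolding h'_def using bounded_bump_prod[of 1 "incr j ?z"] by simp
    then obtain B where B: "\<And>j. B j > 0" "\<And>j y. \<bar>h' j y\<bar> \<le> B j" by metis
    have "\<bar>g y\<bar> \<le> (\<Sum>j\<in>UNIV. B j)" for y
      using g0[of y] by (simp add: g_def sum_mono B)
    moreover have "(\<Sum>j\<in>UNIV. B j) > 0" using B by (intro sum_pos) auto
    ultimately show thesis using that by blast
  qed
  have g_supp: "g y = 0" if "norm y \<ge> real ?n" for y
    unfolding g_def h'_def using that bump_prod_eq_0[of 1 y] by simp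
  define \<eta> where "\<eta> R x = h (x /\<^sub>R R)" for R x
  have \<eta>: "bump_prod (1 / R) ?z = \<eta> R" for R
    using bump_prod_scale[of "1 / R" 1 ?z] by (simp add: \<eta>_def h_def fun_eq_iff divide_inverse)
  have \<eta>': "bump_prod (1 / R) (incr j ?z) = (\<lambda>x. h' j (x /\<^sub>R R) / R)" for R j
  proof
    fix x
    have "(\<Sum>i\<in>(UNIV::'n set). incr j ?z i) = 1" by (simp add: fun_upd_def sum.delta)
    then show "bump_prod (1 / R) (incr j ?z) x = h' j (x /\<^sub>R R) / R"
      using bump_prod_scale[of "1 / R" 1 "incr j ?z" x] by (simp only: h'_def mult_1_right power_one_right)
        (simp add: divide_inverse mult.commute)
  qed
  have \<eta>_meas [measurable]: "\<eta> R \<in> borel_measurable borel" for R unfolding \<eta>_def[abs_def] by measurable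
  have \<eta>0: "\<eta> R x \<ge> 0" "\<eta> R x \<le> C0" for R x using h0(2) C0(2)[of "x /\<^sub>R R"] by (auto simp: \<eta>_def)
  define \<Phi> where "\<Phi> R j x = real ?n * \<eta> R x ^ (?n - 1) * (h' j (x /\<^sub>R R) / R)" for R j x
  have pd: "has_partial j (\<lambda>x. \<eta> R x ^ ?n) (\<Phi> R j)" for R j
    using has_partial_power[OF has_partial_bump_prod[of j "1 / R" ?z], of ?n]
    unfolding \<Phi>_def[abs_def] \<eta> \<eta>' .
  have cont\<eta>: "continuous_on UNIV (\<eta> R)" for R by (simp only: \<eta>[symmetric] continuous_bump_prod)
  have cont\<eta>': "continuous_on UNIV (\<lambda>x. h' j (x /\<^sub>R R) / R)" for R j by (simp only: \<eta>'[symmetric] continuous_bump_prod)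
  have bs\<eta>: "bounded_support (\<eta> R)" "bounded_support (\<lambda>x. h' j (x /\<^sub>R R) / R)" if "R > 0" for R j
    using bounded_support_bump_prod[of "1 / R"] that by (simp_all only: \<eta>[symmetric] \<eta>'[symmetric]) auto
  have reg: "continuous_on UNIV (\<lambda>x. \<eta> R x ^ ?n)" "continuous_on UNIV (\<Phi> R j)" for R j
    unfolding \<Phi>_def by (intro continuous_intros cont\<eta> cont\<eta>')+
  have supp: "bounded_support (\<lambda>x. \<eta> R x ^ ?n)" "bounded_support (\<Phi> R j)" if "R > 0" for R j
  proof -
    show "bounded_support (\<lambda>x. \<eta> R x ^ ?n)" using bs\<eta>(1)[OF that] by (auto simp: bounded_support_def)
    show "bounded_support (\<Phi> R j)" unfolding \<Phi>_def by (intro bounded_support_mult bs\<eta> that)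
  qed
  note by_parts = weak_det_by_parts[OF w M An reg(1) supp(1) reg(2) supp(2) pd, folded J_def]
  \<comment> \<open>M bounds the component of f, n! comes from the Leibniz formula, and the second n
    from differentiating the n-th power of the cutoff. In \<open>C2\<close> below, the factor n ^ n
    arises because the gradient of the cutoff lives in the ball of radius n R.\<close>
  define C where "C = M * (fact ?n * real ?n)"
  have C: "C \<ge> 0" unfolding C_def using M0 by simp
  define C2 where "C2 = C * C1 * \<kappa> * real ?n ^ ?n"
  have \<kappa>: "\<kappa> \<ge> 0"
  proof -
    have "0 \<le> (\<integral>x. indicator (cball 0 1) x * K x ^ (?n - 1) \<partial>(lborel :: (real ^ 'n) measure))"
      using order.trans[OF zero_le_one K(1)] by (intro integral_nonneg_AE AE_I2) simp
    with K(3)[of 1] show ?thesis by simp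
  qed
  have C2: "C2 \<ge> 0" unfolding C2_def using C C1(1) \<kappa> by simp
  define I where "I R = (\<integral>x. \<eta> R x ^ ?n * J x \<partial>lborel)" for R
  define G where "G R = (\<integral>x. g (x /\<^sub>R R) * (\<eta> R x ^ ?n * J x) \<partial>lborel)" for R
  have intJ: "integrable lborel (\<lambda>x. \<eta> R x ^ ?n * J x)" if "R > 0" for R
    using by_parts(1)[OF that that] .
  have intG: "integrable lborel (\<lambda>x. g (x /\<^sub>R R) * (\<eta> R x ^ ?n * J x))" if "R > 0" for R
  proof (rule integrable_abs_bound)
    show "integrable lborel (\<lambda>x. C1 * \<bar>\<eta> R x ^ ?n * J x\<bar>)" using intJ[OF that] by auto
    show "AE x in lborel. \<bar>g (x /\<^sub>R R) * (\<eta> R x ^ ?n * J x)\<bar> \<le> C1 * \<bar>\<eta> R x ^ ?n * J x\<bar>"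
      unfolding abs_mult[of "g _"] by (intro AE_I2 mult_right_mono C1) auto
  qed measurable
  have main: "I R \<le> C / \<epsilon> * G R + C2 * \<epsilon> ^ (?n - 1)" if R: "R \<ge> 1" and \<epsilon>: "\<epsilon> > 0" for R \<epsilon>
  proof -
    have R0: "R > 0" using R by simp
    let ?b = "\<lambda>x. F i0 x * det (replace_row i0 (\<lambda>j. \<Phi> R j x) (\<lambda>i j. A i j x))"
    let ?k = "\<lambda>x. indicat_real (cball 0 (real ?n * R)) x * K x ^ (?n - 1)"
    let ?D = "C * C1 * (\<epsilon> ^ (?n - 1) / R ^ ?n)"
    have "real ?n \<ge> 1" using n2 by simp
    then have nR: "real ?n * R \<ge> 1" using mult_mono[of 1 "real ?n" 1 R] R by simp
    have ki: "integrable lborel ?k" by (rule loc_integrable_imp_integrable[OF K(2)])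
    have "I R = - (\<integral>x. ?b x \<partial>lborel)"
      unfolding I_def by (rule by_parts(3)[OF R0 R0])
    also have "\<dots> = (\<integral>x. - ?b x \<partial>lborel)" by simp
    also have "\<dots> \<le> (\<integral>x. C / \<epsilon> * (g (x /\<^sub>R R) * (\<eta> R x ^ ?n * J x)) + ?D * ?k x \<partial>lborel)"
    proof (rule integral_mono_AE)
      show "integrable lborel (\<lambda>x. - ?b x)" using by_parts(2)[OF R0 R0] by simp
      show "integrable lborel (\<lambda>x. C / \<epsilon> * (g (x /\<^sub>R R) * (\<eta> R x ^ ?n * J x)) + ?D * ?k x)"
        by (intro Bochner_Integration.integrable_add integrable_mult_right intG R0 ki)
      show "AE x in lborel. - ?b x \<le> C / \<epsilon> * (g (x /\<^sub>R R) * (\<eta> R x ^ ?n * J x)) + ?D * ?k x"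
        using dist
      proof eventually_elim
        case (elim x)
        \<comment> \<open>The n - 1 powers of the cutoff that survive differentiation match the n -
          1 rows of Df that survive the replacement. This is why the test function is an n-th
          power.\<close>
        define p where "p = \<eta> R x * q x"
        define \<gamma> where "\<gamma> = g (x /\<^sub>R R)"
        have q0: "q x \<ge> 0" using elim abs_ge_zero order.trans by blast
        have K0: "K x > 0" using K(1)[of x] by simp
        have p0: "p \<ge> 0" unfolding p_def using \<eta>0 q0 by simp
        have \<gamma>0: "\<gamma> \<ge> 0" unfolding \<gamma>_def by (rule g0)
        have "\<bar>\<Phi> R j x\<bar> \<le> real ?n * \<eta> R x ^ (?n - 1) * (\<gamma> / R)" for j
        proof -
          have "\<bar>h' j (x /\<^sub>R R)\<bar> \<le> \<gamma>" unfolding \<gamma>_def g_def by (rule member_le_sum) auto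
          then show ?thesis unfolding \<Phi>_def abs_mult using R0 \<eta>0(1)
            by (intro mult_mono) (auto simp: divide_right_mono)
        qed
        then have "\<bar>?b x\<bar> \<le> M * (fact ?n * ((real ?n * \<eta> R x ^ (?n - 1) * (\<gamma> / R)) * q x ^ (?n - 1)))"
          unfolding abs_mult using elim M0 by (intro mult_mono M abs_det_replace_row_le) auto
        also have "\<dots> = C * \<gamma> * (p ^ (?n - 1) / R)"
          by (simp add: C_def p_def power_mult_distrib mult_ac)
        also have "\<dots> \<le> C * \<gamma> * (p ^ ?n / (\<epsilon> * K x) + \<epsilon> ^ (?n - 1) * K x ^ (?n - 1) / R ^ ?n)"
          by (intro mult_left_mono young_split p0 K0 R0 \<epsilon>) (use C \<gamma>0 n2 in auto)
        also have "\<dots> \<le> C * \<gamma> * (\<eta> R x ^ ?n * J x / \<epsilon> + \<epsilon> ^ (?n - 1) * K x ^ (?n - 1) / R ^ ?n)"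
        proof (intro mult_left_mono add_right_mono)
          have "p ^ ?n \<le> \<eta> R x ^ ?n * (K x * J x)"
            unfolding p_def power_mult_distrib using elim \<eta>0 by (intro mult_left_mono) (auto simp: J_def)
          then have "p ^ ?n / (\<epsilon> * K x) \<le> \<eta> R x ^ ?n * (K x * J x) / (\<epsilon> * K x)"
            using \<epsilon> K0 by (intro divide_right_mono) auto
          also have "\<dots> = \<eta> R x ^ ?n * J x / \<epsilon>" using K0 \<epsilon> by (simp add: field_simps)
          finally show "p ^ ?n / (\<epsilon> * K x) \<le> \<eta> R x ^ ?n * J x / \<epsilon>" .
        qed (use C \<gamma>0 in auto)
        also have "\<dots> = C / \<epsilon> * (\<gamma> * (\<eta> R x ^ ?n * J x)) + C * \<gamma> * (\<epsilon> ^ (?n - 1) / R ^ ?n) * K x ^ (?n - 1)"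
          by (simp add: field_simps)
        \<comment> \<open>Here \<gamma> is traded for its bound \<open>C1\<close> on the ball where
          it can be nonzero, so that the growth hypothesis on K applies.\<close>
        also have "C * \<gamma> * (\<epsilon> ^ (?n - 1) / R ^ ?n) * K x ^ (?n - 1) \<le> ?D * ?k x"
        proof (cases "norm x \<le> real ?n * R")
          case True
          have "\<gamma> \<le> C1" using C1(2)[of "x /\<^sub>R R"] by (simp add: \<gamma>_def)
          then have "C * \<gamma> * (\<epsilon> ^ (?n - 1) / R ^ ?n) * K x ^ (?n - 1) \<le> C * C1 * (\<epsilon> ^ (?n - 1) / R ^ ?n) * K x ^ (?n - 1)"
            using C \<epsilon> R0 K0 by (intro mult_right_mono mult_left_mono) auto
          then show ?thesis using True by simp
        next
          case False
          then have "real ?n \<le> norm (x /\<^sub>R R)" using R0 by (simp add: field_simps)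
          then have "\<gamma> = 0" unfolding \<gamma>_def by (rule g_supp)
          then show ?thesis using False by simp
        qed
        finally show ?case unfolding \<gamma>_def by simp
      qed
    qed
    also have "\<dots> = C / \<epsilon> * G R + ?D * (\<integral>x. ?k x \<partial>lborel)"
      unfolding G_def
      by (simp only: integral_mult_right_zero Bochner_Integration.integral_add[OF
            integrable_mult_right[OF intG[OF R0]] integrable_mult_right[OF ki]])
    also have "?D * (\<integral>x. ?k x \<partial>lborel) \<le> ?D * (\<kappa> * (real ?n * R) ^ ?n)"
      using C C1(1) \<epsilon> R0 by (intro mult_left_mono K(3) nR) auto
    also have "?D * (\<kappa> * (real ?n * R) ^ ?n) = C2 * \<epsilon> ^ (?n - 1)"
      using R0 by (simp add: C2_def power_mult_distrib field_simps)
    finally show ?thesis by simp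
  qed
  have GI: "G R \<le> C1 * I R" if "R \<ge> 1" for R
  proof -
    have R0: "R > 0" using that by simp
    have "G R \<le> (\<integral>x. C1 * (\<eta> R x ^ ?n * J x) \<partial>lborel)" unfolding G_def
    proof (rule integral_mono_AE)
      show "AE x in lborel. g (x /\<^sub>R R) * (\<eta> R x ^ ?n * J x) \<le> C1 * (\<eta> R x ^ ?n * J x)"
        using J
      proof eventually_elim
        case (elim x)
        then show ?case using C1(2)[of "x /\<^sub>R R"] \<eta>0(1)[of R x] by (intro mult_right_mono) auto
      qed
    qed (use intG[OF R0] intJ[OF R0] in auto)
    then show ?thesis by (simp add: I_def)
  qed
  \<comment> \<open>Makes C C1 / \<epsilon>1 at most 1 / 2. Since G R \<le> C1 I R and I R is finite
    for each fixed R, half of I R can be absorbed, which leaves the bound \<open>B\<close>,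
    independent of R.\<close>
  define \<epsilon>1 where "\<epsilon>1 = 2 * (C * C1 + 1)"
  have \<epsilon>1: "\<epsilon>1 > 0" unfolding \<epsilon>1_def using C C1(1) by (simp add: add_nonneg_pos)
  define B where "B = 2 * (C2 * \<epsilon>1 ^ (?n - 1))"
  have Inn: "I R \<ge> 0" for R unfolding I_def
  proof (rule integral_nonneg_AE)
    show "AE x in lborel. 0 \<le> \<eta> R x ^ ?n * J x" using J by eventually_elim (simp add: \<eta>0)
  qed
  have IB: "I R \<le> B" if "R \<ge> 1" for R
  proof -
    have "C / \<epsilon>1 * G R \<le> C / \<epsilon>1 * (C1 * I R)" using GI[OF that] C \<epsilon>1 by (intro mult_left_mono) auto
    also have "\<dots> = (C * C1 / \<epsilon>1) * I R" by simp
    also have "\<dots> \<le> (1 / 2) * I R"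
      by (intro mult_right_mono Inn) (use C C1(1) \<epsilon>1 in \<open>simp add: \<epsilon>1_def field_simps\<close>)
    finally show ?thesis using main[OF that \<epsilon>1] unfolding B_def by linarith
  qed
  define Rn where "Rn m = real (Suc m)" for m
  have Rn: "Rn m \<ge> 1" "Rn m > 0" for m by (auto simp: Rn_def)
  have toz: "(\<lambda>m. x /\<^sub>R Rn m) \<longlonglongrightarrow> 0" for x :: "real ^ 'n"
  proof -
    have "(\<lambda>m. inverse (real (Suc m)) *\<^sub>R x) \<longlonglongrightarrow> 0 *\<^sub>R x"
      by (intro tendsto_intros LIMSEQ_inverse_real_of_nat)
    then show ?thesis by (simp add: Rn_def)
  qed
  have lim\<eta>: "(\<lambda>m. \<eta> (Rn m) x) \<longlonglongrightarrow> h 0" for x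
    unfolding \<eta>_def by (rule continuous_on_tendsto_compose[OF ch(1) toz]) auto
  have limg: "(\<lambda>m. g (x /\<^sub>R Rn m)) \<longlonglongrightarrow> 0" for x
    using continuous_on_tendsto_compose[OF ch(3) toz] by (simp add: g_0)
  \<comment> \<open>Fatou's lemma: as R grows, the cutoffs tend pointwise to the positive constant h
    0, which is not normalised to 1.\<close>
  have "(\<integral>\<^sup>+x. ennreal (h 0 ^ ?n * J x) \<partial>lborel) \<le> ennreal B"
  proof -
    have "(\<integral>\<^sup>+x. ennreal (h 0 ^ ?n * J x) \<partial>lborel) = (\<integral>\<^sup>+x. liminf (\<lambda>m. ennreal (\<eta> (Rn m) x ^ ?n * J x)) \<partial>lborel)"
    proof (intro nn_integral_cong)
      fix x
      have "(\<lambda>m. ennreal (\<eta> (Rn m) x ^ ?n * J x)) \<longlonglongrightarrow> ennreal (h 0 ^ ?n * J x)"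
        by (intro tendsto_ennrealI tendsto_intros lim\<eta>)
      then show "ennreal (h 0 ^ ?n * J x) = liminf (\<lambda>m. ennreal (\<eta> (Rn m) x ^ ?n * J x))"
        by (simp add: lim_imp_Liminf)
    qed
    also have "\<dots> \<le> liminf (\<lambda>m. \<integral>\<^sup>+x. ennreal (\<eta> (Rn m) x ^ ?n * J x) \<partial>lborel)"
      by (rule nn_integral_liminf) measurable
    also have "\<dots> \<le> liminf (\<lambda>m. ennreal B)"
    proof (intro Liminf_mono always_eventually allI)
      fix m
      have "(\<integral>\<^sup>+x. ennreal (\<eta> (Rn m) x ^ ?n * J x) \<partial>lborel) = ennreal (I (Rn m))"
        unfolding I_def
      proof (rule nn_integral_eq_integral[OF intJ[OF Rn(2)]])
        show "AE x in lborel. 0 \<le> \<eta> (Rn m) x ^ ?n * J x" using J by eventually_elim (simp add: \<eta>0)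
      qed
      also have "\<dots> \<le> ennreal B" by (intro ennreal_leI IB Rn)
      finally show "(\<integral>\<^sup>+x. ennreal (\<eta> (Rn m) x ^ ?n * J x) \<partial>lborel) \<le> ennreal B" .
    qed
    also have "\<dots> = ennreal B" by (simp add: Liminf_const)
    finally show ?thesis .
  qed
  then have "integrable lborel (\<lambda>x. h 0 ^ ?n * J x)"
  proof (intro integrableI_nonneg)
    show "AE x in lborel. 0 \<le> h 0 ^ ?n * J x" using J by eventually_elim (simp add: h0(2))
  qed (auto simp: le_less_trans)
  then have Ji: "integrable lborel J" using h0(1) by simp
  have dom: "AE x in lborel. \<bar>\<eta> R x ^ ?n * J x\<bar> \<le> C0 ^ ?n * \<bar>J x\<bar>" for R
    unfolding abs_mult by (intro AE_I2 mult_right_mono) (auto simp: \<eta>0 intro!: power_mono)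
  have limI: "(\<lambda>m. I (Rn m)) \<longlonglongrightarrow> (\<integral>x. h 0 ^ ?n * J x \<partial>lborel)"
    unfolding I_def
  proof (rule integral_dominated_convergence[where w="\<lambda>x. C0 ^ ?n * \<bar>J x\<bar>"])
    show "AE x in lborel. (\<lambda>m. \<eta> (Rn m) x ^ ?n * J x) \<longlonglongrightarrow> h 0 ^ ?n * J x"
      by (intro AE_I2 tendsto_intros lim\<eta>)
  qed (use Ji dom in auto)
  \<comment> \<open>Pointwise, g (x / R) tends to g 0 = 0; the integrability of J just obtained
    supplies the majorant.\<close>
  have limG: "(\<lambda>m. G (Rn m)) \<longlonglongrightarrow> (\<integral>x. 0 \<partial>(lborel :: (real ^ 'n) measure))"
    unfolding G_def
  proof (rule integral_dominated_convergence[where w="\<lambda>x. C1 * (C0 ^ ?n * \<bar>J x\<bar>)"])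
    show "AE x in lborel. (\<lambda>m. g (x /\<^sub>R Rn m) * (\<eta> (Rn m) x ^ ?n * J x)) \<longlonglongrightarrow> 0"
    proof (rule AE_I2)
      fix x
      have "(\<lambda>m. g (x /\<^sub>R Rn m) * (\<eta> (Rn m) x ^ ?n * J x)) \<longlonglongrightarrow> 0 * (h 0 ^ ?n * J x)"
        by (intro tendsto_intros lim\<eta> limg)
      then show "(\<lambda>m. g (x /\<^sub>R Rn m) * (\<eta> (Rn m) x ^ ?n * J x)) \<longlonglongrightarrow> 0" by simp
    qed
    show "AE x in lborel. norm (g (x /\<^sub>R Rn m) * (\<eta> (Rn m) x ^ ?n * J x)) \<le> C1 * (C0 ^ ?n * \<bar>J x\<bar>)" for m
      using dom[of "Rn m"]
    proof eventually_elim
      case (elim x)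
      show ?case unfolding real_norm_def abs_mult[of "g _"] using elim C1 by (intro mult_mono) auto
    qed
  qed (use Ji in auto)
  define X where "X = h 0 ^ ?n * (\<integral>x. J x \<partial>lborel)"
  \<comment> \<open>R tends to infinity in \<open>main\<close> with \<epsilon> held fixed, so the
    factor 1 / \<epsilon> multiplies a quantity that vanishes.\<close>
  have Xle: "X \<le> C2 * \<epsilon> ^ (?n - 1)" if \<epsilon>: "\<epsilon> > 0" for \<epsilon>
  proof -
    have l1: "(\<lambda>m. C / \<epsilon> * G (Rn m) + C2 * \<epsilon> ^ (?n - 1)) \<longlonglongrightarrow> C / \<epsilon> * 0 + C2 * \<epsilon> ^ (?n - 1)"
      using limG by (intro tendsto_intros) simp
    have l2: "(\<lambda>m. I (Rn m)) \<longlonglongrightarrow> X" using limI by (simp add: X_def)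
    have "X \<le> C / \<epsilon> * 0 + C2 * \<epsilon> ^ (?n - 1)"
      by (rule LIMSEQ_le[OF l2 l1]) (use main[OF Rn(1) \<epsilon>] in blast)
    then show ?thesis by simp
  qed
  have "X \<le> 0"
  proof (rule ccontr)
    assume "\<not> X \<le> 0"
    then have X: "X > 0" by simp
    \<comment> \<open>As \<epsilon> \<le> 1 and n - 1 \<ge> 1, the power \<epsilon>^(n-1) is at most
      \<epsilon>, and the second entry of the minimum makes C2 \<epsilon> smaller than X.\<close>
    define \<epsilon> where "\<epsilon> = min 1 (X / (2 * (C2 + 1)))"
    have \<epsilon>: "0 < \<epsilon>" "\<epsilon> \<le> 1" "\<epsilon> \<le> X / (2 * (C2 + 1))" using X C2 by (auto simp: \<epsilon>_def)
    have "\<epsilon> ^ (?n - 1) \<le> \<epsilon> ^ 1" using \<epsilon> n2 by (intro power_decreasing) auto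
    then have "X \<le> C2 * \<epsilon>" using Xle[OF \<epsilon>(1)] mult_left_mono[OF _ C2] by (metis order.trans power_one_right)
    also have "\<dots> \<le> C2 * (X / (2 * (C2 + 1)))" by (intro mult_left_mono \<epsilon> C2)
    also have "\<dots> < X" using X C2 by (simp add: field_simps add_nonneg_pos)
    finally show False by simp
  qed
  then have "(\<integral>x. J x \<partial>lborel) \<le> 0" using zero_less_power[OF h0(1), of ?n] by (simp add: X_def mult_le_0_iff)
  moreover have "(\<integral>x. J x \<partial>lborel) \<ge> 0" by (rule integral_nonneg_AE[OF J])
  ultimately have "(\<integral>x. J x \<partial>lborel) = 0" by simp
  then have "AE x in lborel. J x = 0" using integral_nonneg_eq_0_iff_AE[OF Ji J] by simp
  with dist show ?thesis
  proof eventually_elim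
    case (elim x)
    have q0: "q x \<ge> 0" using elim abs_ge_zero order.trans by blast
    have "q x ^ ?n \<le> 0" using elim by (simp add: J_def)
    then have "q x = 0" using q0 by (metis order.antisym power_eq_0_iff zero_le_power)
    then show ?case using elim by auto
  qed
qed

section \<open>Reduction to Borel representatives\<close>


lemma measurable_lebesgue_on_UNIV:
  "f \<in> borel_measurable (lebesgue_on UNIV) \<longleftrightarrow> f \<in> borel_measurable lebesgue"
  by (simp only: lebesgue_on_UNIV_eq)

lemma vec_nth_measurable_lebesgue:
  fixes f :: "'a::euclidean_space \<Rightarrow> 'b::real_normed_vector ^ 'n"
  assumes "f \<in> borel_measurable lebesgue"
  shows "(\<lambda>x. f x $ i) \<in> borel_measurable lebesgue"
  by (rule borel_measurable_continuous_on[OF _ assms])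
    (intro linear_continuous_on bounded_linear_vec_nth)

lemma borel_matrix_version:
  fixes A :: "'a::euclidean_space \<Rightarrow> real ^ 'n ^ 'm"
  assumes "A \<in> borel_measurable lebesgue"
  obtains B where "\<And>i j. B i j \<in> borel_measurable borel" "\<And>i j. AE x in lborel. A x $ i $ j = B i j x"
proof -
  let ?P = "\<lambda>i j F. F \<in> borel_measurable borel \<and> (AE x in lborel. A x $ i $ j = F x)"
  have "\<exists>F. ?P i j F" for i j
    using completion_ex_borel_measurable_real[OF vec_nth_measurable_lebesgue[OF vec_nth_measurable_lebesgue[OF assms]], of i j]
    by auto
  then have "?P i j (SOME F. ?P i j F)" for i j by (rule someI_ex)
  then show thesis by (intro that[of "\<lambda>i j. SOME F. ?P i j F"]) blast+
qed

text \<open>Applied with p = 1 to the components of f and of its weak differential, and with p = n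
  to the n-th powers of the entries.\<close>

lemma Lp_loc_imp_loc_integrable:
  fixes g :: "real ^ 'n \<Rightarrow> real"
  assumes u: "Lp_loc UNIV p u" and g: "g \<in> borel_measurable borel"
    and le: "AE x in lborel. \<bar>g x\<bar> \<le> norm (u x) powr p"
  shows "loc_integrable g"
  unfolding loc_integrable_def
proof (intro conjI allI g)
  fix R
  let ?C = "cball 0 R :: (real ^ 'n) set"
  have "integrable (lebesgue_on ?C) (\<lambda>x. norm (u x) powr p)"
    using u by (auto simp: Lp_loc_def)
  then have "integrable lebesgue (\<lambda>x. indicator ?C x *\<^sub>R norm (u x) powr p)"
    by (subst (asm) integrable_restrict_space) auto
  moreover have m: "(\<lambda>x. indicat_real ?C x *\<^sub>R g x) \<in> borel_measurable lborel"
    using g by (intro borel_measurable_scaleR borel_measurable_indicator) auto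
  ultimately have "integrable lebesgue (\<lambda>x. indicat_real ?C x *\<^sub>R g x)"
  proof (rule Bochner_Integration.integrable_bound[OF _ measurable_completion])
    show "AE x in lebesgue. norm (indicat_real ?C x *\<^sub>R g x) \<le> norm (indicat_real ?C x *\<^sub>R norm (u x) powr p)"
      using AE_completion[OF le] by eventually_elim (auto simp: indicator_def)
  qed
  then show "set_integrable lborel ?C g"
    unfolding set_integrable_def using integrable_completion[OF m] by simp
qed

lemma test_function_continuous:
  assumes "\<phi> \<in> test_functions S"
  shows "continuous_on UNIV \<phi>" "continuous_on UNIV (partial_deriv j \<phi>)"
proof -
  have "Ck_function k \<phi>" for k using assms by (auto simp: test_functions_def)
  from this[of 0] this[of "Suc 0"] show "continuous_on UNIV \<phi>" "continuous_on UNIV (partial_deriv j \<phi>)" by auto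
qed

lemma integral_lebesgue_AE_eq:
  fixes u v :: "'a::euclidean_space \<Rightarrow> real"
  assumes "u \<in> borel_measurable lebesgue" "v \<in> borel_measurable borel" "AE x in lborel. u x = v x"
    and "continuous_on UNIV \<psi>"
  shows "integral\<^sup>L (lebesgue_on UNIV) (\<lambda>x. u x * \<psi> x) = (\<integral>x. v x * \<psi> x \<partial>lborel)"
proof -
  have \<psi>: "\<psi> \<in> borel_measurable borel" using assms(4) by (rule continuous_imp_borel)
  have v: "(\<lambda>x. v x * \<psi> x) \<in> borel_measurable lborel" using assms(2) \<psi> by simp
  have "integral\<^sup>L lebesgue (\<lambda>x. u x * \<psi> x) = integral\<^sup>L lebesgue (\<lambda>x. v x * \<psi> x)"
  proof (rule integral_cong_AE)
    show "(\<lambda>x. u x * \<psi> x) \<in> borel_measurable lebesgue"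
      using \<psi> by (intro borel_measurable_times assms measurable_completion) simp
    show "(\<lambda>x. v x * \<psi> x) \<in> borel_measurable lebesgue" using v by (rule measurable_completion)
    show "AE x in lebesgue. u x * \<psi> x = v x * \<psi> x"
      using AE_completion[OF assms(3)] by eventually_elim simp
  qed
  also have "\<dots> = (\<integral>x. v x * \<psi> x \<partial>lborel)" by (rule integral_completion[OF v])
  finally show ?thesis by (simp only: lebesgue_on_UNIV_eq)
qed

lemma weak_differential_imp_weak_jacobian:
  fixes f :: "real ^ 'n \<Rightarrow> real ^ 'n"
  assumes w: "weak_differential UNIV f A"
    and F: "\<And>i. F i \<in> borel_measurable borel" "\<And>i. AE x in lborel. f x $ i = F i x"
    and B: "\<And>i j. B i j \<in> borel_measurable borel" "\<And>i j. AE x in lborel. A x $ i $ j = B i j x"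
  shows "weak_jacobian F B"
  unfolding weak_jacobian_def
proof (intro conjI allI ballI)
  have L: "Lp_loc UNIV 1 f" "Lp_loc UNIV 1 A" using w by (auto simp: weak_differential_def)
  then have fm: "f \<in> borel_measurable lebesgue" and Am: "A \<in> borel_measurable lebesgue"
    by (auto simp: Lp_loc_def measurable_lebesgue_on_UNIV)
  fix i j
  show "loc_integrable (F i)"
  proof (rule Lp_loc_imp_loc_integrable[OF L(1) F(1)])
    show "AE x in lborel. \<bar>F i x\<bar> \<le> norm (f x) powr 1"
      using F(2)[of i]
    proof eventually_elim
      case (elim x)
      show ?case using component_le_norm_cart[of "f x" i] by (simp add: elim)
    qed
  qed
  show "loc_integrable (B i j)"
  proof (rule Lp_loc_imp_loc_integrable[OF L(2) B(1)])
    show "AE x in lborel. \<bar>B i j x\<bar> \<le> norm (A x) powr 1"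
      using B(2)[of i j]
    proof eventually_elim
      case (elim x)
      show ?case using component_le_norm_cart[of "A x $ i" j] Finite_Cartesian_Product.norm_nth_le[of "A x" i] by (simp add: elim)
    qed
  qed
  fix \<phi> :: "real ^ 'n \<Rightarrow> real"
  assume \<phi>: "\<phi> \<in> test_functions UNIV"
  note c = test_function_continuous[OF \<phi>]
  have "(\<integral>x. F i x * partial_deriv j \<phi> x \<partial>lborel) = integral\<^sup>L (lebesgue_on UNIV) (\<lambda>x. f x $ i * partial_deriv j \<phi> x)"
    by (rule integral_lebesgue_AE_eq[OF vec_nth_measurable_lebesgue[OF fm] F c(2), symmetric])
  also have "\<dots> = - integral\<^sup>L (lebesgue_on UNIV) (\<lambda>x. A x $ i $ j * \<phi> x)"
    using w \<phi> by (auto simp: weak_differential_def)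
  also have "integral\<^sup>L (lebesgue_on UNIV) (\<lambda>x. A x $ i $ j * \<phi> x) = (\<integral>x. B i j x * \<phi> x \<partial>lborel)"
    by (rule integral_lebesgue_AE_eq[OF vec_nth_measurable_lebesgue[OF vec_nth_measurable_lebesgue[OF Am]] B c(1)])
  finally show "(\<integral>x. F i x * partial_deriv j \<phi> x \<partial>lborel) = - (\<integral>x. B i j x * \<phi> x \<partial>lborel)" .
qed

text \<open>Multiplying the means by the volume of the ball, a constant times R^n, turns their
  boundedness into growth of order R^n.\<close>

lemma mean_distortion_finite_imp:
  fixes K K' :: "real ^ 'n \<Rightarrow> real"
  assumes fin: "mean_distortion (real CARD('n) - 1) K < \<infinity>"
    and K': "K' \<in> borel_measurable borel" "\<And>x. 1 \<le> K' x" "AE x in lborel. K x = K' x"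
  obtains \<kappa> where "loc_integrable (\<lambda>x. K' x ^ (CARD('n) - 1))"
    "\<And>R. R \<ge> 1 \<Longrightarrow> (\<integral>x. indicator (cball 0 R) x * K' x ^ (CARD('n) - 1) \<partial>lborel) \<le> \<kappa> * R ^ CARD('n)"
proof -
  let ?n = "CARD('n)" and ?P = "\<lambda>x. K' x ^ (CARD('n) - 1)"
  \<comment> \<open>The added 1 makes c strictly larger than the supremum, as clearing the
    denominator is done with a strict inequality.\<close>
  define c where "c = enn2real (mean_distortion (real ?n - 1) K + 1)"
  have c: "mean_distortion (real ?n - 1) K < ennreal c" "c \<ge> 0"
  proof -
    have "ennreal c = mean_distortion (real ?n - 1) K + 1"
      unfolding c_def using fin by (intro ennreal_enn2real) (simp add: less_top)
    moreover have "mean_distortion (real ?n - 1) K < mean_distortion (real ?n - 1) K + 1"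
      using fin by (cases "mean_distortion (real ?n - 1) K") (auto simp: ennreal_less_iff simp flip: ennreal_1 ennreal_plus)
    ultimately show "mean_distortion (real ?n - 1) K < ennreal c" by simp
  qed (simp add: c_def)
  define v where "v = unit_ball_vol (real ?n)"
  have v: "v > 0" by (simp add: v_def)
  have [measurable]: "K' \<in> borel_measurable borel" by (rule K')
  have K0: "0 \<le> ?P x" for x using order.trans[OF zero_le_one K'(2)] by simp
  have ball: "(\<integral>\<^sup>+x\<in>ball 0 R. ennreal (?P x) \<partial>lborel) \<le> ennreal (c * (v * R ^ ?n))" if R: "R \<ge> 1" for R
  proof -
    have em: "emeasure lebesgue (ball 0 R :: (real ^ 'n) set) = ennreal (v * R ^ ?n)"
      using R emeasure_ball[of R "0 :: real ^ 'n"] by (simp add: v_def)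
    have "(\<integral>\<^sup>+x\<in>ball 0 R. ennreal (?P x) \<partial>lborel) = (\<integral>\<^sup>+x\<in>ball 0 R. ennreal (?P x) \<partial>lebesgue)"
      by (rule nn_integral_completion[symmetric])
    also have "\<dots> = (\<integral>\<^sup>+x\<in>ball 0 R. ennreal (K x powr (real ?n - 1)) \<partial>lebesgue)"
    proof (rule nn_integral_cong_AE)
      show "AE x in lebesgue. ennreal (?P x) * indicator (ball 0 R) x
          = ennreal (K x powr (real ?n - 1)) * indicator (ball 0 R) x"
        using AE_completion[OF K'(3)]
      proof eventually_elim
        case (elim x)
        have "K' x powr (real ?n - 1) = K' x powr (real (?n - 1))"
          by (simp add: of_nat_diff Suc_leI)
        also have "\<dots> = ?P x" using K'(2)[of x] by (intro powr_realpow) simp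
        finally show ?case by (simp add: elim)
      qed
    qed
    also have "\<dots> \<le> ennreal c * ennreal (v * R ^ ?n)"
    proof -
      have "(\<integral>\<^sup>+x\<in>ball 0 R. ennreal (K x powr (real ?n - 1)) \<partial>lebesgue) / emeasure lebesgue (ball 0 R :: (real ^ 'n) set)
          \<le> mean_distortion (real ?n - 1) K"
        unfolding mean_distortion_def using R by (intro SUP_upper) auto
      also note c(1)
      finally have "(\<integral>\<^sup>+x\<in>ball 0 R. ennreal (K x powr (real ?n - 1)) \<partial>lebesgue)
          < ennreal c * emeasure lebesgue (ball 0 R :: (real ^ 'n) set)"
        by (subst (asm) divide_less_ennreal) (use v R in \<open>auto simp: em\<close>)
      then show ?thesis by (simp add: em)
    qed
    also have "\<dots> = ennreal (c * (v * R ^ ?n))" using c v R by (simp add: ennreal_mult)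
    finally show ?thesis .
  qed
  \<comment> \<open>Doubling the radius fits a closed ball into an open one. The maximum with 1 is
    there because the supremum runs over R \<ge> 1 while local integrability concerns every
    R.\<close>
  have cb: "(\<integral>\<^sup>+x. ennreal (indicat_real (cball 0 R) x * ?P x) \<partial>lborel) \<le> ennreal (c * (v * (2 * max 1 R) ^ ?n))" for R
  proof -
    have "(\<integral>\<^sup>+x. ennreal (indicat_real (cball 0 R) x * ?P x) \<partial>lborel)
        \<le> (\<integral>\<^sup>+x\<in>ball 0 (2 * max 1 R). ennreal (?P x) \<partial>lborel)"
      by (intro nn_integral_mono) (auto simp: indicator_def)
    also have "\<dots> \<le> ennreal (c * (v * (2 * max 1 R) ^ ?n))" by (rule ball) simp
    finally show ?thesis .
  qed
  have int: "integrable lborel (\<lambda>x. indicat_real (cball 0 R) x * ?P x)" for R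
  proof (rule integrableI_nonneg)
    have "indicat_real (cball 0 R) \<in> borel_measurable (borel :: (real ^ 'n) measure)"
      by (rule borel_measurable_indicator) auto
    then show "(\<lambda>x. indicat_real (cball 0 R) x * ?P x) \<in> borel_measurable lborel" by measurable
    show "AE x in lborel. 0 \<le> indicat_real (cball 0 R) x * ?P x" using K0 by simp
    show "(\<integral>\<^sup>+x. ennreal (indicat_real (cball 0 R) x * ?P x) \<partial>lborel) < \<infinity>"
      using cb[of R] by (rule le_less_trans) simp
  qed
  show thesis
  proof (rule that)
    show "loc_integrable ?P" using int by (auto simp: loc_integrable_def set_integrable_def)
    fix R :: real assume R: "R \<ge> 1"
    have "ennreal (\<integral>x. indicat_real (cball 0 R) x * ?P x \<partial>lborel) \<le> ennreal (c * (v * (2 * max 1 R) ^ ?n))"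
      using cb[of R] K0 by (subst nn_integral_eq_integral[OF int, symmetric]) auto
    then have "(\<integral>x. indicat_real (cball 0 R) x * ?P x \<partial>lborel) \<le> c * (v * (2 * max 1 R) ^ ?n)"
      using c v R by (subst (asm) ennreal_le_iff) auto
    also have "\<dots> = (c * v * 2 ^ ?n) * R ^ ?n" using R by (simp add: power_mult_distrib mult_ac)
    finally show "(\<integral>x. indicat_real (cball 0 R) x * ?P x \<partial>lborel) \<le> (c * v * 2 ^ ?n) * R ^ ?n" .
  qed
qed

theorem theorem1p4:
  fixes f :: "real ^ 'n \<Rightarrow> real ^ 'n" and K :: "real ^ 'n \<Rightarrow> real"
  assumes "CARD('n) \<ge> 2"
    and "finite_distortion UNIV f"
    and "distortion_function UNIV f K"
    and "mean_distortion (real CARD('n) - 1) K < \<infinity>"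
    and "\<exists>M::real. AE x in lebesgue. norm (f x) \<le> M"
  shows "\<exists>c. AE x in lebesgue. f x = c"
proof -
  let ?n = "CARD('n)"
  \<comment> \<open>Two weak differentials have to be kept apart for now: A0 is known to be locally
    in L^n, and A1 to satisfy the distortion inequality.\<close>
  obtain A0 where A0: "weak_differential UNIV f A0" "Lp_loc UNIV (real ?n) A0"
    using assms(2) by (auto simp: finite_distortion_def W1_loc_def)
  obtain A1 where A1: "weak_differential UNIV f A1"
    "AE x in lebesgue. onorm ((*v) (A1 x)) ^ ?n \<le> K x * det (A1 x)"
    and Km: "K \<in> borel_measurable lebesgue" "\<And>x. 1 \<le> K x"
    using assms(3) unfolding distortion_function_def lebesgue_on_UNIV_eq by auto
  obtain M where M: "AE x in lebesgue. norm (f x) \<le> M" using assms(5) by blast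
  have meas: "f \<in> borel_measurable lebesgue" "A0 \<in> borel_measurable lebesgue" "A1 \<in> borel_measurable lebesgue"
    using A0 A1 by (auto simp: weak_differential_def Lp_loc_def measurable_lebesgue_on_UNIV)
  have "\<exists>F. F \<in> borel_measurable borel \<and> (AE x in lborel. f x $ i = F x)" for i
    using completion_ex_borel_measurable_real[OF vec_nth_measurable_lebesgue[OF meas(1)], of i] by auto
  then obtain F' where F': "\<And>i. F' i \<in> borel_measurable borel" "\<And>i. AE x in lborel. f x $ i = F' i x" by metis
  obtain B0 where B0: "\<And>i j. B0 i j \<in> borel_measurable borel" "\<And>i j. AE x in lborel. A0 x $ i $ j = B0 i j x"
    using borel_matrix_version[OF meas(2)] by blast
  obtain B1 where B1: "\<And>i j. B1 i j \<in> borel_measurable borel" "\<And>i j. AE x in lborel. A1 x $ i $ j = B1 i j x"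
    using borel_matrix_version[OF meas(3)] by blast
  obtain K1 where K1: "K1 \<in> borel_measurable borel" "AE x in lborel. K x = K1 x"
    using completion_ex_borel_measurable_real[OF Km(1)] by auto
  \<comment> \<open>Restores the lower bound 1 at every point, which the Borel representative has
    only almost everywhere.\<close>
  define K' where "K' x = max 1 (K1 x)" for x
  have K': "K' \<in> borel_measurable borel" "\<And>x. 1 \<le> K' x" "AE x in lborel. K x = K' x"
  proof -
    show "K' \<in> borel_measurable borel" unfolding K'_def[abs_def] using K1(1) by measurable
    show "AE x in lborel. K x = K' x"
      using K1(2)
    proof eventually_elim
      case (elim x)
      then show ?case using Km(2)[of x] by (simp add: K'_def)
    qed
  qed (simp add: K'_def)
  \<comment> \<open>Truncation turns the almost everywhere bound into a pointwise one and changes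
    the component only on a null set. The modulus of M keeps the interval nonempty.\<close>
  define F where "F i x = max (- \<bar>M\<bar>) (min \<bar>M\<bar> (F' i x))" for i x
  have F: "\<And>i. F i \<in> borel_measurable borel" "\<And>i. AE x in lborel. f x $ i = F i x" "\<And>i x. \<bar>F i x\<bar> \<le> \<bar>M\<bar>"
  proof -
    show "F i \<in> borel_measurable borel" for i unfolding F_def[abs_def] using F'(1)[of i] by measurable
    show "AE x in lborel. f x $ i = F i x" for i
      using F'(2)[of i] M[unfolded AE_completion_iff]
    proof eventually_elim
      case (elim x)
      then show ?case using component_le_norm_cart[of "f x" i] by (simp add: F_def)
    qed
    show "\<bar>F i x\<bar> \<le> \<bar>M\<bar>" for i x by (simp add: F_def abs_le_iff)
  qed
  have w0: "weak_jacobian F B0" and w1: "weak_jacobian F B1"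
    using weak_differential_imp_weak_jacobian[OF A0(1) F(1,2) B0] weak_differential_imp_weak_jacobian[OF A1(1) F(1,2) B1]
    by blast+
  have Bn: "loc_integrable (\<lambda>x. \<bar>B0 i j x\<bar> ^ ?n)" for i j
  proof (rule Lp_loc_imp_loc_integrable[OF A0(2)])
    show "(\<lambda>x. \<bar>B0 i j x\<bar> ^ ?n) \<in> borel_measurable borel" using B0(1)[of i j] by measurable
    show "AE x in lborel. \<bar>\<bar>B0 i j x\<bar> ^ ?n\<bar> \<le> norm (A0 x) powr real ?n"
      using B0(2)[of i j]
    proof eventually_elim
      case (elim x)
      have "\<bar>B0 i j x\<bar> \<le> norm (A0 x)"
        using component_le_norm_cart[of "A0 x $ i" j] Finite_Cartesian_Product.norm_nth_le[of "A0 x" i] by (simp add: elim)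
      then show ?case by (simp add: powr_realpow' power_mono)
    qed
  qed
  obtain \<kappa> where \<kappa>: "loc_integrable (\<lambda>x. K' x ^ (?n - 1))"
    "\<And>R. R \<ge> 1 \<Longrightarrow> (\<integral>x. indicator (cball 0 R) x * K' x ^ (?n - 1) \<partial>lborel) \<le> \<kappa> * R ^ ?n"
    using mean_distortion_finite_imp[OF assms(4) K'] by blast
  \<comment> \<open>The distortion inequality passes from A1 to the representative of A0 by
    uniqueness, so that one matrix field has both properties.\<close>
  have "AE x in lborel. (\<forall>i j. \<bar>B0 i j x\<bar> \<le> onorm ((*v) (A1 x))) \<and>
      onorm ((*v) (A1 x)) ^ ?n \<le> K' x * det (\<chi> i j. B0 i j x)"
  proof -
    have "AE x in lborel. \<forall>i j. B0 i j x = B1 i j x"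
      by (simp only: AE_all_countable[symmetric] eventually_all_finite weak_jacobian_unique[OF w0 w1])
    moreover have "AE x in lborel. \<forall>i j. A1 x $ i $ j = B1 i j x"
      by (simp only: eventually_all_finite B1(2))
    ultimately show ?thesis
      using K'(3) A1(2)[unfolded AE_completion_iff]
    proof eventually_elim
      case (elim x)
      then have eq: "B0 i j x = A1 x $ i $ j" for i j by simp
      then have mat: "(\<chi> i j. B0 i j x) = A1 x" by (simp add: vec_eq_iff)
      have "\<forall>i j. \<bar>B0 i j x\<bar> \<le> onorm ((*v) (A1 x))"
        by (simp only: eq matrix_component_le_onorm simp_thms)
      then show ?case using elim(4) unfolding mat elim(3) by blast
    qed
  qed
  from weak_jacobian_eq_0[OF assms(1) w0 F(3) Bn K'(2) \<kappa> this]
  have "AE x in lborel. B0 i j x = 0" for i j by (auto elim!: eventually_mono)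
  then have "\<exists>c. AE x in lborel. F i x = c" for i
    by (rule weak_jacobian_0_imp_const[OF w0])
  then obtain c where c: "\<And>i. AE x in lborel. F i x = c i" by metis
  have "AE x in lborel. f x $ i = c i" for i
    using F(2)[of i] c[of i] by eventually_elim simp
  then have "AE x in lborel. \<forall>i. f x $ i = c i"
    by (simp add: eventually_all_finite)
  then have "AE x in lborel. f x = (\<chi> i. c i)"
    by eventually_elim (simp add: vec_eq_iff)
  then show ?thesis by (blast intro: AE_completion)
qed

end
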